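(* Let $(M,g)$ be a Riemannian manifold with non-positive sectional curvature. Then the Geodesic Implicit Euler (GIE) method $\phi_{h,X}$, defined on $M$ by $y_1=\phi_{h,X}(y_0)$ if and only if $y_0=\exp_{y_1}\left(-hX|_{y_1}\right)$, is B-stable. Explicitly: suppose that for every non-expansive system $(\mathcal{U},X,g,\nu)$ on $M$ the GIE map $\phi_{h,X}$ is well defined on $\mathcal{U}$ for all $h>0$ and $\mathcal{U}$ is $\phi_{h,X}$-invariant for all $h>0$ (that is, for every $h>0$ and $y_0\in\mathcal{U}$ there is exactly one $y_1\in\mathcal{U}$ with $-hX|_{y_1}$ in the domain of $\exp_{y_1}$ and $\exp_{y_1}(-hX|_{y_1})=y_0$, and $\phi_{h,X}(y_0):=y_1$). Then for every non-expansive system $(\mathcal{U},X,g,\nu)$ on $M$, $$d\left(\phi_{h,X}(x_0),\phi_{h,X}(y_0)\right)\le d(x_0,y_0)\qquad\text{for all } x_0,y_0\in\mathcal{U},\ h>0.$$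
   Context: $M$ is a smooth finite-dimensional manifold with Riemannian metric $g=\langle\cdot,\cdot\rangle$, norm $\|v\|=\langle v,v\rangle^{1/2}$, Levi-Civita connection $\nabla$, Riemannian exponential map $\exp_p$ (defined on a subset of $T_pM$), and Riemannian distance $d$ (infimum of lengths of curves in $M$ connecting two points). A set $\mathcal{U}\subseteq M$ is geodesically convex if for each $p,q\in\mathcal{U}$ there is a unique minimizing geodesic segment from $p$ to $q$ contained entirely in $\mathcal{U}$. For a smooth vector field $X$ on $M$, $\exp(tX)$ denotes its $t$-flow. $X$ is forward complete on $\mathcal{U}$ if $\exp(tX)p$ is defined for all $t\ge 0$ and all $p\in\mathcal{U}$; $\mathcal{U}$ is forward $X$-invariant if $\exp(tX)p\in\mathcal{U}$ for all $t\ge0$, $p\in\mathcal{U}$. $X$ satisfies the monotonicity condition on $\mathcal{U}$ with constant $\nu\in\mathbb{R}$ if $\langle\nabla_{v_x}X,v_x\rangle\le\nu\|v_x\|^2$ for every $x\in\mathcal{U}$ and $v_x\in T_xM$. A non-expansive system on $(M,g)$ is a quadruple $(\mathcal{U},X,g,\nu)$ where $\mathcal{U}\subseteq M$ is open and geodesically convex, $X$ is a smooth vector field on $M$ that is forward complete on $\mathcal{U}$, $\mathcal{U}$ is forward $X$-invariant, and $X$ satisfies the monotonicity condition on $\mathcal{U}$ with constant $\nu\le 0$. B-stability: let $\phi_{h,X}$ be a numerical method on $M$, and suppose that for any non-expansive system $(\mathcal{U},X,g,\nu)$ on $M$, (i) $\phi_{h,X}$ is well defined on $\mathcal{U}$ for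 all $h>0$, and (ii) $\mathcal{U}$ is $\phi_{h,X}$-invariant for all $h>0$, i.e. $\phi_{h,X}(y)\in\mathcal{U}$ for $y\in\mathcal{U}$. If $d(\phi_{h,X}(x_0),\phi_{h,X}(y_0))\le d(x_0,y_0)$ for all such systems, all $x_0,y_0\in\mathcal{U}$ and all $h>0$, then the method is called B-stable. *)

theory Defs
  imports "HOL-Analysis.Analysis"
begin

section \<open>Smooth functions on open subsets of a Euclidean space\<close>

text \<open>Meant for open \<open>S\<close> and a finite-dimensional source, where continuity of all directional
  derivatives is continuity of the total derivative.\<close>

primrec Ck_on :: "nat \<Rightarrow> ('e::euclidean_space \<Rightarrow> 'f::real_normed_vector) \<Rightarrow> 'e set \<Rightarrow> bool" where
  "Ck_on 0 f S \<longleftrightarrow> continuous_on S f"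
| "Ck_on (Suc k) f S \<longleftrightarrow>
     (\<forall>x\<in>S. f differentiable (at x)) \<and> (\<forall>v. Ck_on k (\<lambda>x. frechet_derivative f (at x) v) S)"

definition smooth_on :: "'e::euclidean_space set \<Rightarrow> ('e \<Rightarrow> 'f::real_normed_vector) \<Rightarrow> bool" where
  "smooth_on S f \<longleftrightarrow> (\<forall>k. Ck_on k f S)"


section \<open>Smooth manifolds\<close>

text \<open>A chart is a pair of its domain and its coordinate map (irrelevant off the domain). The
  manifold is the whole type \<open>'a\<close>; the model space \<open>'e\<close> fixes the dimension.\<close>

type_synonym ('a, 'e) chart = "'a set \<times> ('a \<Rightarrow> 'e)"

definition is_chart :: "('a::topological_space, 'e::euclidean_space) chart \<Rightarrow> bool" where
  "is_chart c \<longleftrightarrow> open (fst c) \<and> open (snd c ` fst c) \<and> inj_on (snd c) (fst c) \<and>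
     continuous_on (fst c) (snd c) \<and> continuous_on (snd c ` fst c) (inv_into (fst c) (snd c))"

text \<open>A tangent vector at \<open>p\<close> is the family of its coordinate representations in all charts
  around \<open>p\<close> (and \<open>0\<close> at the other charts); see \<open>tangent_space\<close> below.\<close>

type_synonym ('a, 'e) tvec = "('a, 'e) chart \<Rightarrow> 'e"

type_synonym ('a, 'e) vfield = "'a \<Rightarrow> ('a, 'e) tvec"

locale smooth_manifold =
  fixes A :: "('a::{t2_space, second_countable_topology}, 'e::euclidean_space) chart set"
  assumes charts: "c \<in> A \<Longrightarrow> is_chart c"
    and covering: "(\<Union>c\<in>A. fst c) = UNIV"
    and compatible: "c \<in> A \<Longrightarrow> c' \<in> A \<Longrightarrow>
      smooth_on (snd c ` (fst c \<inter> fst c')) (snd c' \<circ> inv_into (fst c) (snd c))"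
begin

definition charts_at :: "'a \<Rightarrow> ('a, 'e) chart set" where
  "charts_at p = {c \<in> A. p \<in> fst c}"

text \<open>The local expression \<open>f \<circ> \<phi>\<^sup>-\<^sup>1\<close> of a function \<open>f\<close> on the manifold in a chart \<open>\<phi>\<close>, and its
  derivative at (the coordinates of) \<open>p\<close> in the coordinate direction \<open>a\<close>.\<close>

definition in_chart :: "('a, 'e) chart \<Rightarrow> ('a \<Rightarrow> 'f) \<Rightarrow> 'e \<Rightarrow> 'f" where
  "in_chart c f = f \<circ> inv_into (fst c) (snd c)"

definition chart_deriv :: "('a, 'e) chart \<Rightarrow> ('a \<Rightarrow> 'f::real_normed_vector) \<Rightarrow> 'a \<Rightarrow> 'e \<Rightarrow> 'f" where
  "chart_deriv c f p a = frechet_derivative (in_chart c f) (at (snd c p)) a"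

definition tangent_space :: "'a \<Rightarrow> ('a, 'e) tvec set" where
  "tangent_space p = {v. (\<forall>c. c \<notin> charts_at p \<longrightarrow> v c = 0) \<and>
     (\<forall>c\<in>charts_at p. \<forall>c'\<in>charts_at p. v c' = chart_deriv c (snd c') p (v c))}"

text \<open>The tangent vector at \<open>p\<close> with coordinates \<open>a\<close> in the chart \<open>c\<close>.\<close>

definition coord_vec :: "('a, 'e) chart \<Rightarrow> 'a \<Rightarrow> 'e \<Rightarrow> ('a, 'e) tvec" where
  "coord_vec c p a = (\<lambda>c'. if c' \<in> charts_at p then chart_deriv c (snd c') p a else 0)"

definition tadd :: "('a, 'e) tvec \<Rightarrow> ('a, 'e) tvec \<Rightarrow> ('a, 'e) tvec" where
  "tadd v w = (\<lambda>c. v c + w c)"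

definition tscale :: "real \<Rightarrow> ('a, 'e) tvec \<Rightarrow> ('a, 'e) tvec" where
  "tscale r v = (\<lambda>c. r *\<^sub>R v c)"

text \<open>Coordinate vectors are tangent vectors, and \<open>coord_vec c p\<close> is a linear isomorphism.\<close>

lemma transition_differentiable:
  assumes "c \<in> charts_at p" "c' \<in> charts_at p"
  shows "in_chart c (snd c') differentiable (at (snd c p))"
proof -
  have c: "c \<in> A" "c' \<in> A" "p \<in> fst c \<inter> fst c'"
    using assms by (auto simp: charts_at_def)
  have "Ck_on (Suc 0) (snd c' \<circ> inv_into (fst c) (snd c)) (snd c ` (fst c \<inter> fst c'))"
    using compatible[OF c(1,2)] by (simp add: smooth_on_def del: Ck_on.simps)
  then show ?thesis
    using c(3) by (auto simp: in_chart_def)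
qed

lemma inv_chart: "c \<in> A \<Longrightarrow> p \<in> fst c \<Longrightarrow> inv_into (fst c) (snd c) (snd c p) = p"
  using charts[of c] by (simp add: is_chart_def)

lemma chart_image_open:
  assumes "c \<in> A" "open W"
  shows "open (snd c ` (fst c \<inter> W))"
proof -
  let ?\<psi> = "inv_into (fst c) (snd c)"
  have c: "open (snd c ` fst c)" "continuous_on (snd c ` fst c) ?\<psi>"
    using charts[OF assms(1)] by (auto simp: is_chart_def)
  have "snd c ` (fst c \<inter> W) = ?\<psi> -` W \<inter> snd c ` fst c"
    using inv_chart[OF assms(1)] by auto
  then show ?thesis
    using continuous_on_open_vimage[OF c(1), of ?\<psi>] c(2) assms(2) by metis
qed

lemma chart_deriv_linear:
  assumes "c \<in> charts_at p" "c' \<in> charts_at p"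
  shows "linear (chart_deriv c (snd c') p)"
  unfolding chart_deriv_def
  using linear_frechet_derivative[OF transition_differentiable[OF assms]] by (simp add: eta_contract_eq)

lemma chart_deriv_chain:
  assumes "c \<in> charts_at p" "c' \<in> charts_at p" "c'' \<in> charts_at p"
  shows "chart_deriv c (snd c'') p a = chart_deriv c' (snd c'') p (chart_deriv c (snd c') p a)"
proof -
  have c: "c \<in> A" "c' \<in> A" "p \<in> fst c" "p \<in> fst c'"
    using assms by (auto simp: charts_at_def)
  let ?S = "snd c ` (fst c \<inter> fst c')"
  have S: "open ?S" "snd c p \<in> ?S"
    using chart_image_open[OF c(1), of "fst c'"] charts[OF c(2)] c by (auto simp: is_chart_def)
  have p: "in_chart c (snd c') (snd c p) = snd c' p"
    using inv_chart[OF c(1,3)] by (simp add: in_chart_def)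
  have f: "(in_chart c (snd c') has_derivative frechet_derivative (in_chart c (snd c')) (at (snd c p)))
      (at (snd c p))"
    using transition_differentiable[OF assms(1,2)] frechet_derivative_works by blast
  have h: "(in_chart c' (snd c'') has_derivative
      frechet_derivative (in_chart c' (snd c'')) (at (snd c' p)))
      (at (in_chart c (snd c') (snd c p)))"
    using transition_differentiable[OF assms(2,3)] frechet_derivative_works p by metis
  have "(in_chart c (snd c'') has_derivative
      frechet_derivative (in_chart c' (snd c'')) (at (snd c' p)) \<circ>
      frechet_derivative (in_chart c (snd c')) (at (snd c p))) (at (snd c p))"
    by (rule has_derivative_transform_within_open[OF diff_chain_at[OF f h] S])
       (auto simp: in_chart_def inv_chart c)
  then show ?thesis
    by (simp add: chart_deriv_def frechet_derivative_at[symmetric])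
qed

lemma chart_deriv_self:
  assumes "c \<in> charts_at p"
  shows "chart_deriv c (snd c) p a = a"
proof -
  have c: "c \<in> A" "p \<in> fst c"
    using assms by (auto simp: charts_at_def)
  have S: "open (snd c ` fst c)" "snd c p \<in> snd c ` fst c"
    using charts[OF c(1)] c by (auto simp: is_chart_def)
  have "(in_chart c (snd c) has_derivative (\<lambda>x. x)) (at (snd c p))"
    by (rule has_derivative_transform_within_open[OF has_derivative_ident S])
       (auto simp: in_chart_def inv_chart c)
  then show ?thesis
    by (simp add: chart_deriv_def frechet_derivative_at[symmetric])
qed

lemma coord_vec_tangent:
  assumes "c \<in> charts_at p"
  shows "coord_vec c p a \<in> tangent_space p"
proof -
  have "coord_vec c p a c'' = chart_deriv c' (snd c'') p (coord_vec c p a c')"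
    if "c' \<in> charts_at p" "c'' \<in> charts_at p" for c' c''
    unfolding coord_vec_def if_P[OF that(1)] if_P[OF that(2)]
    by (rule chart_deriv_chain[OF assms that])
  moreover have "coord_vec c p a c' = 0" if "c' \<notin> charts_at p" for c'
    unfolding coord_vec_def if_not_P[OF that] ..
  ultimately show ?thesis
    unfolding tangent_space_def by blast
qed

lemma coord_vec_self: "c \<in> charts_at p \<Longrightarrow> coord_vec c p a c = a"
  by (simp add: coord_vec_def chart_deriv_self)

lemma coord_vec_inverse:
  assumes "c \<in> charts_at p" "v \<in> tangent_space p"
  shows "coord_vec c p (v c) = v"
proof
  fix c'
  have "v c' = (if c' \<in> charts_at p then chart_deriv c (snd c') p (v c) else 0)"
  proof (cases "c' \<in> charts_at p")
    case True
    then have "v c' = chart_deriv c (snd c') p (v c)"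
      using assms unfolding tangent_space_def by blast
    then show ?thesis
      unfolding if_P[OF True] .
  next
    case False
    then have "v c' = 0"
      using assms unfolding tangent_space_def by blast
    then show ?thesis
      unfolding if_not_P[OF False] .
  qed
  then show "coord_vec c p (v c) c' = v c'"
    by (simp only: coord_vec_def)
qed

lemma coord_vec_add:
  "c \<in> charts_at p \<Longrightarrow> coord_vec c p (a + b) = tadd (coord_vec c p a) (coord_vec c p b)"
  by (rule ext) (simp add: coord_vec_def tadd_def linear_add chart_deriv_linear)

lemma coord_vec_scale:
  "c \<in> charts_at p \<Longrightarrow> coord_vec c p (r *\<^sub>R a) = tscale r (coord_vec c p a)"
  by (rule ext) (simp add: coord_vec_def tscale_def linear_scale chart_deriv_linear)

definition tindependent :: "('a, 'e) tvec \<Rightarrow> ('a, 'e) tvec \<Rightarrow> bool" where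
  "tindependent v w \<longleftrightarrow>
     (\<forall>r s. tadd (tscale r v) (tscale s w) = (\<lambda>c. 0) \<longrightarrow> r = 0 \<and> s = 0)"

definition smooth_vfield_on :: "'a set \<Rightarrow> ('a, 'e) vfield \<Rightarrow> bool" where
  "smooth_vfield_on W X \<longleftrightarrow> (\<forall>p\<in>W. X p \<in> tangent_space p) \<and>
     (\<forall>c\<in>A. smooth_on (snd c ` (fst c \<inter> W)) (in_chart c (\<lambda>q. X q c)))"

definition lie_bracket :: "('a, 'e) vfield \<Rightarrow> ('a, 'e) vfield \<Rightarrow> ('a, 'e) vfield" where
  "lie_bracket X Y p = (\<lambda>c. if c \<in> charts_at p
     then chart_deriv c (\<lambda>q. Y q c) p (X p c) - chart_deriv c (\<lambda>q. X q c) p (Y p c) else 0)"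


subsection \<open>Curves\<close>

text \<open>In all notions about curves, \<open>I\<close> is an interval and derivatives at its end points are
  one-sided.\<close>

definition velocity :: "real set \<Rightarrow> (real \<Rightarrow> 'a) \<Rightarrow> real \<Rightarrow> ('a, 'e) tvec" where
  "velocity I \<gamma> t =
     (\<lambda>c. if c \<in> charts_at (\<gamma> t) then vector_derivative (snd c \<circ> \<gamma>) (at t within I) else 0)"

definition C1_curve_on :: "real set \<Rightarrow> (real \<Rightarrow> 'a) \<Rightarrow> bool" where
  "C1_curve_on I \<gamma> \<longleftrightarrow> continuous_on I \<gamma> \<and>
     (\<forall>c\<in>A. (\<forall>t\<in>I. \<gamma> t \<in> fst c \<longrightarrow> (snd c \<circ> \<gamma>) differentiable (at t within I)) \<and>
       continuous_on {t \<in> I. \<gamma> t \<in> fst c} (\<lambda>t. vector_derivative (snd c \<circ> \<gamma>) (at t within I)))"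

definition piecewise_C1_curve_on :: "real \<Rightarrow> real \<Rightarrow> (real \<Rightarrow> 'a) \<Rightarrow> bool" where
  "piecewise_C1_curve_on a b \<gamma> \<longleftrightarrow> continuous_on {a..b} \<gamma> \<and>
     (\<exists>F. finite F \<and> (\<forall>s t. a \<le> s \<and> s < t \<and> t \<le> b \<and> {s<..<t} \<inter> F = {} \<longrightarrow> C1_curve_on {s..t} \<gamma>))"

definition integral_curve_on :: "real set \<Rightarrow> ('a, 'e) vfield \<Rightarrow> (real \<Rightarrow> 'a) \<Rightarrow> bool" where
  "integral_curve_on I X \<gamma> \<longleftrightarrow> continuous_on I \<gamma> \<and>
     (\<forall>t\<in>I. \<forall>c\<in>charts_at (\<gamma> t).
        ((snd c \<circ> \<gamma>) has_vector_derivative X (\<gamma> t) c) (at t within I))"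

definition forward_complete_on :: "'a set \<Rightarrow> ('a, 'e) vfield \<Rightarrow> bool" where
  "forward_complete_on \<U> X \<longleftrightarrow> (\<forall>p\<in>\<U>. \<exists>\<gamma>. integral_curve_on {0..} X \<gamma> \<and> \<gamma> 0 = p)"

definition flow :: "('a, 'e) vfield \<Rightarrow> real \<Rightarrow> 'a \<Rightarrow> 'a" where
  "flow X t p = (THE q. \<exists>\<gamma>. integral_curve_on {0..t} X \<gamma> \<and> \<gamma> 0 = p \<and> \<gamma> t = q)"

definition forward_invariant :: "'a set \<Rightarrow> ('a, 'e) vfield \<Rightarrow> bool" where
  "forward_invariant \<U> X \<longleftrightarrow> (\<forall>p\<in>\<U>. \<forall>t\<ge>0. flow X t p \<in> \<U>)"

end


section \<open>Riemannian manifolds\<close>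

locale riemannian_manifold = smooth_manifold A
  for A :: "('a::{t2_space, second_countable_topology}, 'e::euclidean_space) chart set" +
  fixes g :: "'a \<Rightarrow> ('a, 'e) tvec \<Rightarrow> ('a, 'e) tvec \<Rightarrow> real"
  assumes metric_add: "u \<in> tangent_space p \<Longrightarrow> v \<in> tangent_space p \<Longrightarrow> w \<in> tangent_space p \<Longrightarrow>
      g p (tadd u v) w = g p u w + g p v w"
    and metric_scale: "v \<in> tangent_space p \<Longrightarrow> w \<in> tangent_space p \<Longrightarrow>
      g p (tscale r v) w = r * g p v w"
    and metric_sym: "v \<in> tangent_space p \<Longrightarrow> w \<in> tangent_space p \<Longrightarrow> g p v w = g p w v"
    and metric_pos: "v \<in> tangent_space p \<Longrightarrow> v \<noteq> (\<lambda>c. 0) \<Longrightarrow> g p v v > 0"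
    and metric_smooth: "c \<in> A \<Longrightarrow>
      smooth_on (snd c ` fst c) (in_chart c (\<lambda>q. g q (coord_vec c q a) (coord_vec c q b)))"
begin

definition tnorm :: "'a \<Rightarrow> ('a, 'e) tvec \<Rightarrow> real" where
  "tnorm p v = sqrt (g p v v)"


subsection \<open>Levi-Civita connection and curvature\<close>

text \<open>In a chart a connection is \<open>\<nabla>\<^sub>u Y = D\<^sub>u Y + \<Gamma>(u, Y)\<close> with \<open>\<Gamma>\<close> bilinear. It is torsion-free iff
  \<open>\<Gamma>\<close> is symmetric, and compatible with the metric iff
  \<open>D\<^sub>u (g(a, b)) = g(\<Gamma>(u, a), b) + g(a, \<Gamma>(u, b))\<close> for constant \<open>a\<close>, \<open>b\<close>. Existence and uniqueness
  are proved in \<open>christoffel_ex1\<close> below.\<close>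

definition is_christoffel :: "('a, 'e) chart \<Rightarrow> 'a \<Rightarrow> ('e \<Rightarrow> 'e \<Rightarrow> 'e) \<Rightarrow> bool" where
  "is_christoffel c p \<Gamma> \<longleftrightarrow> bilinear \<Gamma> \<and> (\<forall>u a. \<Gamma> u a = \<Gamma> a u) \<and>
     (\<forall>u a b. chart_deriv c (\<lambda>q. g q (coord_vec c q a) (coord_vec c q b)) p u =
        g p (coord_vec c p (\<Gamma> u a)) (coord_vec c p b) +
        g p (coord_vec c p a) (coord_vec c p (\<Gamma> u b)))"

definition christoffel :: "('a, 'e) chart \<Rightarrow> 'a \<Rightarrow> 'e \<Rightarrow> 'e \<Rightarrow> 'e" where
  "christoffel c p = (THE \<Gamma>. is_christoffel c p \<Gamma>)"

text \<open>The fundamental theorem of Riemannian geometry at one point of a chart; it ensures that the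
  definite description in \<open>christoffel\<close> is meaningful.\<close>

lemma metric_chart_differentiable:
  assumes "c \<in> charts_at p"
  shows "in_chart c (\<lambda>q. g q (coord_vec c q a) (coord_vec c q b)) differentiable (at (snd c p))"
proof -
  have c: "c \<in> A" "p \<in> fst c"
    using assms by (auto simp: charts_at_def)
  have "Ck_on (Suc 0) (in_chart c (\<lambda>q. g q (coord_vec c q a) (coord_vec c q b))) (snd c ` fst c)"
    using metric_smooth[OF c(1)] by (simp add: smooth_on_def del: Ck_on.simps)
  then show ?thesis
    using c(2) by auto
qed

lemma metric_chart_sym:
  "c \<in> charts_at q \<Longrightarrow> g q (coord_vec c q a) (coord_vec c q b) = g q (coord_vec c q b) (coord_vec c q a)"
  by (intro metric_sym coord_vec_tangent)

lemma metric_chart_add: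
  "c \<in> charts_at q \<Longrightarrow> g q (coord_vec c q (a + a')) (coord_vec c q b) =
     g q (coord_vec c q a) (coord_vec c q b) + g q (coord_vec c q a') (coord_vec c q b)"
  by (simp add: coord_vec_add metric_add coord_vec_tangent)

lemma metric_chart_scale:
  "c \<in> charts_at q \<Longrightarrow> g q (coord_vec c q (r *\<^sub>R a)) (coord_vec c q b) =
     r * g q (coord_vec c q a) (coord_vec c q b)"
  by (simp add: coord_vec_scale metric_scale coord_vec_tangent)

lemma chart_deriv_cong:
  assumes "c \<in> charts_at p" "\<And>q. c \<in> charts_at q \<Longrightarrow> f q = h q"
  shows "chart_deriv c f p u = chart_deriv c h p u"
proof -
  have c: "c \<in> A" "p \<in> fst c"
    using assms by (auto simp: charts_at_def)
  have S: "open (snd c ` fst c)" "snd c p \<in> snd c ` fst c"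
    using charts[OF c(1)] c by (auto simp: is_chart_def)
  have eq: "in_chart c f x = in_chart c h x" if "x \<in> snd c ` fst c" for x
    using that assms(2) c by (auto simp: in_chart_def inv_chart charts_at_def)
  have "(in_chart c f has_derivative D) (at (snd c p)) \<longleftrightarrow>
      (in_chart c h has_derivative D) (at (snd c p))" for D
    using has_derivative_transform_within_open[OF _ S] eq by metis
  then show ?thesis
    by (simp add: chart_deriv_def frechet_derivative_def)
qed

lemma christoffel_ex1:
  assumes c: "c \<in> charts_at p"
  shows "\<exists>!\<Gamma>. is_christoffel c p \<Gamma>"
proof -
  define G where "G a b = g p (coord_vec c p a) (coord_vec c p b)" for a b
  define D where "D u a b = chart_deriv c (\<lambda>q. g q (coord_vec c q a) (coord_vec c q b)) p u" for u a b
  have G_sym: "G a b = G b a" for a b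
    unfolding G_def by (rule metric_chart_sym[OF c])
  have G_add: "G (a + a') b = G a b + G a' b" for a a' b
    unfolding G_def by (rule metric_chart_add[OF c])
  have G_scale: "G (r *\<^sub>R a) b = r * G a b" for r a b
    unfolding G_def by (rule metric_chart_scale[OF c])
  have G_add': "G b (a + a') = G b a + G b a'" for a a' b
    using G_sym G_add by metis
  have G_scale': "G b (r *\<^sub>R a) = r * G b a" for r a b
    using G_sym G_scale by metis
  have G_lin: "linear (\<lambda>b. G a b)" for a
    by (intro linearI) (auto simp: G_add' G_scale')
  have G_pos: "a = 0" if "G a a = 0" for a
  proof (rule ccontr)
    assume "a \<noteq> 0"
    then have "coord_vec c p a \<noteq> (\<lambda>c. 0)"
      using coord_vec_self[OF c, of a] by auto
    then show False
      using metric_pos[OF coord_vec_tangent[OF c], of a] that by (simp add: G_def)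
  qed
  have G_inj: "x = y" if "\<And>b. G x b = G y b" for x y
  proof -
    have "G (x + (-1) *\<^sub>R y) (x - y) = 0"
      unfolding G_add G_scale by (simp add: that)
    then show ?thesis using G_pos[of "x - y"] by simp
  qed
  have riesz: "\<exists>z. \<forall>b. G z b = l b" if l: "linear l" for l :: "'e \<Rightarrow> real"
  proof -
    let ?T = "\<lambda>z. \<Sum>i\<in>Basis. G z i *\<^sub>R i"
    have lin: "linear ?T"
      by (intro linearI) (auto simp: G_add G_scale scaleR_add_left sum.distrib scaleR_sum_right)
    have ext: "G z b = m b" if "linear m" "\<And>i. i \<in> Basis \<Longrightarrow> G z i = m i" for z b m
      by (rule linear_eq_on_span[OF G_lin that(1), of Basis]) (auto simp: that(2))
    have "inj ?T"
    proof (rule injI)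
      fix x y assume eq: "?T x = ?T y"
      have "G x i = G y i" if "i \<in> Basis" for i
        using arg_cong[OF eq, of "\<lambda>v. v \<bullet> i"] that
        by (simp only: inner_sum_left_Basis)
      then have "G x b = G y b" for b
        by (rule ext[OF G_lin])
      then show "x = y" by (rule G_inj)
    qed
    then have "surj ?T"
      using linear_injective_imp_surjective[OF lin] by simp
    then obtain z where z: "(\<Sum>i\<in>Basis. l i *\<^sub>R i) = ?T z"
      using surjD[OF \<open>surj ?T\<close>, of "\<Sum>i\<in>Basis. l i *\<^sub>R i"] by blast
    have "G z i = l i" if "i \<in> Basis" for i
      using arg_cong[OF z, of "\<lambda>v. v \<bullet> i"] that
      by (simp only: inner_sum_left_Basis)
    then show ?thesis
      using ext[OF l] by blast
  qed
  note diff = metric_chart_differentiable[OF c]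
  have D_lin: "linear (\<lambda>u. D u a b)" for a b
    unfolding D_def chart_deriv_def using linear_frechet_derivative[OF diff] by (simp add: eta_contract_eq)
  have D_sym: "D u a b = D u b a" for u a b
    unfolding D_def by (rule chart_deriv_cong[OF c]) (rule metric_chart_sym)
  have D_add: "D u (a + a') b = D u a b + D u a' b" for u a a' b
  proof -
    let ?f = "\<lambda>a. in_chart c (\<lambda>q. g q (coord_vec c q a) (coord_vec c q b))"
    have "D u (a + a') b = chart_deriv c (\<lambda>q. g q (coord_vec c q a) (coord_vec c q b) +
        g q (coord_vec c q a') (coord_vec c q b)) p u"
      unfolding D_def by (rule chart_deriv_cong[OF c]) (rule metric_chart_add)
    also have "\<dots> = frechet_derivative (\<lambda>x. ?f a x + ?f a' x) (at (snd c p)) u"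
      by (simp add: chart_deriv_def in_chart_def comp_def)
    also have "\<dots> = D u a b + D u a' b"
    proof -
      have "((\<lambda>x. ?f a x + ?f a' x) has_derivative
          (\<lambda>u. frechet_derivative (?f a) (at (snd c p)) u +
            frechet_derivative (?f a') (at (snd c p)) u)) (at (snd c p))"
        using has_derivative_add[of "?f a" _ _ "?f a'"] diff frechet_derivative_works by blast
      then show ?thesis
        by (simp add: D_def chart_deriv_def frechet_derivative_at[symmetric])
    qed
    finally show ?thesis .
  qed
  have D_scale: "D u (r *\<^sub>R a) b = r * D u a b" for u r a b
  proof -
    let ?f = "in_chart c (\<lambda>q. g q (coord_vec c q a) (coord_vec c q b))"
    have "D u (r *\<^sub>R a) b = chart_deriv c (\<lambda>q. r * g q (coord_vec c q a) (coord_vec c q b)) p u"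
      unfolding D_def by (rule chart_deriv_cong[OF c]) (rule metric_chart_scale)
    also have "\<dots> = frechet_derivative (\<lambda>x. r * ?f x) (at (snd c p)) u"
      by (simp add: chart_deriv_def in_chart_def comp_def)
    also have "\<dots> = r * D u a b"
    proof -
      have "((\<lambda>x. r * ?f x) has_derivative (\<lambda>u. r * frechet_derivative ?f (at (snd c p)) u))
          (at (snd c p))"
        using has_derivative_mult_right[of ?f] diff frechet_derivative_works by blast
      then show ?thesis
        by (simp add: D_def chart_deriv_def frechet_derivative_at[symmetric])
    qed
    finally show ?thesis .
  qed
  have D_add1: "D (u + u') a b = D u a b + D u' a b" and D_scale1: "D (r *\<^sub>R u) a b = r * D u a b"
    for u u' a b r
    using linear_add[OF D_lin] linear_scale[OF D_lin] by auto
  have D_add2: "D u b (a + a') = D u b a + D u b a'" and D_scale2: "D u b (r *\<^sub>R a) = r * D u b a"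
    for u a a' b r
    by (simp_all add: D_sym[of u b] D_add D_scale)
  define K where "K u a b = (D u a b + D a u b - D b u a) / 2" for u a b
  have "linear (K u a)" for u a
    by (intro linearI)
       (auto simp: K_def D_add1 D_add2 D_scale1 D_scale2 field_simps)
  then have "\<exists>z. \<forall>b. G z b = K u a b" for u a
    by (rule riesz)
  then obtain \<Gamma> where \<Gamma>: "\<And>u a b. G (\<Gamma> u a) b = K u a b"
    by metis
  have *: "is_christoffel c p \<Delta> \<longleftrightarrow> bilinear \<Delta> \<and> (\<forall>u a. \<Delta> u a = \<Delta> a u) \<and>
      (\<forall>u a b. D u a b = G (\<Delta> u a) b + G a (\<Delta> u b))" for \<Delta>
    by (simp add: is_christoffel_def D_def G_def)
  have "is_christoffel c p \<Gamma>"
    unfolding *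
  proof (intro conjI allI)
    show "\<Gamma> u a = \<Gamma> a u" for u a
      by (rule G_inj) (simp add: \<Gamma> K_def D_sym)
    show "D u a b = G (\<Gamma> u a) b + G a (\<Gamma> u b)" for u a b
      unfolding G_sym[of a] \<Gamma> by (simp add: K_def D_sym[of u b a] D_sym[of a b u] D_sym[of b a u] field_simps)
    have "linear (\<lambda>a. \<Gamma> u a)" "linear (\<lambda>u. \<Gamma> u a)" for u a
      by (intro linearI G_inj;
          simp add: \<Gamma> G_add G_scale K_def D_add D_scale D_add1 D_scale1 D_add2 D_scale2 field_simps)+
    then show "bilinear \<Gamma>"
      by (simp add: bilinear_def)
  qed
  moreover have "\<Delta> = \<Gamma>" if "is_christoffel c p \<Delta>" for \<Delta>
  proof (intro ext)
    fix u a
    have s: "\<Delta> x y = \<Delta> y x" and m: "D x y z = G (\<Delta> x y) z + G y (\<Delta> x z)" for x y z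
      using that unfolding * by blast+
    show "\<Delta> u a = \<Gamma> u a"
    proof (rule G_inj)
      fix b
      have "D u a b = G (\<Delta> u a) b + G (\<Delta> u b) a"
        using m[of u a b] G_sym[of a "\<Delta> u b"] by linarith
      moreover have "D a u b = G (\<Delta> u a) b + G (\<Delta> a b) u"
        using m[of a u b] G_sym[of u "\<Delta> a b"] unfolding s[of a u] by linarith
      moreover have "D b u a = G (\<Delta> u b) a + G (\<Delta> a b) u"
        using m[of b u a] G_sym[of u "\<Delta> a b"] unfolding s[of b u] s[of b a] by linarith
      ultimately have "D u a b + D a u b - D b u a = 2 * G (\<Delta> u a) b"
        by linarith
      then show "G (\<Delta> u a) b = G (\<Gamma> u a) b"
        by (simp add: \<Gamma> K_def)
    qed
  qed
  ultimately show ?thesis by blast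
qed

text \<open>\<open>nabla p v X\<close> is the covariant derivative \<open>\<nabla>\<^sub>v X\<close> for \<open>v\<close> tangent at \<open>p\<close>.\<close>

definition nabla :: "'a \<Rightarrow> ('a, 'e) tvec \<Rightarrow> ('a, 'e) vfield \<Rightarrow> ('a, 'e) tvec" where
  "nabla p v X = (\<lambda>c. if c \<in> charts_at p
     then chart_deriv c (\<lambda>q. X q c) p (v c) + christoffel c p (v c) (X p c) else 0)"

text \<open>\<open>R(X, Y)Z = \<nabla>\<^sub>X \<nabla>\<^sub>Y Z - \<nabla>\<^sub>Y \<nabla>\<^sub>X Z - \<nabla>\<^bsub>[X, Y]\<^esub> Z\<close>.\<close>

definition curvature ::
  "('a, 'e) vfield \<Rightarrow> ('a, 'e) vfield \<Rightarrow> ('a, 'e) vfield \<Rightarrow> ('a, 'e) vfield" where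
  "curvature X Y Z p = (\<lambda>c. nabla p (X p) (\<lambda>q. nabla q (Y q) Z) c
     - nabla p (Y p) (\<lambda>q. nabla q (X q) Z) c - nabla p (lie_bracket X Y p) Z c)"

text \<open>The sectional curvature at \<open>p\<close> of the plane spanned by \<open>X p\<close> and \<open>Y p\<close>, for vector fields
  \<open>X\<close>, \<open>Y\<close> defined near \<open>p\<close>; by tensoriality it only depends on \<open>X p\<close> and \<open>Y p\<close>.\<close>

definition sectional_curvature :: "('a, 'e) vfield \<Rightarrow> ('a, 'e) vfield \<Rightarrow> 'a \<Rightarrow> real" where
  "sectional_curvature X Y p = g p (curvature X Y Y p) (X p) /
     (g p (X p) (X p) * g p (Y p) (Y p) - (g p (X p) (Y p))\<^sup>2)"

definition nonpositive_sectional_curvature :: bool where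
  "nonpositive_sectional_curvature \<longleftrightarrow> (\<forall>W X Y p. open W \<and> p \<in> W \<and>
     smooth_vfield_on W X \<and> smooth_vfield_on W Y \<and> tindependent (X p) (Y p) \<longrightarrow>
       sectional_curvature X Y p \<le> 0)"


subsection \<open>Distance, geodesics, exponential map\<close>

definition curve_length :: "real \<Rightarrow> real \<Rightarrow> (real \<Rightarrow> 'a) \<Rightarrow> real" where
  "curve_length a b \<gamma> = integral {a..b} (\<lambda>t. tnorm (\<gamma> t) (velocity {a..b} \<gamma> t))"

text \<open>Extended real: the distance is \<open>\<infinity>\<close> between different components.\<close>

definition riem_dist :: "'a \<Rightarrow> 'a \<Rightarrow> ereal" where
  "riem_dist p q = (INF \<gamma>\<in>{\<gamma>. piecewise_C1_curve_on 0 1 \<gamma> \<and> \<gamma> 0 = p \<and> \<gamma> 1 = q}.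
     ereal (curve_length 0 1 \<gamma>))"

text \<open>The geodesic equation \<open>\<nabla>\<^bsub>\<gamma>'\<^esub> \<gamma>' = 0\<close> in every chart that \<open>\<gamma>\<close> meets. Two derivatives suffice:
  solutions of this equation are automatically smooth.\<close>

definition geodesic_on :: "real set \<Rightarrow> (real \<Rightarrow> 'a) \<Rightarrow> bool" where
  "geodesic_on I \<gamma> \<longleftrightarrow> C1_curve_on I \<gamma> \<and>
     (\<forall>t\<in>I. \<forall>c\<in>charts_at (\<gamma> t). let x' = (\<lambda>s. vector_derivative (snd c \<circ> \<gamma>) (at s within I)) in
        (x' has_vector_derivative - christoffel c (\<gamma> t) (x' t) (x' t)) (at t within I))"

definition exp_dom :: "'a \<Rightarrow> ('a, 'e) tvec set" where
  "exp_dom p = {v \<in> tangent_space p.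
     \<exists>\<gamma>. geodesic_on {0..1} \<gamma> \<and> \<gamma> 0 = p \<and> velocity {0..1} \<gamma> 0 = v}"

definition riem_exp :: "'a \<Rightarrow> ('a, 'e) tvec \<Rightarrow> 'a" where
  "riem_exp p v =
     (THE q. \<exists>\<gamma>. geodesic_on {0..1} \<gamma> \<and> \<gamma> 0 = p \<and> velocity {0..1} \<gamma> 0 = v \<and> \<gamma> 1 = q)"

definition minimizing_geodesic :: "(real \<Rightarrow> 'a) \<Rightarrow> 'a \<Rightarrow> 'a \<Rightarrow> bool" where
  "minimizing_geodesic \<gamma> p q \<longleftrightarrow> geodesic_on {0..1} \<gamma> \<and> \<gamma> 0 = p \<and> \<gamma> 1 = q \<and>
     ereal (curve_length 0 1 \<gamma>) = riem_dist p q"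

text \<open>Segments are parametrized proportionally to arc length on \<open>{0..1}\<close>, so that uniqueness of
  the segment is uniqueness of the parametrization on \<open>{0..1}\<close>.\<close>

definition geodesically_convex :: "'a set \<Rightarrow> bool" where
  "geodesically_convex \<U> \<longleftrightarrow> (\<forall>p\<in>\<U>. \<forall>q\<in>\<U>.
     \<exists>\<gamma>. minimizing_geodesic \<gamma> p q \<and> \<gamma> ` {0..1} \<subseteq> \<U> \<and>
       (\<forall>\<sigma>. minimizing_geodesic \<sigma> p q \<and> \<sigma> ` {0..1} \<subseteq> \<U> \<longrightarrow> (\<forall>t\<in>{0..1}. \<sigma> t = \<gamma> t)))"


subsection \<open>Non-expansive systems and B-stability\<close>

definition monotonicity_condition :: "'a set \<Rightarrow> ('a, 'e) vfield \<Rightarrow> real \<Rightarrow> bool" where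
  "monotonicity_condition \<U> X \<nu> \<longleftrightarrow>
     (\<forall>x\<in>\<U>. \<forall>v\<in>tangent_space x. g x (nabla x v X) v \<le> \<nu> * (tnorm x v)\<^sup>2)"

definition nonexpansive_system :: "'a set \<Rightarrow> ('a, 'e) vfield \<Rightarrow> real \<Rightarrow> bool" where
  "nonexpansive_system \<U> X \<nu> \<longleftrightarrow> open \<U> \<and> geodesically_convex \<U> \<and>
     smooth_vfield_on UNIV X \<and> forward_complete_on \<U> X \<and> forward_invariant \<U> X \<and>
     monotonicity_condition \<U> X \<nu> \<and> \<nu> \<le> 0"

text \<open>A (possibly implicit) one-step method is a relation: \<open>\<Phi> h X y0 y1\<close> says that \<open>y1\<close> solves the
  equation that defines the step of size \<open>h\<close> from \<open>y0\<close> for the vector field \<open>X\<close>. On \<open>\<U>\<close> the step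
  is the solution in \<open>\<U>\<close>; being well defined on \<open>\<U>\<close> and leaving \<open>\<U>\<close> invariant means that there
  always is exactly one.\<close>

definition method_map ::
  "(real \<Rightarrow> ('a, 'e) vfield \<Rightarrow> 'a \<Rightarrow> 'a \<Rightarrow> bool) \<Rightarrow> real \<Rightarrow> ('a, 'e) vfield \<Rightarrow> 'a set \<Rightarrow> 'a \<Rightarrow> 'a" where
  "method_map \<Phi> h X \<U> y0 = (THE y1. y1 \<in> \<U> \<and> \<Phi> h X y0 y1)"

definition well_defined_invariant ::
  "(real \<Rightarrow> ('a, 'e) vfield \<Rightarrow> 'a \<Rightarrow> 'a \<Rightarrow> bool) \<Rightarrow> bool" where
  "well_defined_invariant \<Phi> \<longleftrightarrow> (\<forall>\<U> X \<nu>. nonexpansive_system \<U> X \<nu> \<longrightarrow>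
     (\<forall>h>0. \<forall>y0\<in>\<U>. \<exists>!y1. y1 \<in> \<U> \<and> \<Phi> h X y0 y1))"

text \<open>B-stability is only considered for methods with \<open>well_defined_invariant\<close>.\<close>

definition B_stable :: "(real \<Rightarrow> ('a, 'e) vfield \<Rightarrow> 'a \<Rightarrow> 'a \<Rightarrow> bool) \<Rightarrow> bool" where
  "B_stable \<Phi> \<longleftrightarrow> (\<forall>\<U> X \<nu>. nonexpansive_system \<U> X \<nu> \<longrightarrow>
     (\<forall>h>0. \<forall>x0\<in>\<U>. \<forall>y0\<in>\<U>.
        riem_dist (method_map \<Phi> h X \<U> x0) (method_map \<Phi> h X \<U> y0) \<le> riem_dist x0 y0))"

definition GIE :: "real \<Rightarrow> ('a, 'e) vfield \<Rightarrow> 'a \<Rightarrow> 'a \<Rightarrow> bool" where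
  "GIE h X y0 y1 \<longleftrightarrow>
     tscale (- h) (X y1) \<in> exp_dom y1 \<and> riem_exp y1 (tscale (- h) (X y1)) = y0"

end

end

theory Submission
  imports Defs
begin

text \<open>The GIE map \<open>\<phi>\<close> inverts \<open>F(y) = exp\<^sub>y(-hX)\<close> on \<open>\<U>\<close>. For a tangent vector \<open>u\<close> at \<open>y\<close>, \<open>dF(u) = J(1)\<close>,
  where \<open>J\<close> is the Jacobi field along \<open>t \<mapsto> exp\<^sub>y(-thX)\<close> with \<open>J(0) = u\<close> and \<open>\<nabla>J(0) = -h\<nabla>\<^sub>u X\<close>. In non-positive
  curvature \<open>\<langle>J, \<nabla>J\<rangle>\<close>, half the derivative of \<open>\<parallel>J\<parallel>\<^sup>2\<close>, is nondecreasing, and it starts at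
  \<open>-h\<langle>u, \<nabla>\<^sub>u X\<rangle> \<ge> 0\<close> by monotonicity. Hence \<open>F\<close> does not shorten tangent vectors. By the inverse function
  theorem and the uniqueness of the step in \<open>\<U>\<close>, \<open>\<phi>\<close> is \<open>C\<^sup>1\<close> on \<open>\<U>\<close> and does not lengthen them, so it maps
  the minimizing geodesic from \<open>x\<^sub>0\<close> to \<open>y\<^sub>0\<close> to a curve from \<open>\<phi>(x\<^sub>0)\<close> to \<open>\<phi>(y\<^sub>0)\<close> that is not longer.\<close>

section \<open>\<open>C\<^sup>k\<close> functions\<close>

text \<open>Jacobi fields are never introduced as fields along a curve. A variation of the initial
  state is carried by the derivative of the geodesic flow, which solves the linearized geodesic
  equation; this asks for a flow of class C^1 and hence for Christoffel symbols of class C^1. The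
  obstacle is that the geodesic of one step may pass through many charts, whereas the flow is
  constructed for short times in one chart. The flow between the end points is therefore composed of
  short pieces and changes of charts, by bisection of time. Each piece records only two facts about
  a variation with \<open>\<langle>J, \<nabla>J\<rangle> \<ge> 0\<close> at its start: the sign
  persists to its end, and \<open>\<parallel>J\<parallel>\<close> has not decreased. Such facts
  compose, and they do not depend on the charts by the transformation law of the Christoffel
  symbols. A second obstacle is that \<phi> is given by a description only, which says nothing about
  continuity. A local inverse of \<open>F\<close> takes values in \<open>\<U>\<close> and solves the
  equation of the step, so it can only be \<phi>; regularity of \<phi> thus comes out of
  uniqueness.\<close>

abbreviation fderiv :: "('a::real_normed_vector \<Rightarrow> 'b::real_normed_vector) \<Rightarrow> 'a \<Rightarrow> 'a \<Rightarrow> 'b" where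
  "fderiv f x \<equiv> frechet_derivative f (at x)"

lemma frechet_derivative_cong_open:
  assumes "open S" "x \<in> S" "\<And>y. y \<in> S \<Longrightarrow> f y = h y"
  shows "fderiv f x = fderiv h x"
proof -
  have "(f has_derivative D) (at x) \<longleftrightarrow> (h has_derivative D) (at x)" for D
    using has_derivative_transform_within_open[OF _ assms(1,2)] assms(3) by metis
  then show ?thesis
    by (simp add: frechet_derivative_def)
qed

lemma differentiable_cong_open:
  assumes "open S" "x \<in> S" "\<And>y. y \<in> S \<Longrightarrow> f y = h y" "f differentiable (at x)"
  shows "h differentiable (at x)"
  using has_derivative_transform_within_open[OF _ assms(1,2)] assms(3,4)
  unfolding differentiable_def by metis

text \<open>The derivatives in \<open>Ck_on\<close> are taken in the full space, so on an open set
  they depend only on the values there; this passes from one order to the next.\<close>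

lemma Ck_on_cong:
  assumes "open S" "Ck_on k f S" "\<And>x. x \<in> S \<Longrightarrow> f x = h x"
  shows "Ck_on k h S"
  using assms(2,3)
proof (induction k arbitrary: f h)
  case 0
  then show ?case using continuous_on_cong[of S S f h] by simp
next
  case (Suc k)
  have "fderiv f x v = fderiv h x v" if "x \<in> S" for x v
    using frechet_derivative_cong_open[OF assms(1) that Suc.prems(2)] by simp
  moreover have "h differentiable (at x)" if "x \<in> S" for x
    using differentiable_cong_open[OF assms(1) that Suc.prems(2)] Suc.prems(1) that by simp
  ultimately show ?case
    using Suc.IH[of "\<lambda>x. fderiv f x v" "\<lambda>x. fderiv h x v" for v]
      Suc.prems(1) by auto
qed

lemma Ck_on_local:
  assumes "\<And>x. x \<in> S \<Longrightarrow> \<exists>T. open T \<and> x \<in> T \<and> Ck_on k f T"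
  shows "Ck_on k f S"
  using assms
proof (induction k arbitrary: f)
  case 0
  have "isCont f x" if "x \<in> S" for x
    using 0[OF that] by (auto simp: continuous_on_eq_continuous_at)
  then show ?case by (simp add: continuous_at_imp_continuous_on)
next
  case (Suc k)
  have "Ck_on k (\<lambda>x. fderiv f x v) S" for v
    using Suc.prems by (intro Suc.IH) fastforce
  moreover have "f differentiable (at x)" if "x \<in> S" for x
    using Suc.prems[OF that] by auto
  ultimately show ?case by simp
qed

lemma Ck_on_subset: "Ck_on k f S \<Longrightarrow> T \<subseteq> S \<Longrightarrow> Ck_on k f T"
  by (induction k arbitrary: f) (auto intro: continuous_on_subset)

lemma Ck_on_continuous: "Ck_on k f S \<Longrightarrow> continuous_on S f"
  by (cases k) (auto intro!: continuous_at_imp_continuous_on differentiable_imp_continuous_within)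

lemma Ck_on_lower: "Ck_on (Suc k) f S \<Longrightarrow> Ck_on k f S"
proof (induction k arbitrary: f)
  case 0
  then show ?case using Ck_on_continuous by fastforce
next
  case (Suc k)
  from Suc.prems show ?case
    using Suc.IH by (subst Ck_on.simps) (subst (asm) Ck_on.simps, blast)
qed

lemma Ck_on_has_derivative:
  "Ck_on (Suc k) f S \<Longrightarrow> x \<in> S \<Longrightarrow> (f has_derivative fderiv f x) (at x)"
  using frechet_derivative_works by auto

text \<open>Since Frechet derivatives are unique, an explicitly computed \<open>f'\<close> may
  replace \<open>fderiv f\<close>. The closure properties below (linear images, sums, products,
  composition) use this rule to reduce order \<open>Suc k\<close> to a derivative formula.\<close>

lemma Ck_on_SucI:
  assumes "open S" "\<And>x. x \<in> S \<Longrightarrow> (f has_derivative f' x) (at x)" "\<And>v. Ck_on k (\<lambda>x. f' x v) S"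
  shows "Ck_on (Suc k) f S"
proof -
  have "f' x v = fderiv f x v" if "x \<in> S" for x v
    using frechet_derivative_at[OF assms(2)[OF that]] by simp
  then have "Ck_on k (\<lambda>x. fderiv f x v) S" for v
    by (rule Ck_on_cong[OF assms(1,3)])
  then show ?thesis using assms(2) by (auto simp: differentiable_def)
qed

lemma Ck_on_const: "open S \<Longrightarrow> Ck_on k (\<lambda>x. c) S"
proof (induction k arbitrary: c)
  case (Suc k)
  then show ?case by (intro Ck_on_SucI[where f' = "\<lambda>x v. 0"]) auto
qed auto

lemma Ck_on_bounded_linear: "open S \<Longrightarrow> bounded_linear f \<Longrightarrow> Ck_on k f S"
proof (cases k)
  case 0
  assume "bounded_linear f" then show ?thesis unfolding 0
    by (simp add: linear_continuous_on)
next
  case (Suc m)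
  assume "open S" "bounded_linear f" then show ?thesis unfolding Suc
    by (intro Ck_on_SucI[where f' = "\<lambda>x. f"] Ck_on_const bounded_linear_imp_has_derivative)
qed

lemma Ck_on_linear_comp:
  assumes "open S" "bounded_linear L"
  shows "Ck_on k f S \<Longrightarrow> Ck_on k (\<lambda>x. L (f x)) S"
proof (induction k arbitrary: f)
  case 0
  then show ?case using assms(2) by (auto intro: bounded_linear.continuous_on)
next
  case (Suc k)
  show ?case
  proof (rule Ck_on_SucI[OF assms(1)])
    show "((\<lambda>x. L (f x)) has_derivative (\<lambda>v. L (fderiv f x v))) (at x)" if "x \<in> S" for x
      using bounded_linear.has_derivative[OF assms(2)] Ck_on_has_derivative[OF Suc.prems that] .
    show "Ck_on k (\<lambda>x. L (fderiv f x v)) S" for v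
      using Suc by simp
  qed
qed

lemma Ck_on_add:
  assumes "open S"
  shows "Ck_on k f S \<Longrightarrow> Ck_on k h S \<Longrightarrow> Ck_on k (\<lambda>x. f x + h x) S"
proof (induction k arbitrary: f h)
  case 0
  then show ?case by (auto intro: continuous_on_add)
next
  case (Suc k)
  show ?case
  proof (rule Ck_on_SucI[OF assms(1)])
    show "((\<lambda>x. f x + h x) has_derivative
        (\<lambda>v. fderiv f x v + fderiv h x v)) (at x)" if "x \<in> S" for x
      by (intro has_derivative_add Ck_on_has_derivative[OF Suc.prems(1) that]
          Ck_on_has_derivative[OF Suc.prems(2) that])
    show "Ck_on k (\<lambda>x. fderiv f x v + fderiv h x v) S" for v
      using Suc by simp
  qed
qed

lemma Ck_on_sum:
  assumes "open S" "finite I" "\<And>i. i \<in> I \<Longrightarrow> Ck_on k (f i) S"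
  shows "Ck_on k (\<lambda>x. \<Sum>i\<in>I. f i x) S"
  using assms(2,3) by (induction I rule: finite_induct) (auto intro: Ck_on_const Ck_on_add assms(1))

lemma Ck_on_bilinear:
  assumes "open S" "bounded_bilinear pr"
  shows "Ck_on k f S \<Longrightarrow> Ck_on k h S \<Longrightarrow> Ck_on k (\<lambda>x. pr (f x) (h x)) S"
proof (induction k arbitrary: f h)
  case 0
  then show ?case using assms(2) by (auto intro: bounded_bilinear.continuous_on)
next
  case (Suc k)
  show ?case
  proof (rule Ck_on_SucI[OF assms(1)])
    show "((\<lambda>x. pr (f x) (h x)) has_derivative
        (\<lambda>v. pr (f x) (fderiv h x v) + pr (fderiv f x v) (h x)))
        (at x)" if "x \<in> S" for x
      by (intro bounded_bilinear.FDERIV[OF assms(2)] Ck_on_has_derivative[OF Suc.prems(1) that]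
          Ck_on_has_derivative[OF Suc.prems(2) that])
    show "Ck_on k (\<lambda>x. pr (f x) (fderiv h x v) +
        pr (fderiv f x v) (h x)) S" for v
      using Suc.prems by (intro Ck_on_add[OF assms(1)] Suc.IH Ck_on_lower[OF Suc.prems(1)]
          Ck_on_lower[OF Suc.prems(2)]) auto
  qed
qed

lemmas Ck_on_scaleR = Ck_on_bilinear[OF _ bounded_bilinear_scaleR]

lemma Ck_on_inner_const: "open S \<Longrightarrow> Ck_on k f S \<Longrightarrow> Ck_on k (\<lambda>x. f x \<bullet> i) S"
  by (rule Ck_on_linear_comp[OF _ bounded_linear_inner_left])

lemma Ck_on_Pair:
  assumes "open S" "Ck_on k f S" "Ck_on k h S"
  shows "Ck_on k (\<lambda>x. (f x, h x)) S"
proof -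
  have "bounded_linear (\<lambda>x. (x, 0))" "bounded_linear (\<lambda>x. (0, x))"
    by (auto intro: bounded_linear_intros)
  then have "Ck_on k (\<lambda>x. (f x, 0) + (0, h x)) S"
    using assms by (intro Ck_on_add Ck_on_linear_comp[where L = "\<lambda>x. (x, 0)"]
        Ck_on_linear_comp[where L = "\<lambda>x. (0, x)"])
  then show ?thesis by simp
qed

section \<open>Families of linear and bilinear maps\<close>

lemma linear_basis_expansion:
  fixes L :: "'a::euclidean_space \<Rightarrow> 'b::real_vector"
  assumes "linear L"
  shows "L a = (\<Sum>i\<in>Basis. (a \<bullet> i) *\<^sub>R L i)"
proof -
  have "L (\<Sum>i\<in>Basis. (a \<bullet> i) *\<^sub>R i) = (\<Sum>i\<in>Basis. (a \<bullet> i) *\<^sub>R L i)"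
    by (simp add: linear_sum[OF assms] linear_scale[OF assms])
  then show ?thesis by (simp add: euclidean_representation)
qed

text \<open>Expanding the argument in the basis writes the value as a finite sum of products of
  functions of class C^k. So regularity of \<open>B x a\<close> for each fixed \<open>a\<close>
  suffices, and \<open>B\<close> never has to be viewed as a map into a space of operators.\<close>

lemma Ck_on_linear_family:
  fixes B :: "'x::euclidean_space \<Rightarrow> 'p::euclidean_space \<Rightarrow> 'f::real_normed_vector"
  assumes "open S" "\<And>x. x \<in> S \<Longrightarrow> linear (B x)" "\<And>a. Ck_on k (\<lambda>x. B x a) S" "Ck_on k a S"
  shows "Ck_on k (\<lambda>x. B x (a x)) S"
proof (rule Ck_on_cong[OF assms(1)])
  show "Ck_on k (\<lambda>x. \<Sum>i\<in>Basis. (a x \<bullet> i) *\<^sub>R B x i) S"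
    using assms by (intro Ck_on_sum Ck_on_scaleR Ck_on_inner_const) auto
qed (simp add: linear_basis_expansion[OF assms(2), symmetric])

lemma Ck_on_compose:
  fixes h :: "'x::euclidean_space \<Rightarrow> 'y::euclidean_space" and f :: "'y \<Rightarrow> 'z::real_normed_vector"
  assumes "open S" "open T" "h ` S \<subseteq> T"
  shows "Ck_on k f T \<Longrightarrow> Ck_on k h S \<Longrightarrow> Ck_on k (\<lambda>x. f (h x)) S"
proof (induction k arbitrary: f)
  case 0
  then show ?case using assms(3) by (auto intro: continuous_on_compose2)
next
  case (Suc k)
  have hS: "h x \<in> T" if "x \<in> S" for x using assms(3) that by auto
  note hd = Ck_on_has_derivative[OF Suc.prems(2)] and fd = Ck_on_has_derivative[OF Suc.prems(1) hS]
  show ?case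
  proof (rule Ck_on_SucI[OF assms(1)])
    show "((\<lambda>x. f (h x)) has_derivative
        (\<lambda>v. fderiv f (h x) (fderiv h x v))) (at x)" if "x \<in> S" for x
      using diff_chain_at[OF hd fd, OF that that] by (simp add: comp_def)
    \<comment> \<open>In the chain rule the point and the direction both move with \<open>x\<close>.
      The induction hypothesis serves the point with the direction frozen; linearity in the
      direction does the rest.\<close>
    show "Ck_on k (\<lambda>x. fderiv f (h x) (fderiv h x v)) S" for v
    proof (rule Ck_on_linear_family[OF assms(1)])
      show "linear (fderiv f (h x))" if "x \<in> S" for x
        using fd[OF that] by (rule has_derivative_linear)
      show "Ck_on k (\<lambda>x. fderiv f (h x) a) S" for a
        using Suc.prems by (intro Suc.IH[of "\<lambda>y. fderiv f y a"] Ck_on_lower[OF Suc.prems(2)]) auto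
      show "Ck_on k (\<lambda>x. fderiv h x v) S"
        using Suc.prems by simp
    qed
  qed
qed

text \<open>Links the definition by directional derivatives with continuity in the operator norm,
  which the inverse function theorem and the estimates for differential equations ask for. In finite
  dimension continuity on basis vectors suffices.\<close>

lemma Ck_on_1_blinfun:
  fixes f :: "'x::euclidean_space \<Rightarrow> 'y::real_normed_vector"
  assumes "Ck_on (Suc 0) f S"
  shows "continuous_on S (\<lambda>x. Blinfun (fderiv f x))"
    and "x \<in> S \<Longrightarrow> blinfun_apply (Blinfun (fderiv f x)) = fderiv f x"
proof -
  show app: "blinfun_apply (Blinfun (fderiv f x)) = fderiv f x"
    if "x \<in> S" for x
    using has_derivative_bounded_linear[OF Ck_on_has_derivative[OF assms that]]
    by (rule bounded_linear_Blinfun_apply)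
  show "continuous_on S (\<lambda>x. Blinfun (fderiv f x))"
  proof (rule continuous_on_blinfun_componentwise)
    fix i :: 'x
    have "continuous_on S (\<lambda>x. fderiv f x i)" using assms by simp
    then show "continuous_on S (\<lambda>x. blinfun_apply (Blinfun (fderiv f x)) i)"
      using continuous_on_cong[of S S "\<lambda>x. blinfun_apply (Blinfun (fderiv f x)) i"
        "\<lambda>x. fderiv f x i"] app by simp
  qed
qed

lemma bilinear_basis_expansion:
  fixes B :: "'p::euclidean_space \<Rightarrow> 'q::euclidean_space \<Rightarrow> 'f::real_vector"
  assumes "bilinear B"
  shows "B a b = (\<Sum>i\<in>Basis. \<Sum>j\<in>Basis. ((a \<bullet> i) * (b \<bullet> j)) *\<^sub>R B i j)"
proof -
  have lin: "linear (\<lambda>a. B a b)" "linear (B a)" for a b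
    using assms by (auto simp: bilinear_def)
  have "B a b = (\<Sum>i\<in>Basis. (a \<bullet> i) *\<^sub>R B i b)"
    by (rule linear_basis_expansion[OF lin(1)])
  also have "\<dots> = (\<Sum>i\<in>Basis. (a \<bullet> i) *\<^sub>R (\<Sum>j\<in>Basis. (b \<bullet> j) *\<^sub>R B i j))"
    by (intro sum.cong refl arg_cong2[where f = scaleR] linear_basis_expansion[OF lin(2)])
  finally show ?thesis by (simp add: scaleR_sum_right)
qed

lemma Ck_on_bilinear_family:
  fixes B :: "'x::euclidean_space \<Rightarrow> 'p::euclidean_space \<Rightarrow> 'q::euclidean_space \<Rightarrow> 'f::real_normed_vector"
    and x :: "'z::euclidean_space \<Rightarrow> 'x"
  assumes "open S" "\<And>y. y \<in> S \<Longrightarrow> bilinear (B y)" "\<And>a b. Ck_on k (\<lambda>y. B y a b) S"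
    and "open T" "x ` T \<subseteq> S" "Ck_on k x T" "Ck_on k a T" "Ck_on k b T"
  shows "Ck_on k (\<lambda>z. B (x z) (a z) (b z)) T"
proof (rule Ck_on_cong[OF assms(4)])
  have "Ck_on k (\<lambda>z. B (x z) i j) T" for i j
    by (rule Ck_on_compose[OF assms(4,1,5,3,6)])
  moreover have "Ck_on k (\<lambda>z. (a z \<bullet> i) * (b z \<bullet> j)) T" for i j
    by (rule Ck_on_bilinear[OF assms(4) bounded_bilinear_mult Ck_on_inner_const[OF assms(4,7)]
          Ck_on_inner_const[OF assms(4,8)]])
  ultimately show "Ck_on k (\<lambda>z. \<Sum>i\<in>Basis. \<Sum>j\<in>Basis. ((a z \<bullet> i) * (b z \<bullet> j)) *\<^sub>R B (x z) i j) T"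
    by (intro Ck_on_sum Ck_on_scaleR assms(4) finite_Basis)
  show "(\<Sum>i\<in>Basis. \<Sum>j\<in>Basis. ((a z \<bullet> i) * (b z \<bullet> j)) *\<^sub>R B (x z) i j) = B (x z) (a z) (b z)"
    if "z \<in> T" for z
    using that assms(5) by (intro bilinear_basis_expansion[OF assms(2), symmetric]) auto
qed

text \<open>Only the values \<open>B y a b\<close> at fixed arguments are known to be
  differentiable, so the expression is expanded in the basis, differentiated term by term and summed
  up again. Derivatives within \<open>I\<close> include the one-sided ones of curves.\<close>

lemma has_derivative_bilinear_family:
  fixes B :: "'x::euclidean_space \<Rightarrow> 'p::euclidean_space \<Rightarrow> 'q::euclidean_space \<Rightarrow> 'f::real_normed_vector"
    and x :: "'z::real_normed_vector \<Rightarrow> 'x"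
  assumes S: "open S" "x z \<in> S" and z: "z \<in> I" and bil: "\<And>y. y \<in> S \<Longrightarrow> bilinear (B y)"
    and diff: "\<And>a b. (\<lambda>y. B y a b) differentiable (at (x z))"
    and x: "(x has_derivative x') (at z within I)"
    and a: "(a has_derivative a') (at z within I)"
    and b: "(b has_derivative b') (at z within I)"
  shows "((\<lambda>s. B (x s) (a s) (b s)) has_derivative
     (\<lambda>h. fderiv (\<lambda>y. B y (a z) (b z)) (x z) (x' h)
        + B (x z) (a' h) (b z) + B (x z) (a z) (b' h))) (at z within I)"
proof -
  let ?E = "\<lambda>y a b. \<Sum>i\<in>Basis. \<Sum>j\<in>Basis. ((a \<bullet> i) * (b \<bullet> j)) *\<^sub>R B y i j"
  let ?D = "\<lambda>i j. fderiv (\<lambda>y. B y i j) (x z)"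
  have D: "((\<lambda>y. B y i j) has_derivative ?D i j) (at (x z))" for i j
    using diff frechet_derivative_works by blast
  have E: "B y a b = ?E y a b" if "y \<in> S" for y a b
    by (rule bilinear_basis_expansion[OF bil[OF that]])
  have Dx: "((\<lambda>s. B (x s) i j) has_derivative (\<lambda>h. ?D i j (x' h))) (at z within I)" for i j
    using has_derivative_compose[OF x D] by simp
  have DE: "fderiv (\<lambda>y. B y p q) (x z) u =
      (\<Sum>i\<in>Basis. \<Sum>j\<in>Basis. ((p \<bullet> i) * (q \<bullet> j)) *\<^sub>R ?D i j u)" for p q u
  proof -
    have "((\<lambda>y. ?E y p q) has_derivative
        (\<lambda>u. \<Sum>i\<in>Basis. \<Sum>j\<in>Basis. ((p \<bullet> i) * (q \<bullet> j)) *\<^sub>R ?D i j u)) (at (x z))"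
      by (intro has_derivative_sum has_derivative_scaleR_right D)
    then have "((\<lambda>y. B y p q) has_derivative
        (\<lambda>u. \<Sum>i\<in>Basis. \<Sum>j\<in>Basis. ((p \<bullet> i) * (q \<bullet> j)) *\<^sub>R ?D i j u)) (at (x z))"
      by (rule has_derivative_transform_within_open[OF _ S]) (simp add: E[symmetric])
    then show ?thesis by (simp add: frechet_derivative_at[symmetric])
  qed
  have "((\<lambda>s. ?E (x s) (a s) (b s)) has_derivative
     (\<lambda>h. \<Sum>i\<in>Basis. \<Sum>j\<in>Basis. ((a z \<bullet> i) * (b z \<bullet> j)) *\<^sub>R ?D i j (x' h)
        + ((a z \<bullet> i) * (b' h \<bullet> j) + (a' h \<bullet> i) * (b z \<bullet> j)) *\<^sub>R B (x z) i j)) (at z within I)"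
    by (intro has_derivative_sum has_derivative_scaleR has_derivative_mult has_derivative_inner_left a b Dx)
  also have "(\<lambda>h. \<Sum>i\<in>Basis. \<Sum>j\<in>Basis. ((a z \<bullet> i) * (b z \<bullet> j)) *\<^sub>R ?D i j (x' h)
        + ((a z \<bullet> i) * (b' h \<bullet> j) + (a' h \<bullet> i) * (b z \<bullet> j)) *\<^sub>R B (x z) i j) =
     (\<lambda>h. fderiv (\<lambda>y. B y (a z) (b z)) (x z) (x' h)
        + B (x z) (a' h) (b z) + B (x z) (a z) (b' h))"
    unfolding DE[of "a z" "b z"] E[OF S(2), of "a' h" "b z" for h] E[OF S(2), of "a z" "b' h" for h]
    by (simp add: sum.distrib scaleR_add_left algebra_simps)
  finally have *: "((\<lambda>s. ?E (x s) (a s) (b s)) has_derivative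
     (\<lambda>h. fderiv (\<lambda>y. B y (a z) (b z)) (x z) (x' h)
        + B (x z) (a' h) (b z) + B (x z) (a z) (b' h))) (at z within I)" .
  \<comment> \<open>The expansion represents \<open>B\<close> only over \<open>S\<close>, so
    \<open>x s\<close> has to lie in \<open>S\<close> for \<open>s\<close> near
    \<open>z\<close>.\<close>
  have "continuous (at z within I) x"
    using x has_derivative_continuous by blast
  then have "eventually (\<lambda>s. x s \<in> S) (at z within I)"
    using S by (auto simp: continuous_within dest: topological_tendstoD)
  then have "eventually (\<lambda>s. ?E (x s) (a s) (b s) = B (x s) (a s) (b s)) (at z within I)"
    by eventually_elim (simp add: E)
  then show ?thesis
    by (rule has_derivative_transform_eventually[OF *]) (simp_all add: E[OF S(2), symmetric] z)
qed

lemma has_derivative_linear_family: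
  fixes B :: "'x::euclidean_space \<Rightarrow> 'p::euclidean_space \<Rightarrow> 'f::real_normed_vector"
    and x :: "'z::real_normed_vector \<Rightarrow> 'x"
  assumes S: "open S" "x z \<in> S" and z: "z \<in> I" and lin: "\<And>y. y \<in> S \<Longrightarrow> linear (B y)"
    and diff: "\<And>a. (\<lambda>y. B y a) differentiable (at (x z))"
    and x: "(x has_derivative x') (at z within I)"
    and a: "(a has_derivative a') (at z within I)"
  shows "((\<lambda>s. B (x s) (a s)) has_derivative
     (\<lambda>h. fderiv (\<lambda>y. B y (a z)) (x z) (x' h) + B (x z) (a' h))) (at z within I)"
proof -
  \<comment> \<open>The linear case is the bilinear one with a dummy scalar factor \<open>r\<close>,
    held at 1 and hence with derivative 0.\<close>
  have "((\<lambda>s. (\<lambda>y a r. r *\<^sub>R B y a) (x s) (a s) (1 :: real)) has_derivative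
     (\<lambda>h. fderiv (\<lambda>y. (\<lambda>y a r. r *\<^sub>R B y a) y (a z) (1 :: real)) (x z) (x' h)
        + (\<lambda>y a r. r *\<^sub>R B y a) (x z) (a' h) (1 :: real) + (\<lambda>y a r. r *\<^sub>R B y a) (x z) (a z) (0 :: real)))
     (at z within I)"
  proof (rule has_derivative_bilinear_family[where S = S and x = x and z = z and I = I and a = a and b = "\<lambda>s. 1"
          and x' = x' and a' = a' and b' = "\<lambda>h. 0" and B = "\<lambda>y a r. r *\<^sub>R B y a"])
    show "bilinear (\<lambda>a (r :: real). r *\<^sub>R B y a)" if "y \<in> S" for y
      using linear_compose[OF lin[OF that] linear_scaleR]
      by (auto simp: bilinear_def comp_def intro: linear_scaleR_left)
    show "(\<lambda>y. r *\<^sub>R B y a) differentiable (at (x z))" for a and r :: real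
      using diff by (rule differentiable_scaleR[OF differentiable_const])
  qed (use S z x a in \<open>auto intro: has_derivative_const\<close>)
  then show ?thesis by simp
qed

section \<open>Linear equations and symmetry of second derivatives\<close>

text \<open>An injective linear map in finite dimension is bounded below, say by \<open>c\<close>,
  and maps within \<open>c / 2\<close> of it are bounded below by \<open>c / 2\<close>. Hence
  \<open>z x - z0\<close> is at most \<open>2 / c\<close> times the residual
  \<open>k x - B x z0\<close>, which tends to 0.\<close>

lemma linear_solve_tendsto:
  fixes B :: "'x \<Rightarrow> ('e::euclidean_space \<Rightarrow>\<^sub>L 'f::euclidean_space)"
  assumes B: "(B \<longlongrightarrow> B0) F" and inj: "inj (blinfun_apply B0)"
    and k: "(k \<longlongrightarrow> B0 z0) F" and z: "\<forall>\<^sub>F x in F. B x (z x) = k x"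
  shows "(z \<longlongrightarrow> z0) F"
proof -
  obtain c where c: "c > 0" "\<And>a. c * norm a \<le> norm (B0 a)"
    using linear_inj_bounded_below_pos[OF blinfun.bounded_linear_right[THEN bounded_linear.linear] inj]
    by (metis mult.commute)
  have 1: "((\<lambda>x. (2 / c) * norm (k x - B x z0)) \<longlongrightarrow> (2 / c) * norm (B0 z0 - B0 z0)) F"
    by (intro tendsto_intros k B)
  have "\<forall>\<^sub>F x in F. norm (B x - B0) < c / 2"
    using tendstoD[OF B, of "c / 2"] c by (simp add: dist_norm)
  then have "\<forall>\<^sub>F x in F. norm (z x - z0) \<le> (2 / c) * norm (k x - B x z0)"
    using z
  proof eventually_elim
    case (elim x)
    let ?d = "z x - z0"
    have "norm ((B x - B0) ?d) \<le> (c / 2) * norm ?d"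
      using norm_blinfun[of "B x - B0" ?d] elim(1)
      by (meson less_imp_le mult_right_mono norm_ge_zero order_trans)
    moreover have "B0 ?d = B x ?d - (B x - B0) ?d"
      by (simp add: blinfun.diff_left)
    ultimately have "norm (B x ?d) \<ge> (c / 2) * norm ?d"
      using c(2)[of ?d] norm_triangle_ineq4[of "B x ?d" "(B x - B0) ?d"] by simp
    moreover have "B x ?d = k x - B x z0"
      by (simp add: blinfun.diff_right elim(2))
    ultimately show ?case using c(1) by (simp add: field_simps)
  qed
  then have "((\<lambda>x. norm (z x - z0)) \<longlongrightarrow> 0) F"
    using Lim_null_comparison[of "\<lambda>x. norm (z x - z0)" "\<lambda>x. (2 / c) * norm (k x - B x z0)" F] 1 by simp
  then show ?thesis
    using LIM_zero_cancel tendsto_norm_zero_iff by blast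
qed

text \<open>The inverse function theorem provides \<open>G\<close> with a derivative
  \<open>G'\<close>. Continuity of \<open>G' v w\<close> in \<open>v\<close> is read off from the
  linear equation that it solves, whose coefficients \<open>F' (G v)\<close> are continuous in
  \<open>v\<close>.\<close>

lemma C1_local_inverse:
  fixes F :: "'a::euclidean_space \<Rightarrow> 'a"
  assumes S: "open S" "u0 \<in> S" and F: "Ck_on (Suc 0) F S" and inj: "inj (fderiv F u0)"
  obtains V G where "open V" "F u0 \<in> V" "G (F u0) = u0" "Ck_on (Suc 0) G V"
    "\<And>v. v \<in> V \<Longrightarrow> G v \<in> S \<and> F (G v) = v"
    "\<And>v w. v \<in> V \<Longrightarrow> fderiv F (G v) (fderiv G v w) = w"
proof -
  define F' where "F' u = Blinfun (fderiv F u)" for u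
  have F'app: "blinfun_apply (F' u) = fderiv F u" if "u \<in> S" for u
    unfolding F'_def by (rule Ck_on_1_blinfun(2)[OF F that])
  have F'cont: "continuous_on S F'"
    unfolding F'_def[abs_def] by (rule Ck_on_1_blinfun(1)[OF F])
  have Fd: "(F has_derivative blinfun_apply (F' u)) (at u)" if "u \<in> S" for u
    using Ck_on_has_derivative[OF F that] F'app[OF that] by simp
  have Ainj: "inj (blinfun_apply (F' u0))" using inj F'app[OF S(2)] by simp
  have "linear (blinfun_apply (F' u0))" by (simp add: blinfun.bounded_linear_right bounded_linear.linear)
  then have "bounded_linear (inv (blinfun_apply (F' u0)))"
    using inj_linear_imp_inv_linear Ainj by (simp add: linear_conv_bounded_linear)
  then have left_inv: "Blinfun (inv (blinfun_apply (F' u0))) o\<^sub>L F' u0 = id_blinfun"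
    by (intro blinfun_eqI) (simp add: bounded_linear_Blinfun_apply inv_f_f[OF Ainj])
  obtain U' V G G' where V: "open U'" "U' \<subseteq> S" "u0 \<in> U'" "open V" "F u0 \<in> V" "homeomorphism U' V F G"
    "\<And>v. v \<in> V \<Longrightarrow> (G has_derivative G' v) (at v)"
    "\<And>v. v \<in> V \<Longrightarrow> G' v = inv (blinfun_apply (F' (G v)))"
    "\<And>v. v \<in> V \<Longrightarrow> bij (blinfun_apply (F' (G v)))"
  proof (rule inverse_function_theorem[OF S(1) Fd F'cont S(2) left_inv])
    fix U' V G G'
    assume "open U'" "U' \<subseteq> S" "u0 \<in> U'" "open V" "F u0 \<in> V" "homeomorphism U' V F G"
      "\<And>v. v \<in> V \<Longrightarrow> (G has_derivative G' v) (at v)"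
      "\<And>v. v \<in> V \<Longrightarrow> G' v = inv (blinfun_apply (F' (G v)))"
      "\<And>v. v \<in> V \<Longrightarrow> bij (blinfun_apply (F' (G v)))"
    then show thesis by (rule that)
  qed
  have G: "G v \<in> S" "F (G v) = v" if "v \<in> V" for v
    using V(2,6) that by (auto simp: homeomorphism_def)
  have Gcont: "continuous_on V G" using V(6) by (simp add: homeomorphism_def)
  have F'G: "F' (G v) (G' v w) = w" if "v \<in> V" for v w
    unfolding V(8)[OF that] using V(9)[OF that] by (simp add: bij_is_surj surj_f_inv_f)
  have "Ck_on (Suc 0) G V"
  proof (rule Ck_on_SucI[OF V(4) V(7)])
    fix w
    have B: "continuous_on V (\<lambda>v. F' (G v))"
      by (rule continuous_on_compose2[OF F'cont Gcont]) (use G in auto)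
    have "((\<lambda>v. G' v w) \<longlongrightarrow> G' v w) (at v)" if v: "v \<in> V" for v
    proof (rule linear_solve_tendsto)
      show "((\<lambda>v. F' (G v)) \<longlongrightarrow> F' (G v)) (at v)"
        using B V(4) v by (simp add: continuous_on_eq_continuous_at isCont_def)
      show "inj (blinfun_apply (F' (G v)))" using V(9)[OF v] by (rule bij_is_inj)
      show "((\<lambda>v. w) \<longlongrightarrow> blinfun_apply (F' (G v)) (G' v w)) (at v)" by (simp add: F'G[OF v])
      show "\<forall>\<^sub>F v in at v. blinfun_apply (F' (G v)) (G' v w) = w"
        using eventually_at_in_open'[OF V(4) v] by eventually_elim (rule F'G)
    qed
    then show "Ck_on 0 (\<lambda>v. G' v w) V"
      using V(4) by (simp add: continuous_on_eq_continuous_at isCont_def)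
  qed
  moreover have "G (F u0) = u0" using V(3,6) by (auto simp: homeomorphism_def)
  moreover have "fderiv F (G v) (fderiv G v w) = w" if "v \<in> V" for v w
    using F'G[OF that] F'app[OF G(1)[OF that]] frechet_derivative_at[OF V(7)[OF that]] by simp
  ultimately show thesis using that V(4,5) G by blast
qed

text \<open>The map \<open>(x, z) \<mapsto> (x, B x z)\<close> has a triangular derivative with
  injective diagonal blocks, so it has a local inverse of class C^1, and \<open>z x\<close> is the
  second component of this inverse at \<open>(x, k x)\<close>. The application is to the Christoffel
  symbols, which are given implicitly by a linear system.\<close>

lemma linear_solve_C1:
  fixes B :: "'x::euclidean_space \<Rightarrow> 'e::euclidean_space \<Rightarrow> 'e"
  assumes S: "open S" and lin: "\<And>x. x \<in> S \<Longrightarrow> linear (B x)" and inj: "\<And>x. x \<in> S \<Longrightarrow> inj (B x)"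
    and B: "\<And>a. Ck_on (Suc 0) (\<lambda>x. B x a) S" and k: "Ck_on (Suc 0) k S"
    and z: "\<And>x. x \<in> S \<Longrightarrow> B x (z x) = k x"
  shows "Ck_on (Suc 0) z S"
proof (rule Ck_on_local)
  fix x assume x: "x \<in> S"
  let ?D = "S \<times> (UNIV :: 'e set)" and ?F = "\<lambda>p. (fst p, B (fst p) (snd p))"
  have D: "open ?D" "(x, z x) \<in> ?D" using S x by (auto intro: open_Times)
  have fs: "Ck_on (Suc 0) fst ?D" "Ck_on (Suc 0) snd ?D"
    by (rule Ck_on_bounded_linear[OF D(1)], rule bounded_linear_fst bounded_linear_snd)+
  have F: "Ck_on (Suc 0) ?F ?D"
  proof (rule Ck_on_Pair[OF D(1) fs(1) Ck_on_linear_family[OF D(1), where B = "\<lambda>p. B (fst p)" and a = snd]])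
    show "Ck_on (Suc 0) (\<lambda>p. B (fst p) a) ?D" for a
      by (rule Ck_on_compose[OF D(1) S _ B fs(1)]) auto
  qed (use lin fs in auto)
  have f: "(fst has_derivative fst) (at (x, z x))" "(snd has_derivative snd) (at (x, z x))"
    by (auto intro!: derivative_eq_intros)
  have "((\<lambda>s. B (fst s) (snd s)) has_derivative
    (\<lambda>h. fderiv (\<lambda>y. B y (snd (x, z x))) (fst (x, z x)) (fst h) + B (fst (x, z x)) (snd h))) (at (x, z x))"
    by (rule has_derivative_linear_family[OF S _ UNIV_I lin _ f]) (use x B in auto)
  from frechet_derivative_at[OF has_derivative_Pair[OF f(1) this]]
  have F': "fderiv ?F (x, z x) =
      (\<lambda>h. (fst h, fderiv (\<lambda>y. B y (z x)) x (fst h) + B x (snd h)))" by simp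
  have "inj (fderiv ?F (x, z x))"
    unfolding F' using inj[OF x] by (auto simp: inj_def)
  then obtain V G where V: "open V" "?F (x, z x) \<in> V" "Ck_on (Suc 0) G V"
    "\<And>v. v \<in> V \<Longrightarrow> G v \<in> ?D \<and> ?F (G v) = v"
    by (rule C1_local_inverse[OF D F]) blast
  let ?T = "S \<inter> (\<lambda>y. (y, k y)) -` V"
  have yk: "Ck_on (Suc 0) (\<lambda>y. (y, k y)) S"
    by (rule Ck_on_Pair[OF S Ck_on_bounded_linear[OF S bounded_linear_ident] k])
  have T: "open ?T" by (rule continuous_open_preimage[OF Ck_on_continuous[OF yk] S V(1)])
  have "Ck_on (Suc 0) (\<lambda>y. snd (G (y, k y))) ?T"
    by (rule Ck_on_linear_comp[OF T bounded_linear_snd Ck_on_compose[OF T V(1) _ V(3) Ck_on_subset[OF yk]]]) auto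
  then have "Ck_on (Suc 0) z ?T"
  proof (rule Ck_on_cong[OF T])
    fix y assume y: "y \<in> ?T"
    then have "fst (G (y, k y)) = y" "B (fst (G (y, k y))) (snd (G (y, k y))) = k y"
      using V(4)[of "(y, k y)"] by auto
    then have "B y (snd (G (y, k y))) = B y (z y)" using z y by simp
    then show "snd (G (y, k y)) = z y" using inj y by (auto dest: injD)
  qed
  then show "\<exists>T. open T \<and> x \<in> T \<and> Ck_on (Suc 0) z T"
    using T x V(2) z by (intro exI[of _ ?T]) simp
qed

section \<open>Second differences and the theorem of Schwarz\<close>

lemma mvt_line:
  fixes f :: "'a::euclidean_space \<Rightarrow> real"
  assumes S: "\<And>t. 0 \<le> t \<Longrightarrow> t \<le> h \<Longrightarrow> p + t *\<^sub>R u \<in> S" and f: "\<And>x. x \<in> S \<Longrightarrow> f differentiable (at x)"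
    and h: "0 < h"
  obtains t where "0 < t" "t < h" "f (p + h *\<^sub>R u) - f p = h * fderiv f (p + t *\<^sub>R u) u"
proof -
  have "((\<lambda>t. f (p + t *\<^sub>R u)) has_real_derivative fderiv f (p + t *\<^sub>R u) u) (at t)"
    if "0 \<le> t" "t \<le> h" for t
  proof -
    have d: "(f has_derivative fderiv f (p + t *\<^sub>R u)) (at (p + t *\<^sub>R u))"
      using f[OF S[OF that]] frechet_derivative_works by blast
    have "((\<lambda>t. f (p + t *\<^sub>R u)) has_derivative (\<lambda>s. fderiv f (p + t *\<^sub>R u) (s *\<^sub>R u))) (at t)"
      by (rule has_derivative_compose[where f = "\<lambda>t. p + t *\<^sub>R u" and f' = "\<lambda>s. s *\<^sub>R u"])
        (use d in \<open>auto intro!: derivative_eq_intros\<close>)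
    then show ?thesis
      unfolding has_field_derivative_def
      by (simp add: linear_scale[OF has_derivative_linear[OF d]] mult_commute_abs)
  qed
  then obtain t where "0 < t" "t < h"
    "f (p + h *\<^sub>R u) - f (p + 0 *\<^sub>R u) = (h - 0) * fderiv f (p + t *\<^sub>R u) u"
    using MVT2[OF h, of "\<lambda>t. f (p + t *\<^sub>R u)" "\<lambda>t. fderiv f (p + t *\<^sub>R u) u"] by blast
  then show thesis using that by simp
qed

text \<open>The left side is the increment along \<open>u\<close> of
  \<open>g y = f (y + h *\<^sub>R v) - f y\<close>. The mean value theorem along \<open>u\<close>
  and then along \<open>v\<close> turns it into a mixed second derivative at a nearby point. What
  makes the formula useful is that the left side is symmetric in \<open>u\<close> and
  \<open>v\<close>.\<close>

lemma second_difference: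
  fixes f :: "'a::euclidean_space \<Rightarrow> real"
  assumes f: "Ck_on (Suc (Suc 0)) f (ball x e)" and h: "0 < h" "h * (norm u + norm v) < e"
  obtains p where "dist x p \<le> h * (norm u + norm v)"
    "f (x + h *\<^sub>R u + h *\<^sub>R v) - f (x + h *\<^sub>R u) - f (x + h *\<^sub>R v) + f x =
       h * h * fderiv (\<lambda>y. fderiv f y u) p v"
proof -
  have in1: "dist x (x + t *\<^sub>R u + s *\<^sub>R v) \<le> h * (norm u + norm v)" if "0 \<le> t" "t \<le> h" "0 \<le> s" "s \<le> h" for s t
  proof -
    have "norm (t *\<^sub>R u + s *\<^sub>R v) \<le> t * norm u + s * norm v"
      using norm_triangle_ineq[of "t *\<^sub>R u" "s *\<^sub>R v"] that by simp
    also have "\<dots> \<le> h * norm u + h * norm v"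
      using that by (intro add_mono mult_right_mono) auto
    finally show ?thesis by (simp add: dist_norm norm_minus_commute algebra_simps flip: norm_minus_cancel[of "- t *\<^sub>R u - s *\<^sub>R v"])
  qed
  then have in2: "x + t *\<^sub>R u + s *\<^sub>R v \<in> ball x e" if "0 \<le> t" "t \<le> h" "0 \<le> s" "s \<le> h" for s t
    using le_less_trans[OF in1[OF that] h(2)] by simp
  have in3: "x + t *\<^sub>R u \<in> ball x e" if "0 \<le> t" "t \<le> h" for t
    using in2[of t 0] that h by simp
  define g where "g y = f (y + h *\<^sub>R v) - f y" for y
  let ?S = "{x + t *\<^sub>R u | t. 0 \<le> t \<and> t \<le> h}"
  have gd: "(g has_derivative (\<lambda>w. fderiv f (y + h *\<^sub>R v) w - fderiv f y w)) (at y)"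
    if "y \<in> ?S" for y
  proof -
    obtain t where t: "y = x + t *\<^sub>R u" "0 \<le> t" "t \<le> h" using \<open>y \<in> ?S\<close> by blast
    have "y + h *\<^sub>R v \<in> ball x e" "y \<in> ball x e" using t in2[of t h] in3[of t] h by auto
    note d = Ck_on_has_derivative[OF f this(1)] Ck_on_has_derivative[OF f this(2)]
    have "((\<lambda>y. f (y + h *\<^sub>R v)) has_derivative fderiv f (y + h *\<^sub>R v)) (at y)"
      by (rule has_derivative_compose[where f = "\<lambda>y. y + h *\<^sub>R v" and f' = "\<lambda>w. w"])
        (use d in \<open>auto intro!: derivative_eq_intros\<close>)
    then show ?thesis unfolding g_def by (intro has_derivative_diff d)
  qed
  obtain t where t: "0 < t" "t < h" "g (x + h *\<^sub>R u) - g x = h * fderiv g (x + t *\<^sub>R u) u"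
    by (rule mvt_line[of h x u ?S g]) (use gd h in \<open>auto simp: differentiable_def\<close>)
  let ?y = "x + t *\<^sub>R u"
  have "fderiv g ?y u = fderiv f (?y + h *\<^sub>R v) u - fderiv f ?y u"
    using frechet_derivative_at[OF gd[of ?y]] t by (metis (mono_tags, lifting) less_imp_le mem_Collect_eq)
  moreover obtain s where s: "0 < s" "s < h" "fderiv f (?y + h *\<^sub>R v) u - fderiv f ?y u
      = h * fderiv (\<lambda>y. fderiv f y u) (?y + s *\<^sub>R v) v"
    by (rule mvt_line[of h ?y v "ball x e" "\<lambda>y. fderiv f y u"]) (use in2 t f h in auto)
  ultimately have "g (x + h *\<^sub>R u) - g x =
      h * h * fderiv (\<lambda>y. fderiv f y u) (?y + s *\<^sub>R v) v"
    using t by simp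
  then show thesis
    using that[of "?y + s *\<^sub>R v"] in1[of t s] t s by (simp add: g_def)
qed

text \<open>Exchanging \<open>u\<close> and \<open>v\<close> leaves the second difference unchanged,
  so the two mixed derivatives, taken at points \<open>p\<close> and \<open>q\<close> close to
  \<open>x\<close>, agree; continuity brings both to \<open>x\<close>.\<close>

lemma second_derivative_symmetric_real:
  fixes f :: "'a::euclidean_space \<Rightarrow> real"
  assumes f: "Ck_on (Suc (Suc 0)) f S" and S: "open S" "x \<in> S"
  shows "fderiv (\<lambda>y. fderiv f y u) x v =
    fderiv (\<lambda>y. fderiv f y v) x u" (is "?D u v x = ?D v u x")
proof -
  obtain e where e: "e > 0" "ball x e \<subseteq> S" using S by (meson openE)
  have fb: "Ck_on (Suc (Suc 0)) f (ball x e)" using Ck_on_subset[OF f e(2)] .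
  have cont: "continuous (at x) (?D u v)" for u v
    using f S by (simp add: continuous_on_eq_continuous_at)
  have close: "\<bar>?D u v x - ?D v u x\<bar> < d" if d: "d > 0" for d
  proof -
    obtain a where a: "a > 0" "\<And>y. dist x y < a \<Longrightarrow> \<bar>?D u v y - ?D u v x\<bar> < d / 2"
      using cont[of u v, unfolded continuous_at_eps_delta, rule_format, of "d / 2"] d
      by (metis dist_commute dist_real_def half_gt_zero)
    obtain b where b: "b > 0" "\<And>y. dist x y < b \<Longrightarrow> \<bar>?D v u y - ?D v u x\<bar> < d / 2"
      using cont[of v u, unfolded continuous_at_eps_delta, rule_format, of "d / 2"] d
      by (metis dist_commute dist_real_def half_gt_zero)
    define m where "m = min e (min a b)"
    have m: "m > 0" "m \<le> e" "m \<le> a" "m \<le> b" using e a b by (auto simp: m_def)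
    \<comment> \<open>The summand 1 keeps \<open>n\<close> positive even when \<open>u\<close> and
      \<open>v\<close> vanish, and the factor 2 in \<open>h\<close> makes \<open>h * n\<close>
      strictly smaller than \<open>m\<close>.\<close>
    define n where "n = norm u + norm v + 1"
    define h where "h = m / (2 * n)"
    have n: "n > 0" "norm u + norm v \<le> n" by (auto simp: n_def intro: add_nonneg_pos)
    have h: "h > 0" using m n by (simp add: h_def)
    have "h * (norm u + norm v) \<le> h * n" using h n by simp
    also have "h * n < m" using m n by (simp add: h_def)
    finally have hm: "h * (norm u + norm v) < m" .
    obtain p where p: "dist x p \<le> h * (norm u + norm v)"
      "f (x + h *\<^sub>R u + h *\<^sub>R v) - f (x + h *\<^sub>R u) - f (x + h *\<^sub>R v) + f x = h * h * ?D u v p"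
      by (rule second_difference[OF fb h, of u v]) (use hm m in auto)
    obtain q where q: "dist x q \<le> h * (norm v + norm u)"
      "f (x + h *\<^sub>R v + h *\<^sub>R u) - f (x + h *\<^sub>R v) - f (x + h *\<^sub>R u) + f x = h * h * ?D v u q"
      by (rule second_difference[OF fb h, of v u]) (use hm m in \<open>auto simp: add.commute\<close>)
    have "h * h * ?D u v p = h * h * ?D v u q"
      using p(2) q(2) by (simp add: algebra_simps)
    then have "?D u v p = ?D v u q" using h by simp
    moreover have "\<bar>?D u v p - ?D u v x\<bar> < d / 2" using a(2)[of p] p(1) hm m by simp
    moreover have "\<bar>?D v u q - ?D v u x\<bar> < d / 2" using b(2)[of q] q(1) hm m by (simp add: add.commute)
    ultimately show ?thesis by linarith
  qed
  show ?thesis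
  proof (rule ccontr)
    assume "?D u v x \<noteq> ?D v u x"
    then show False using close[of "\<bar>?D u v x - ?D v u x\<bar>"] by simp
  qed
qed

lemma second_derivative_symmetric:
  fixes f :: "'a::euclidean_space \<Rightarrow> 'b::euclidean_space"
  assumes f: "Ck_on (Suc (Suc 0)) f S" and S: "open S" "x \<in> S"
  shows "fderiv (\<lambda>y. fderiv f y u) x v =
    fderiv (\<lambda>y. fderiv f y v) x u"
proof (rule euclidean_eqI)
  fix i :: 'b
  have 1: "fderiv (\<lambda>y. f y \<bullet> i) y u = fderiv f y u \<bullet> i" if "y \<in> S" for u y
    using frechet_derivative_at[OF has_derivative_inner_left[OF Ck_on_has_derivative[OF f that]]] by metis
  have "fderiv (\<lambda>y. fderiv (\<lambda>y. f y \<bullet> i) y u) x v =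
      fderiv (\<lambda>y. fderiv f y u) x v \<bullet> i" for u v
  proof -
    have "Ck_on (Suc 0) (\<lambda>y. fderiv f y u) S" using f by simp
    from has_derivative_inner_left[OF Ck_on_has_derivative[OF this S(2)]]
    have "((\<lambda>y. fderiv (\<lambda>y. f y \<bullet> i) y u) has_derivative
      (\<lambda>v. fderiv (\<lambda>y. fderiv f y u) x v \<bullet> i)) (at x)"
      by (rule has_derivative_transform_within_open[OF _ S]) (simp add: 1)
    then show ?thesis by (metis frechet_derivative_at)
  qed
  then show "fderiv (\<lambda>y. fderiv f y u) x v \<bullet> i =
    fderiv (\<lambda>y. fderiv f y v) x u \<bullet> i"
    using second_derivative_symmetric_real[OF Ck_on_inner_const[OF S(1) f] S, of i u v] by simp
qed

section \<open>Ordinary differential equations\<close>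

text \<open>Banach's fixed point theorem for the integral equation. \<open>F\<close> depends on time
  and \<open>X\<close> is any closed set because there are two applications: the flow in a closed
  ball, and the linear equation of its derivative on a whole space of operators.\<close>

lemma picard_fixed_point:
  fixes F :: "real \<Rightarrow> 'c::banach \<Rightarrow> 'c"
  assumes T: "0 \<le> T" and L: "0 \<le> L" "T * L \<le> 1 / 2" and X: "closed X" "z \<in> X"
    and cont: "continuous_on ({0..T} \<times> X) (\<lambda>p. F (fst p) (snd p))"
    and lip: "\<And>t x y. t \<in> {0..T} \<Longrightarrow> x \<in> X \<Longrightarrow> y \<in> X \<Longrightarrow> norm (F t x - F t y) \<le> L * norm (x - y)"
    and inv: "\<And>u t. continuous_on {0..T} u \<Longrightarrow> u ` {0..T} \<subseteq> X \<Longrightarrow> t \<in> {0..T} \<Longrightarrow>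
      z + integral {0..t} (\<lambda>s. F s (u s)) \<in> X"
  shows "\<exists>u. u 0 = z \<and> (\<forall>t\<in>{0..T}. u t \<in> X \<and> (u has_vector_derivative F t (u t)) (at t within {0..T}))"
proof -
  \<comment> \<open>Clamping time to \<open>{0..T}\<close> extends curves constantly to the whole
    line, so that the complete space of bounded continuous functions on the reals can be
    used.\<close>
  define cl where "cl t = max 0 (min T t)" for t
  have cl: "cl t \<in> {0..T}" for t using T by (auto simp: cl_def)
  have cl_id: "cl t = t" if "t \<in> {0..T}" for t using that by (auto simp: cl_def)
  have cl_cont: "continuous_on UNIV cl" unfolding cl_def by (intro continuous_intros)
  define A where "A = PiC (UNIV :: real set) (\<lambda>_. X)"
  have A: "u \<in> A \<longleftrightarrow> (\<forall>t. apply_bcontfun u t \<in> X)" for u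
    by (auto simp: A_def mem_PiC_iff)
  have Fcont: "continuous_on {0..T} (\<lambda>s. F s (apply_bcontfun u s))" if "u \<in> A" for u
  proof -
    have "continuous_on {0..T} (\<lambda>s. (s, apply_bcontfun u s))" by (intro continuous_intros continuous_on_apply_bcontfun)
    from continuous_on_compose2[OF cont this] that show ?thesis by (auto simp: A)
  qed
  define p where "p u t = z + integral {0..cl t} (\<lambda>s. F s (apply_bcontfun u s))" for u t
  have p_bc: "p u \<in> bcontfun" if "u \<in> A" for u
  proof -
    have c: "continuous_on {0..T} (\<lambda>t. z + integral {0..t} (\<lambda>s. F s (apply_bcontfun u s)))"
      by (intro continuous_intros indefinite_integral_continuous_1 integrable_continuous_interval Fcont that)
    have "p u = (\<lambda>t. z + integral {0..cl t} (\<lambda>s. F s (apply_bcontfun u s)))"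
      by (simp add: fun_eq_iff p_def)
    moreover have "range cl \<subseteq> {0..T}" using cl by blast
    ultimately have "continuous_on UNIV (p u)"
      using continuous_on_compose2[OF c cl_cont] by simp
    moreover have "bounded ((\<lambda>t. z + integral {0..t} (\<lambda>s. F s (apply_bcontfun u s))) ` {0..T})"
      using compact_continuous_image[OF c] compact_imp_bounded by blast
    then have "bounded (range (p u))"
      by (rule bounded_subset) (use cl in \<open>auto simp: p_def\<close>)
    ultimately show ?thesis by (simp add: bcontfun_def)
  qed
  define P where "P u = Bcontfun (p u)" for u
  have P: "apply_bcontfun (P u) = p u" if "u \<in> A" for u
    unfolding P_def by (rule Bcontfun_inverse[OF p_bc[OF that]])
  have "\<exists>!u. u \<in> A \<and> P u = u"
  proof (rule Banach_fix)
    show "complete A" unfolding A_def using X closed_PiC[of UNIV "\<lambda>_. X"] by (simp add: complete_eq_closed)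
    show "A \<noteq> {}" using X A[of "const_bcontfun z"] by (metis const_bcontfun.rep_eq empty_iff)
    show "0 \<le> (1 / 2 :: real)" "(1 / 2 :: real) < 1" by auto
    show "P ` A \<subseteq> A"
      using cl by (auto simp: A P p_def intro!: inv continuous_on_apply_bcontfun)
    fix u v assume uv: "u \<in> A" "v \<in> A"
    show "dist (P u) (P v) \<le> 1 / 2 * dist u v"
    proof (rule dist_bound)
      fix t
      have i: "(\<lambda>s. F s (apply_bcontfun w s)) integrable_on {0..cl t}" if "w \<in> A" for w
        using cl[of t] by (intro integrable_continuous_interval continuous_on_subset[OF Fcont[OF that]]) auto
      have "dist (p u t) (p v t) = norm (integral {0..cl t} (\<lambda>s. F s (apply_bcontfun u s) - F s (apply_bcontfun v s)))"
        by (simp add: p_def dist_norm integral_diff[OF i[OF uv(1)] i[OF uv(2)]])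
      also have "\<dots> \<le> (L * dist u v) * (cl t - 0)"
      proof (rule integral_bound)
        show "continuous_on {0..cl t} (\<lambda>s. F s (apply_bcontfun u s) - F s (apply_bcontfun v s))"
          using cl[of t] uv by (intro continuous_on_diff continuous_on_subset[OF Fcont]) auto
        fix s assume "s \<in> {0..cl t}"
        then have "norm (F s (apply_bcontfun u s) - F s (apply_bcontfun v s)) \<le>
            L * norm (apply_bcontfun u s - apply_bcontfun v s)"
          using lip[of s] uv cl[of t] by (auto simp: A)
        also have "\<dots> \<le> L * dist u v"
          using dist_bounded[of u s v] L by (intro mult_left_mono) (auto simp: dist_norm)
        finally show "norm (F s (apply_bcontfun u s) - F s (apply_bcontfun v s)) \<le> L * dist u v" .
      qed (use cl[of t] in auto)
      also have "\<dots> = (cl t * L) * dist u v" by simp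
      also have "\<dots> \<le> (1 / 2) * dist u v"
      proof -
        have "cl t * L \<le> T * L" using cl[of t] L by (intro mult_right_mono) auto
        then show ?thesis using L by (intro mult_right_mono) auto
      qed
      finally show "dist (apply_bcontfun (P u) t) (apply_bcontfun (P v) t) \<le> 1 / 2 * dist u v"
        using uv by (simp add: P)
    qed
  qed
  then obtain u where u: "u \<in> A" "P u = u" by blast
  let ?u = "apply_bcontfun u"
  have eq: "?u t = z + integral {0..t} (\<lambda>s. F s (?u s))" if "t \<in> {0..T}" for t
    using arg_cong[OF u(2), of "\<lambda>v. apply_bcontfun v t"] by (simp add: P[OF u(1)] p_def cl_id[OF that])
  have "(?u has_vector_derivative F t (?u t)) (at t within {0..T})" if t: "t \<in> {0..T}" for t
  proof (rule has_vector_derivative_transform[OF t])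
    show "((\<lambda>t. z + integral {0..t} (\<lambda>s. F s (?u s))) has_vector_derivative F t (?u t)) (at t within {0..T})"
      using integral_has_vector_derivative[OF Fcont[OF u(1)] t]
      by (auto intro!: derivative_eq_intros)
  qed (simp add: eq)
  moreover have "?u 0 = z" using eq[of 0] T by simp
  ultimately show ?thesis using u(1) by (intro exI[of _ ?u]) (auto simp: A)
qed

text \<open>A substitute for Gronwall's inequality on a short interval. At a maximum
  \<open>m\<close> of the norm the mean value inequality gives \<open>norm (u m) \<le> norm (u 0) +
  norm (u m) / 2 + T * \<epsilon>\<close>, since \<open>T * L \<le> 1 / 2\<close>; absorbing the
  middle term produces the factor 2.\<close>

lemma ode_bound:
  fixes u :: "real \<Rightarrow> 'b::real_normed_vector"
  assumes T: "0 \<le> T" and L: "0 \<le> L" "T * L \<le> 1 / 2" and \<epsilon>: "0 \<le> \<epsilon>"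
    and deriv: "\<And>t. t \<in> {0..T} \<Longrightarrow> (u has_vector_derivative u' t) (at t within {0..T})"
    and bound: "\<And>t. t \<in> {0..T} \<Longrightarrow> norm (u' t) \<le> L * norm (u t) + \<epsilon>"
    and t: "t \<in> {0..T}"
  shows "norm (u t) \<le> 2 * (norm (u 0) + T * \<epsilon>)"
proof -
  have "continuous_on {0..T} (\<lambda>t. norm (u t))"
    by (rule continuous_on_norm[OF continuous_on_vector_derivative[OF deriv]])
  then obtain m where m: "m \<in> {0..T}" "\<And>s. s \<in> {0..T} \<Longrightarrow> norm (u s) \<le> norm (u m)"
    using continuous_attains_sup[of "{0..T}" "\<lambda>t. norm (u t)"] T by auto
  have "norm (u m - u 0) \<le> (L * norm (u m) + \<epsilon>) * norm (m - 0)"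
  proof (rule differentiable_bound[of "{0..T}" u "\<lambda>t h. h *\<^sub>R u' t"])
    fix s assume s: "s \<in> {0..T}"
    show "(u has_derivative (\<lambda>h. h *\<^sub>R u' s)) (at s within {0..T})"
      using deriv[OF s] by (simp add: has_vector_derivative_def)
    have "norm (u' s) \<le> L * norm (u m) + \<epsilon>"
      using bound[OF s] mult_left_mono[OF m(2)[OF s] L(1)] by linarith
    then show "onorm (\<lambda>h. h *\<^sub>R u' s) \<le> L * norm (u m) + \<epsilon>"
      by (intro onorm_le) (simp add: mult.commute mult_left_mono)
  qed (use m T in auto)
  also have "\<dots> \<le> (L * norm (u m) + \<epsilon>) * T"
    using m T L \<epsilon> by (intro mult_left_mono) auto
  also have "\<dots> = (T * L) * norm (u m) + T * \<epsilon>" by (simp add: algebra_simps)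
  also have "\<dots> \<le> (1 / 2) * norm (u m) + T * \<epsilon>"
    using L by (intro add_right_mono mult_right_mono) auto
  finally have "norm (u m) \<le> 2 * (norm (u 0) + T * \<epsilon>)"
    using norm_triangle_sub[of "u m" "u 0"] by simp
  then show ?thesis using m(2)[OF t] by simp
qed

text \<open>All points of the segment from \<open>p\<close> to \<open>q\<close> are at most as far
  from \<open>p\<close> as \<open>q\<close> is, so the oscillation of \<open>f'\<close> is measured
  only over such points.\<close>

lemma C1_linearization_bound:
  fixes f :: "'b::euclidean_space \<Rightarrow> 'c::real_normed_vector"
  assumes f: "\<And>x. x \<in> K \<Longrightarrow> (f has_derivative blinfun_apply (f' x)) (at x)" and K: "convex K" "p \<in> K" "q \<in> K"
    and B: "\<And>x. x \<in> K \<Longrightarrow> dist x p \<le> dist q p \<Longrightarrow> norm (f' x - f' p) \<le> B"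
  shows "norm (f q - f p - f' p (q - p)) \<le> norm (q - p) * B"
proof (rule differentiable_bound_linearization[where S = "closed_segment p q"])
  show "p + t *\<^sub>R (q - p) \<in> closed_segment p q" if "t \<in> {0..1}" for t
    using that by (auto simp: in_segment algebra_simps intro!: exI[of _ t])
  have sub: "closed_segment p q \<subseteq> K" using K by (simp add: closed_segment_subset)
  fix x assume x: "x \<in> closed_segment p q"
  show "(f has_derivative blinfun_apply (f' x)) (at x within closed_segment p q)"
    using f sub x by (blast intro: has_derivative_at_withinI)
  have "dist x p \<le> dist q p"
    using segment_bound(1)[OF x] by (simp add: dist_norm)
  then have "norm (f' x - f' p) \<le> B" using B sub x by blast
  then show "onorm (blinfun_apply (f' x) - blinfun_apply (f' p)) \<le> B"
    by (simp add: norm_blinfun.rep_eq minus_blinfun.rep_eq fun_diff_def)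
qed simp

text \<open>The derivative in the initial value is found as the solution \<open>W\<close> of the
  linearized equation. The error \<open>\<Phi> y t - \<Phi> z t - W z t (y - z)\<close> satisfies a
  differential inequality whose inhomogeneity is small compared with \<open>norm (y - z)\<close>,
  and \<open>ode_bound\<close> passes this on to the error. One \<open>T\<close> and one
  \<open>r\<close> serve all initial values in the ball.\<close>

theorem local_flow:
  fixes f :: "'b::euclidean_space \<Rightarrow> 'b"
  assumes S: "open S" "z0 \<in> S" and f: "Ck_on (Suc 0) f S"
  obtains T r \<Phi> where "T > 0" "r > 0" "ball z0 r \<subseteq> S"
    "\<And>z. z \<in> ball z0 r \<Longrightarrow> \<Phi> z 0 = z"
    "\<And>z t. z \<in> ball z0 r \<Longrightarrow> t \<in> {0..T} \<Longrightarrow> \<Phi> z t \<in> S"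
    "\<And>z t. z \<in> ball z0 r \<Longrightarrow> t \<in> {0..T} \<Longrightarrow> (\<Phi> z has_vector_derivative f (\<Phi> z t)) (at t within {0..T})"
    "\<And>t. t \<in> {0..T} \<Longrightarrow> Ck_on (Suc 0) (\<lambda>z. \<Phi> z t) (ball z0 r)"
    "\<And>z \<zeta>. z \<in> ball z0 r \<Longrightarrow> fderiv (\<lambda>z. \<Phi> z 0) z \<zeta> = \<zeta>"
    "\<And>z \<zeta> t. z \<in> ball z0 r \<Longrightarrow> t \<in> {0..T} \<Longrightarrow>
      ((\<lambda>t. fderiv (\<lambda>z. \<Phi> z t) z \<zeta>) has_vector_derivative
       fderiv f (\<Phi> z t) (fderiv (\<lambda>z. \<Phi> z t) z \<zeta>)) (at t within {0..T})"
proof -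
  define f' where "f' x = Blinfun (fderiv f x)" for x
  have f'app: "blinfun_apply (f' x) = fderiv f x" if "x \<in> S" for x
    unfolding f'_def by (rule Ck_on_1_blinfun(2)[OF f that])
  obtain R where R: "R > 0" "cball z0 R \<subseteq> S" using S open_contains_cball by blast
  let ?K = "cball z0 R"
  have f'cont: "continuous_on ?K f'"
    unfolding f'_def using continuous_on_subset[OF Ck_on_1_blinfun(1)[OF f] R(2)] .
  have fcont: "continuous_on ?K f" using continuous_on_subset[OF Ck_on_continuous[OF f] R(2)] .
  have fd: "(f has_derivative blinfun_apply (f' x)) (at x)" if "x \<in> ?K" for x
    using Ck_on_has_derivative[OF f] f'app that R(2) by auto
  obtain L where L: "L > 0" "\<And>x. x \<in> ?K \<Longrightarrow> norm (f' x) \<le> L"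
    using compact_imp_bounded[OF compact_continuous_image[OF f'cont compact_cball]]
    by (auto simp: bounded_pos)
  obtain M where M: "M > 0" "\<And>x. x \<in> ?K \<Longrightarrow> norm (f x) \<le> M"
    using compact_imp_bounded[OF compact_continuous_image[OF fcont compact_cball]]
    by (auto simp: bounded_pos)
  have lip: "norm (f x - f y) \<le> L * norm (x - y)" if "x \<in> ?K" "y \<in> ?K" for x y
    by (rule differentiable_bound[of ?K f "\<lambda>x. blinfun_apply (f' x)"])
      (use that fd L in \<open>auto intro: has_derivative_at_withinI simp flip: norm_blinfun.rep_eq\<close>)
  \<comment> \<open>The first bound gives \<open>T * L \<le> 1 / 2\<close> for the contraction and
    for \<open>ode_bound\<close>. By the second a solution moves at most \<open>R / 2\<close>, so
    from a start within \<open>r = R / 2\<close> of \<open>z0\<close> it stays in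
    \<open>?K\<close>.\<close>
  define T where "T = min (1 / (2 * L)) (R / (2 * M))"
  define r where "r = R / 2"
  have T: "T > 0" "0 \<le> T" using L M R by (auto simp: T_def)
  have TL: "T * L \<le> 1 / 2"
    using mult_right_mono[of T "1 / (2 * L)" L] L by (simp add: T_def)
  have TM: "M * T \<le> R / 2"
    using mult_left_mono[of T "R / (2 * M)" M] M by (simp add: T_def)
  have L0: "0 \<le> L" using L by simp
  have r: "r > 0" "ball z0 r \<subseteq> ?K" using R by (auto simp: r_def)
  have "\<exists>u. u 0 = z \<and> (\<forall>t\<in>{0..T}. u t \<in> ?K \<and> (u has_vector_derivative f (u t)) (at t within {0..T}))"
    if z: "z \<in> ball z0 r" for z
  proof (rule picard_fixed_point[where F = "\<lambda>t x. f x", OF T(2) L0 TL])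
    show "continuous_on ({0..T} \<times> ?K) (\<lambda>p. f (snd p))"
      by (rule continuous_on_compose2[OF fcont]) (auto intro!: continuous_intros)
    show "z + integral {0..t} (\<lambda>s. f (u s)) \<in> ?K"
      if u: "continuous_on {0..T} u" "u ` {0..T} \<subseteq> ?K" and t: "t \<in> {0..T}" for u t
    proof -
      have "norm (integral {0..t} (\<lambda>s. f (u s))) \<le> M * (t - 0)"
      proof (rule integral_bound)
        show "continuous_on {0..t} (\<lambda>s. f (u s))"
          by (rule continuous_on_compose2[OF fcont continuous_on_subset[OF u(1)]]) (use u t in auto)
        show "norm (f (u s)) \<le> M" if "s \<in> {0..t}" for s
          using that t by (intro M(2) subsetD[OF u(2)] imageI) auto
      qed (use t in auto)
      also have "\<dots> \<le> M * T" using t M by simp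
      finally have "norm (integral {0..t} (\<lambda>s. f (u s))) \<le> R / 2" using TM by linarith
      moreover have "dist z0 z \<le> R / 2" using z by (simp add: r_def)
      ultimately show ?thesis
        using norm_triangle_ineq4[of "z0 - z" "integral {0..t} (\<lambda>s. f (u s))"]
        by (simp add: dist_norm algebra_simps)
    qed
  qed (use z r lip in auto)
  then obtain \<Phi> where \<Phi>: "\<And>z. z \<in> ball z0 r \<Longrightarrow> \<Phi> z 0 = z"
    "\<And>z t. z \<in> ball z0 r \<Longrightarrow> t \<in> {0..T} \<Longrightarrow> \<Phi> z t \<in> ?K"
    "\<And>z t. z \<in> ball z0 r \<Longrightarrow> t \<in> {0..T} \<Longrightarrow> (\<Phi> z has_vector_derivative f (\<Phi> z t)) (at t within {0..T})"
    by metis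
  have \<Phi>cont: "continuous_on {0..T} (\<Phi> z)" if "z \<in> ball z0 r" for z
    using \<Phi>(3)[OF that] by (rule continuous_on_vector_derivative)
  \<comment> \<open>The linearized equation has the same Lipschitz constant \<open>L\<close>, the
    bound on \<open>f'\<close> over \<open>?K\<close>, and can be posed on the whole space of
    operators; so it is solvable on the same interval.\<close>
  have "\<exists>W. W 0 = id_blinfun \<and> (\<forall>t\<in>{0..T}. W t \<in> UNIV \<and>
      (W has_vector_derivative f' (\<Phi> z t) o\<^sub>L W t) (at t within {0..T}))"
    if z: "z \<in> ball z0 r" for z
  proof (rule picard_fixed_point[where F = "\<lambda>t B. f' (\<Phi> z t) o\<^sub>L B", OF T(2) L0 TL])
    have "continuous_on ({0..T} \<times> UNIV) (\<lambda>p::real \<times> ('b \<Rightarrow>\<^sub>L 'b). \<Phi> z (fst p))"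
      by (rule continuous_on_compose2[OF \<Phi>cont[OF z]]) (auto intro!: continuous_intros)
    then have "continuous_on ({0..T} \<times> UNIV) (\<lambda>p::real \<times> ('b \<Rightarrow>\<^sub>L 'b). f' (\<Phi> z (fst p)))"
      by (rule continuous_on_compose2[OF f'cont]) (use \<Phi>(2)[OF z] in auto)
    then show "continuous_on ({0..T} \<times> UNIV) (\<lambda>p::real \<times> ('b \<Rightarrow>\<^sub>L 'b). f' (\<Phi> z (fst p)) o\<^sub>L snd p)"
      by (intro bounded_bilinear.continuous_on[OF bounded_bilinear_blinfun_compose] continuous_intros)
    show "norm ((f' (\<Phi> z t) o\<^sub>L A) - (f' (\<Phi> z t) o\<^sub>L B)) \<le> L * norm (A - B)" if "t \<in> {0..T}" for t and A B :: "'b \<Rightarrow>\<^sub>L 'b"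
      using norm_blinfun_compose[of "f' (\<Phi> z t)" "A - B"] L(2)[OF \<Phi>(2)[OF z that]]
        bounded_bilinear.diff_right[OF bounded_bilinear_blinfun_compose, of "f' (\<Phi> z t)" A B]
      by (metis mult_right_mono norm_ge_zero order_trans)
  qed auto
  then obtain W where W: "\<And>z. z \<in> ball z0 r \<Longrightarrow> W z 0 = id_blinfun"
    "\<And>z t. z \<in> ball z0 r \<Longrightarrow> t \<in> {0..T} \<Longrightarrow>
      (W z has_vector_derivative f' (\<Phi> z t) o\<^sub>L W z t) (at t within {0..T})"
    by metis
  \<comment> \<open>Trajectories separate at most by the factor 2; the halved radii
    \<open>d / 2\<close> below compensate for it.\<close>
  have dep: "norm (\<Phi> y t - \<Phi> z t) \<le> 2 * norm (y - z)"
    if yz: "y \<in> ball z0 r" "z \<in> ball z0 r" and t: "t \<in> {0..T}" for y z t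
  proof -
    have "norm (\<Phi> y t - \<Phi> z t) \<le> 2 * (norm (\<Phi> y 0 - \<Phi> z 0) + T * 0)"
      by (rule ode_bound[OF T(2) L0 TL order_refl, of _ "\<lambda>t. f (\<Phi> y t) - f (\<Phi> z t)"])
        (use yz t \<Phi> lip in \<open>auto intro!: has_vector_derivative_diff\<close>)
    then show ?thesis using yz by (simp add: \<Phi>)
  qed
  have Wb: "norm (W z t) \<le> 2" if z: "z \<in> ball z0 r" and t: "t \<in> {0..T}" for z t
  proof -
    have "norm (W z t) \<le> 2 * (norm (W z 0) + T * 0)"
    proof (rule ode_bound[OF T(2) L0 TL order_refl W(2)[OF z] _ t])
      show "norm (f' (\<Phi> z t) o\<^sub>L W z t) \<le> L * norm (W z t) + 0" if "t \<in> {0..T}" for t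
        using norm_blinfun_compose[of "f' (\<Phi> z t)" "W z t"] mult_right_mono[OF L(2)[OF \<Phi>(2)[OF z that]], of "norm (W z t)"]
        by simp
    qed
    then show ?thesis using norm_blinfun_id_le[where 'a = 'b] by (simp add: W(1)[OF z])
  qed
  have unif: "\<exists>d>0. \<forall>x\<in>?K. \<forall>y\<in>?K. dist x y < d \<longrightarrow> norm (f' x - f' y) \<le> e" if "e > 0" for e
    using compact_uniformly_continuous[OF f'cont compact_cball] that
    unfolding uniformly_continuous_on_def by (metis dist_norm less_imp_le)
  have \<Phi>d: "((\<lambda>z. \<Phi> z t) has_derivative blinfun_apply (W z t)) (at z)"
    if z: "z \<in> ball z0 r" and t: "t \<in> {0..T}" for z t
    unfolding has_derivative_at_alt
  proof (intro conjI allI impI)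
    show "bounded_linear (blinfun_apply (W z t))" by (rule blinfun.bounded_linear_right)
    fix e :: real assume e: "e > 0"
    \<comment> \<open>\<open>ode_bound\<close> contributes \<open>2 * T\<close> and the separation
      of trajectories another 2, which the denominator cancels exactly.\<close>
    then have "e / (4 * T) > 0" using T by simp
    then obtain d where d: "d > 0"
      "\<And>x y. x \<in> ?K \<Longrightarrow> y \<in> ?K \<Longrightarrow> dist x y < d \<Longrightarrow> norm (f' x - f' y) \<le> e / (4 * T)"
      using unif by blast
    obtain d' where d': "d' > 0" "ball z d' \<subseteq> ball z0 r" using z by (metis open_ball openE)
    have "norm (\<Phi> y t - \<Phi> z t - W z t (y - z)) \<le> e * norm (y - z)" if y: "norm (y - z) < min (d / 2) d'" for y
    proof -
      have yb: "y \<in> ball z0 r" using y by (intro subsetD[OF d'(2)]) (simp add: dist_norm norm_minus_commute)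
      have "norm (\<Phi> y t - \<Phi> z t - W z t (y - z)) \<le>
          2 * (norm (\<Phi> y 0 - \<Phi> z 0 - W z 0 (y - z)) + T * (2 * norm (y - z) * (e / (4 * T))))"
      proof (rule ode_bound[OF T(2) L0 TL _ _ _ t])
        fix t assume t: "t \<in> {0..T}"
        let ?u' = "f (\<Phi> y t) - f (\<Phi> z t) - (f' (\<Phi> z t) o\<^sub>L W z t) (y - z)"
        show "((\<lambda>t. \<Phi> y t - \<Phi> z t - W z t (y - z)) has_vector_derivative ?u') (at t within {0..T})"
          by (intro has_vector_derivative_diff \<Phi> yb z t bounded_linear.has_vector_derivative[OF blinfun.bounded_linear_left W(2)])
        have "norm (f (\<Phi> y t) - f (\<Phi> z t) - f' (\<Phi> z t) (\<Phi> y t - \<Phi> z t)) \<le>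
            norm (\<Phi> y t - \<Phi> z t) * (e / (4 * T))"
        proof (rule C1_linearization_bound[OF fd])
          fix x assume "x \<in> ?K" "dist x (\<Phi> z t) \<le> dist (\<Phi> y t) (\<Phi> z t)"
          then show "norm (f' x - f' (\<Phi> z t)) \<le> e / (4 * T)"
            using dep[OF yb z t] y by (intro d \<Phi> z t) (auto simp: dist_norm)
        qed (use \<Phi>(2) yb z t in auto)
        also have "\<dots> \<le> 2 * norm (y - z) * (e / (4 * T))"
          using dep[OF yb z t] e T by (intro mult_right_mono) auto
        finally have 1: "norm (f (\<Phi> y t) - f (\<Phi> z t) - f' (\<Phi> z t) (\<Phi> y t - \<Phi> z t)) \<le> 2 * norm (y - z) * (e / (4 * T))" .
        have "norm (f' (\<Phi> z t) (\<Phi> y t - \<Phi> z t - W z t (y - z))) \<le> L * norm (\<Phi> y t - \<Phi> z t - W z t (y - z))"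
          using norm_blinfun[of "f' (\<Phi> z t)"] mult_right_mono[OF L(2)[OF \<Phi>(2)[OF z t]]] norm_ge_zero order_trans by blast
        \<comment> \<open>The derivative of the error splits into the linearization error of
          \<open>f\<close> between the two trajectories and \<open>f'\<close> applied to the error
          itself.\<close>
        moreover have eq: "?u' = (f (\<Phi> y t) - f (\<Phi> z t) - f' (\<Phi> z t) (\<Phi> y t - \<Phi> z t)) + f' (\<Phi> z t) (\<Phi> y t - \<Phi> z t - W z t (y - z))"
          by (simp add: blinfun.diff_right)
        ultimately show "norm ?u' \<le> L * norm (\<Phi> y t - \<Phi> z t - W z t (y - z)) + 2 * norm (y - z) * (e / (4 * T))"
          unfolding eq
          using 1 norm_triangle_ineq[of "f (\<Phi> y t) - f (\<Phi> z t) - f' (\<Phi> z t) (\<Phi> y t - \<Phi> z t)"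
              "f' (\<Phi> z t) (\<Phi> y t - \<Phi> z t - W z t (y - z))"] by linarith
      qed (use e T in auto)
      also have "\<dots> = e * norm (y - z)" using T by (simp add: \<Phi>(1)[OF yb] \<Phi>(1)[OF z] W(1)[OF z])
      finally show ?thesis .
    qed
    then show "\<exists>d>0. \<forall>y. norm (y - z) < d \<longrightarrow> norm (\<Phi> y t - \<Phi> z t - W z t (y - z)) \<le> e * norm (y - z)"
      using d d' by (intro exI[of _ "min (d / 2) d'"]) auto
  qed
  have Wcont: "continuous_on (ball z0 r) (\<lambda>z. W z t)" if t: "t \<in> {0..T}" for t
    unfolding continuous_on_iff
  proof (intro ballI allI impI)
    fix z and e :: real assume z: "z \<in> ball z0 r" and e: "e > 0"
    \<comment> \<open>Here the factors are \<open>2 * T\<close> and the bound 2 on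
      \<open>W z t\<close>, which leaves \<open>e / 2 < e\<close>.\<close>
    then have "e / (8 * T) > 0" using T by simp
    then obtain d where d: "d > 0"
      "\<And>x y. x \<in> ?K \<Longrightarrow> y \<in> ?K \<Longrightarrow> dist x y < d \<Longrightarrow> norm (f' x - f' y) \<le> e / (8 * T)"
      using unif by blast
    have "dist (W y t) (W z t) < e" if yb: "y \<in> ball z0 r" and y: "dist y z < d / 2" for y
    proof -
      have "norm (W y t - W z t) \<le> 2 * (norm (W y 0 - W z 0) + T * (e / (8 * T) * 2))"
      proof (rule ode_bound[OF T(2) L0 TL _ _ _ t])
        fix t assume t: "t \<in> {0..T}"
        let ?u' = "(f' (\<Phi> y t) o\<^sub>L W y t) - (f' (\<Phi> z t) o\<^sub>L W z t)"
        show "((\<lambda>t. W y t - W z t) has_vector_derivative ?u') (at t within {0..T})"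
          by (intro has_vector_derivative_diff W yb z t)
        have eq: "?u' = (f' (\<Phi> y t) o\<^sub>L (W y t - W z t)) + ((f' (\<Phi> y t) - f' (\<Phi> z t)) o\<^sub>L W z t)"
          by (simp add: bounded_bilinear.diff_right[OF bounded_bilinear_blinfun_compose]
              bounded_bilinear.diff_left[OF bounded_bilinear_blinfun_compose])
        have "norm (f' (\<Phi> y t) o\<^sub>L (W y t - W z t)) \<le> L * norm (W y t - W z t)"
          using norm_blinfun_compose mult_right_mono[OF L(2)[OF \<Phi>(2)[OF yb t]]] norm_ge_zero order_trans by blast
        moreover have "norm (f' (\<Phi> y t) - f' (\<Phi> z t)) \<le> e / (8 * T)"
          using dep[OF yb z t] y by (intro d \<Phi> yb z t) (auto simp: dist_norm)
        then have "norm ((f' (\<Phi> y t) - f' (\<Phi> z t)) o\<^sub>L W z t) \<le> e / (8 * T) * 2"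
          using norm_blinfun_compose[of "f' (\<Phi> y t) - f' (\<Phi> z t)" "W z t"] Wb[OF z t] e T
          by (meson mult_mono norm_ge_zero order_trans)
        ultimately show "norm ?u' \<le> L * norm (W y t - W z t) + e / (8 * T) * 2"
          unfolding eq using norm_triangle_ineq[of "f' (\<Phi> y t) o\<^sub>L (W y t - W z t)" "(f' (\<Phi> y t) - f' (\<Phi> z t)) o\<^sub>L W z t"]
          by linarith
      qed (use e T in auto)
      also have "\<dots> = e / 2" using T by (simp add: W(1)[OF yb] W(1)[OF z])
      finally show ?thesis using e by (simp add: dist_norm)
    qed
    then show "\<exists>d>0. \<forall>y\<in>ball z0 r. dist y z < d \<longrightarrow> dist (W y t) (W z t) < e"
      using d by (intro exI[of _ "d / 2"]) auto
  qed
  have fdW: "fderiv (\<lambda>z. \<Phi> z t) z = W z t" if "z \<in> ball z0 r" "t \<in> {0..T}" for z t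
    using frechet_derivative_at[OF \<Phi>d[OF that]] by simp
  show thesis
  proof (rule that[OF T(1) r(1) order_trans[OF r(2) R(2)]])
    show "\<Phi> z t \<in> S" if "z \<in> ball z0 r" "t \<in> {0..T}" for z t using \<Phi>(2)[OF that] R(2) by auto
    show "Ck_on (Suc 0) (\<lambda>z. \<Phi> z t) (ball z0 r)" if "t \<in> {0..T}" for t
      by (rule Ck_on_SucI[OF open_ball \<Phi>d[OF _ that]]) (auto intro!: continuous_intros Wcont that)
    show "fderiv (\<lambda>z. \<Phi> z 0) z \<zeta> = \<zeta>" if "z \<in> ball z0 r" for z \<zeta>
      using fdW[OF that, of 0] T by (simp add: W(1)[OF that])
    fix z \<zeta> t assume z: "z \<in> ball z0 r" and t: "t \<in> {0..T}"
    have "((\<lambda>t. W z t \<zeta>) has_vector_derivative (f' (\<Phi> z t) o\<^sub>L W z t) \<zeta>) (at t within {0..T})"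
      by (rule bounded_linear.has_vector_derivative[OF blinfun.bounded_linear_left W(2)[OF z t]])
    then have *: "((\<lambda>t. W z t \<zeta>) has_vector_derivative fderiv f (\<Phi> z t) (W z t \<zeta>)) (at t within {0..T})"
      using f'app \<Phi>(2)[OF z t] R(2) by auto
    have "((\<lambda>t. fderiv (\<lambda>z. \<Phi> z t) z \<zeta>) has_vector_derivative
        fderiv f (\<Phi> z t) (W z t \<zeta>)) (at t within {0..T})"
      by (rule has_vector_derivative_transform[OF t _ *]) (simp add: fdW[OF z])
    then show "((\<lambda>t. fderiv (\<lambda>z. \<Phi> z t) z \<zeta>) has_vector_derivative
       fderiv f (\<Phi> z t) (fderiv (\<lambda>z. \<Phi> z t) z \<zeta>)) (at t within {0..T})"
      by (simp add: fdW[OF z t])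
  qed (use \<Phi> in auto)
qed

section \<open>Charts and transitions\<close>

context smooth_manifold
begin

definition cinv :: "('a, 'e) chart \<Rightarrow> 'e \<Rightarrow> 'a" where
  "cinv c = inv_into (fst c) (snd c)"

definition cdom :: "('a, 'e) chart \<Rightarrow> 'e set" where
  "cdom c = snd c ` fst c"

definition transition :: "('a, 'e) chart \<Rightarrow> ('a, 'e) chart \<Rightarrow> 'e \<Rightarrow> 'e" where
  "transition c c' = in_chart c (snd c')"

definition transition_dom :: "('a, 'e) chart \<Rightarrow> ('a, 'e) chart \<Rightarrow> 'e set" where
  "transition_dom c c' = snd c ` (fst c \<inter> fst c')"

text \<open>The Hessian term by which accelerations, derivatives of vector fields and Christoffel
  symbols fail to be tensors. The cancellations below rest on its symmetry.\<close>

definition transition_deriv2 :: "('a, 'e) chart \<Rightarrow> ('a, 'e) chart \<Rightarrow> 'e \<Rightarrow> 'e \<Rightarrow> 'e \<Rightarrow> 'e" where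
  "transition_deriv2 c c' x u a =
     fderiv (\<lambda>y. fderiv (transition c c') y a) x u"

lemma charts_atI: "c \<in> A \<Longrightarrow> p \<in> fst c \<Longrightarrow> c \<in> charts_at p"
  by (simp add: charts_at_def)

lemma charts_atD: "c \<in> charts_at p \<Longrightarrow> c \<in> A" "c \<in> charts_at p \<Longrightarrow> p \<in> fst c"
  by (simp_all add: charts_at_def)

lemma charts_at_nonempty: obtains c where "c \<in> charts_at p"
proof -
  have "p \<in> (\<Union>c\<in>A. fst c)" using covering by simp
  then obtain c where "c \<in> A" "p \<in> fst c" by blast
  then show thesis using that by (simp add: charts_at_def)
qed

lemma open_chart_dom: "c \<in> A \<Longrightarrow> open (fst c)"
  using charts by (simp add: is_chart_def)

lemma open_cdom: "c \<in> A \<Longrightarrow> open (cdom c)"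
  using charts by (simp add: is_chart_def cdom_def)

lemma chart_continuous: "c \<in> A \<Longrightarrow> continuous_on (fst c) (snd c)"
  using charts by (simp add: is_chart_def)

lemma cinv_continuous: "c \<in> A \<Longrightarrow> continuous_on (cdom c) (cinv c)"
  using charts by (simp add: is_chart_def cdom_def cinv_def)

lemma cinv_chart: "c \<in> charts_at p \<Longrightarrow> cinv c (snd c p) = p"
  using inv_chart by (simp add: cinv_def charts_at_def)

lemma chart_in_cdom: "c \<in> charts_at p \<Longrightarrow> snd c p \<in> cdom c"
  by (simp add: cdom_def charts_at_def)

lemma cinv_in: "x \<in> cdom c \<Longrightarrow> cinv c x \<in> fst c"
  by (simp add: cdom_def cinv_def inv_into_into)

lemma cinv_charts_at: "c \<in> A \<Longrightarrow> x \<in> cdom c \<Longrightarrow> c \<in> charts_at (cinv c x)"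
  by (simp add: charts_at_def cinv_in)

lemma chart_cinv: "x \<in> cdom c \<Longrightarrow> snd c (cinv c x) = x"
  by (simp add: cdom_def cinv_def f_inv_into_f)

lemma in_chart_eq: "in_chart c f x = f (cinv c x)"
  by (simp add: in_chart_def cinv_def)

lemma transition_eq: "transition c c' x = snd c' (cinv c x)"
  by (simp add: transition_def in_chart_eq)

lemma open_transition_dom: "c \<in> A \<Longrightarrow> c' \<in> A \<Longrightarrow> open (transition_dom c c')"
  by (simp add: transition_dom_def chart_image_open open_chart_dom)

lemma transition_dom_subset: "transition_dom c c' \<subseteq> cdom c"
  by (auto simp: transition_dom_def cdom_def)

lemma transition_domI: "c \<in> charts_at p \<Longrightarrow> c' \<in> charts_at p \<Longrightarrow> snd c p \<in> transition_dom c c'"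
  by (auto simp: transition_dom_def charts_at_def)

lemma transition_domE:
  assumes "c \<in> A" "c' \<in> A" "x \<in> transition_dom c c'"
  shows "c \<in> charts_at (cinv c x)" "c' \<in> charts_at (cinv c x)" "snd c (cinv c x) = x"
proof -
  obtain p where p: "x = snd c p" "p \<in> fst c" "p \<in> fst c'"
    using assms by (auto simp: transition_dom_def)
  then have "cinv c x = p" using assms by (simp add: cinv_chart charts_at_def)
  then show "c \<in> charts_at (cinv c x)" "c' \<in> charts_at (cinv c x)" "snd c (cinv c x) = x"
    using assms p by (auto simp: charts_at_def)
qed

lemma transition_in:
  assumes "c \<in> A" "c' \<in> A" "x \<in> transition_dom c c'"
  shows "transition c c' x \<in> transition_dom c' c"
  using transition_domI[OF transition_domE(2,1)[OF assms]] by (simp add: transition_eq)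

lemma transition_chart: "c \<in> charts_at p \<Longrightarrow> transition c c' (snd c p) = snd c' p"
  by (simp add: transition_eq cinv_chart)

lemma transition_transition:
  assumes "c \<in> A" "c' \<in> A" "x \<in> transition_dom c c'"
  shows "transition c' c (transition c c' x) = x"
  using transition_domE[OF assms] by (simp add: transition_eq cinv_chart)

lemma transition_Ck: "c \<in> A \<Longrightarrow> c' \<in> A \<Longrightarrow> Ck_on k (transition c c') (transition_dom c c')"
  using compatible by (simp add: smooth_on_def transition_def in_chart_def transition_dom_def)

lemma transition_has_derivative:
  "c \<in> A \<Longrightarrow> c' \<in> A \<Longrightarrow> x \<in> transition_dom c c' \<Longrightarrow>
    (transition c c' has_derivative fderiv (transition c c') x) (at x)"
  by (rule Ck_on_has_derivative[OF transition_Ck])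

lemma chart_deriv_transition:
  "chart_deriv c (snd c') p = fderiv (transition c c') (snd c p)"
  by (simp add: fun_eq_iff chart_deriv_def transition_def)

lemma transition_deriv_linear:
  "c \<in> A \<Longrightarrow> c' \<in> A \<Longrightarrow> x \<in> transition_dom c c' \<Longrightarrow> linear (fderiv (transition c c') x)"
  using transition_has_derivative has_derivative_linear by blast

lemma transition_deriv_inverse:
  assumes "c \<in> A" "c' \<in> A" "x \<in> transition_dom c c'"
  shows "fderiv (transition c' c) (transition c c' x)
    (fderiv (transition c c') x a) = a"
proof -
  note c = transition_domE[OF assms]
  show ?thesis
    using chart_deriv_chain[OF c(1,2,1), of a] chart_deriv_self[OF c(1), of a] c(3)
    by (simp add: chart_deriv_transition transition_eq)
qed

lemma transition_deriv_Ck: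
  "c \<in> A \<Longrightarrow> c' \<in> A \<Longrightarrow> Ck_on k (\<lambda>x. fderiv (transition c c') x a) (transition_dom c c')"
  using transition_Ck[of c c' "Suc k"] by simp

lemma transition_deriv2_sym:
  assumes "c \<in> A" "c' \<in> A" "x \<in> transition_dom c c'"
  shows "transition_deriv2 c c' x u a = transition_deriv2 c c' x a u"
  unfolding transition_deriv2_def
  by (rule second_derivative_symmetric[OF transition_Ck open_transition_dom]) (use assms in auto)

lemma tangent_transition:
  assumes "v \<in> tangent_space p" "c \<in> charts_at p" "c' \<in> charts_at p"
  shows "v c' = fderiv (transition c c') (snd c p) (v c)"
proof -
  have "v c' = chart_deriv c (snd c') p (v c)"
    using assms unfolding tangent_space_def by blast
  then show ?thesis unfolding chart_deriv_transition .
qed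

text \<open>A tangent vector is a family over all charts, but one chart at \<open>p\<close>
  determines the others. Later identities are verified in a single chart once both sides are known
  to be tangent.\<close>

lemma tangent_eqI:
  assumes "v \<in> tangent_space p" "w \<in> tangent_space p" "c \<in> charts_at p" "v c = w c"
  shows "v = w"
  using coord_vec_inverse[OF assms(3,1)] coord_vec_inverse[OF assms(3,2)] unfolding assms(4) by metis

lemma coord_vec_transition:
  "c' \<in> charts_at p \<Longrightarrow> coord_vec c p a c' = fderiv (transition c c') (snd c p) a"
  by (simp add: coord_vec_def chart_deriv_transition)

lemma tadd_tangent: "v \<in> tangent_space p \<Longrightarrow> w \<in> tangent_space p \<Longrightarrow> tadd v w \<in> tangent_space p"
proof -
  assume vw: "v \<in> tangent_space p" "w \<in> tangent_space p"
  obtain c where c: "c \<in> charts_at p" by (rule charts_at_nonempty)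
  have "tadd v w = coord_vec c p (v c + w c)"
    by (simp add: coord_vec_add[OF c] coord_vec_inverse[OF c] vw)
  then show ?thesis using coord_vec_tangent[OF c] by simp
qed

lemma tscale_tangent: "v \<in> tangent_space p \<Longrightarrow> tscale r v \<in> tangent_space p"
proof -
  assume v: "v \<in> tangent_space p"
  obtain c where c: "c \<in> charts_at p" by (rule charts_at_nonempty)
  have "tscale r v = coord_vec c p (r *\<^sub>R v c)"
    by (simp add: coord_vec_scale[OF c] coord_vec_inverse[OF c] v)
  then show ?thesis using coord_vec_tangent[OF c] by simp
qed

lemma coord_vec_0: "c \<in> charts_at p \<Longrightarrow> coord_vec c p 0 = (\<lambda>c. 0)"
  using coord_vec_scale[of c p 0 0] by (simp add: tscale_def)

text \<open>The change of coordinates on the tangent bundle, where the states \<open>(x, v)\<close>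
  of geodesics live.\<close>

definition tangent_map :: "('a, 'e) chart \<Rightarrow> ('a, 'e) chart \<Rightarrow> 'e \<times> 'e \<Rightarrow> 'e \<times> 'e" where
  "tangent_map c c' z = (transition c c' (fst z), fderiv (transition c c') (fst z) (snd z))"

lemma tangent_map_Ck:
  assumes c: "c \<in> A" "c' \<in> A"
  shows "Ck_on k (tangent_map c c') (transition_dom c c' \<times> UNIV)"
proof -
  let ?S = "transition_dom c c' \<times> (UNIV :: 'e set)"
  have S: "open ?S" "open (transition_dom c c')" using open_transition_dom[OF c] by (auto intro: open_Times)
  have fst: "Ck_on k fst ?S" "fst ` ?S \<subseteq> transition_dom c c'" "Ck_on k snd ?S"
    using S by (auto intro: Ck_on_bounded_linear bounded_linear_fst bounded_linear_snd)
  have 1: "Ck_on k (\<lambda>z. transition c c' (fst z)) ?S"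
    by (rule Ck_on_compose[OF S fst(2) transition_Ck[OF c] fst(1)])
  have 2: "Ck_on k (\<lambda>z. fderiv (transition c c') (fst z) (snd z)) ?S"
  proof (rule Ck_on_linear_family[OF S(1), where B = "\<lambda>z. fderiv (transition c c') (fst z)"])
    show "linear (fderiv (transition c c') (fst z))" if "z \<in> ?S" for z
      using that transition_deriv_linear[OF c] by auto
    show "Ck_on k (\<lambda>z. fderiv (transition c c') (fst z) a) ?S" for a
      by (rule Ck_on_compose[OF S fst(2) transition_deriv_Ck[OF c] fst(1)])
    show "Ck_on k snd ?S" by fact
  qed
  show ?thesis using Ck_on_Pair[OF S(1) 1 2] by (simp add: tangent_map_def[abs_def])
qed

lemma transition_deriv_along:
  assumes c: "c \<in> A" "c' \<in> A" and xz: "x z \<in> transition_dom c c'" "z \<in> I"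
    and x: "(x has_derivative x') (at z within I)" and a: "(a has_derivative a') (at z within I)"
  shows "((\<lambda>s. fderiv (transition c c') (x s) (a s)) has_derivative
    (\<lambda>h. transition_deriv2 c c' (x z) (x' h) (a z) + fderiv (transition c c') (x z) (a' h)))
    (at z within I)"
  unfolding transition_deriv2_def
proof (rule has_derivative_linear_family[where B = "\<lambda>y. fderiv (transition c c') y" and x = x and a = a and z = z and I = I,
      OF open_transition_dom[OF c] xz _ _ x a])
  show "(\<lambda>y. fderiv (transition c c') y a) differentiable (at (x z))" for a
    using transition_deriv_Ck[OF c, of "Suc 0"] xz by auto
qed (rule transition_deriv_linear[OF c])

text \<open>The second component \<open>w\<close> of a variation of a state is not tensorial, whence
  the Hessian term; only after a Christoffel term is added does it become a covariant
  derivative.\<close>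

lemma tangent_map_derivative:
  assumes c: "c \<in> A" "c' \<in> A" "x \<in> transition_dom c c'"
  shows "fderiv (tangent_map c c') (x, v) (u, w) =
    (fderiv (transition c c') x u,
     transition_deriv2 c c' x u v + fderiv (transition c c') x w)"
proof -
  let ?T = "transition c c'"
  have t: "(?T has_derivative fderiv ?T x) (at x)"
    using transition_has_derivative[OF c] .
  have f: "(fst has_derivative fst) (at (x, v))" "(snd has_derivative snd) (at (x, v))"
    by (auto intro!: derivative_eq_intros)
  have "((\<lambda>z. ?T (fst z)) has_derivative (\<lambda>h. fderiv ?T x (fst h))) (at (x, v))"
    by (rule has_derivative_compose[OF f(1)]) (use t in simp)
  moreover have "((\<lambda>s. fderiv ?T (fst s) (snd s)) has_derivative
    (\<lambda>h. transition_deriv2 c c' (fst (x, v)) (fst h) (snd (x, v)) + fderiv ?T (fst (x, v)) (snd h)))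
    (at (x, v))"
    by (rule transition_deriv_along[OF c(1,2) _ UNIV_I f]) (use c in simp)
  ultimately have *: "(tangent_map c c' has_derivative (\<lambda>h. (fderiv ?T x (fst h),
     transition_deriv2 c c' x (fst h) v + fderiv ?T x (snd h)))) (at (x, v))"
    unfolding tangent_map_def[abs_def] by (intro has_derivative_Pair) auto
  show ?thesis unfolding frechet_derivative_at[OF *, symmetric] by simp
qed

text \<open>On the overlap the field in \<open>c'\<close> is the derivative of the transition map
  applied to the field in \<open>c\<close>. The product rule differentiates both factors, and the
  first one yields the Hessian term.\<close>

lemma chart_deriv_field:
  assumes c: "c \<in> charts_at p" "c' \<in> charts_at p" and W: "open W" "p \<in> W"
    and Z: "\<And>q. q \<in> W \<Longrightarrow> Z q \<in> tangent_space q"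
    and d: "in_chart c (\<lambda>q. Z q c) differentiable (at (snd c p))"
    and v: "v \<in> tangent_space p"
  shows "chart_deriv c' (\<lambda>q. Z q c') p (v c') =
    fderiv (transition c c') (snd c p) (chart_deriv c (\<lambda>q. Z q c) p (v c)) +
    transition_deriv2 c c' (snd c p) (v c) (Z p c)"
proof -
  note cA = charts_atD(1)[OF c(1)] charts_atD(1)[OF c(2)]
  let ?x' = "snd c' p" and ?x = "snd c p" and ?s = "transition c' c"
  have x': "?x' \<in> transition_dom c' c" "?x \<in> transition_dom c c'" using c by (auto intro: transition_domI)
  have sx: "?s ?x' = ?x" using transition_chart[OF c(2)] by simp
  let ?D = "fderiv (in_chart c (\<lambda>q. Z q c)) ?x"
  have D: "(in_chart c (\<lambda>q. Z q c) has_derivative ?D) (at (?s ?x'))"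
    using d frechet_derivative_works sx by metis
  have s: "(?s has_derivative fderiv ?s ?x') (at ?x')"
    by (rule transition_has_derivative[OF cA(2,1) x'(1)])
  have z: "((\<lambda>y. in_chart c (\<lambda>q. Z q c) (?s y)) has_derivative (\<lambda>h. ?D (fderiv ?s ?x' h))) (at ?x')"
    using has_derivative_compose[OF s D] .
  have *: "((\<lambda>y. fderiv (transition c c') (?s y) (in_chart c (\<lambda>q. Z q c) (?s y))) has_derivative
    (\<lambda>h. transition_deriv2 c c' (?s ?x') (fderiv ?s ?x' h) (in_chart c (\<lambda>q. Z q c) (?s ?x')) +
      fderiv (transition c c') (?s ?x') (?D (fderiv ?s ?x' h)))) (at ?x')"
    by (rule transition_deriv_along[OF cA _ UNIV_I s z]) (use sx x' in simp)
  \<comment> \<open>The points of both charts that lie in \<open>W\<close>: there \<open>Z\<close>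
    is tangent, so its two coordinate expressions are related.\<close>
  let ?N = "snd c' ` (fst c' \<inter> (fst c \<inter> W))"
  have N: "open ?N" "?x' \<in> ?N"
    using chart_image_open[OF cA(2), of "fst c \<inter> W"] open_chart_dom[OF cA(1)] W charts_atD(2)[OF c(1)]
      charts_atD(2)[OF c(2)] by auto
  have **: "(in_chart c' (\<lambda>q. Z q c') has_derivative
    (\<lambda>h. transition_deriv2 c c' (?s ?x') (fderiv ?s ?x' h) (in_chart c (\<lambda>q. Z q c) (?s ?x')) +
      fderiv (transition c c') (?s ?x') (?D (fderiv ?s ?x' h)))) (at ?x')"
  proof (rule has_derivative_transform_within_open[OF * N])
    fix y assume "y \<in> ?N"
    then obtain q where q: "y = snd c' q" "q \<in> fst c'" "q \<in> fst c" "q \<in> W" by blast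
    have cq: "c \<in> charts_at q" "c' \<in> charts_at q" using cA q by (auto intro: charts_atI)
    show "fderiv (transition c c') (?s y) (in_chart c (\<lambda>q. Z q c) (?s y)) = in_chart c' (\<lambda>q. Z q c') y"
      using tangent_transition[OF Z[OF q(4)] cq] by (simp add: q(1) transition_chart cq in_chart_eq cinv_chart)
  qed
  have "fderiv ?s ?x' (v c') = v c"
    using tangent_transition[OF v c(2,1)] by simp
  then have "chart_deriv c' (\<lambda>q. Z q c') p (v c') =
      transition_deriv2 c c' ?x (v c) (in_chart c (\<lambda>q. Z q c) ?x) +
      fderiv (transition c c') ?x (?D (v c))"
    unfolding chart_deriv_def frechet_derivative_at[OF **, symmetric] sx by simp
  then show ?thesis
    by (simp add: in_chart_eq cinv_chart c chart_deriv_def)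
qed

text \<open>These fields are constant in the chart \<open>c\<close> and serve as test fields for the
  hypothesis on sectional curvature, which asks for smoothness in every chart.\<close>

lemma coord_field_smooth:
  assumes c: "c \<in> A"
  shows "smooth_vfield_on (fst c) (\<lambda>q. coord_vec c q a)"
  unfolding smooth_vfield_on_def smooth_on_def
proof (intro conjI ballI allI)
  show "coord_vec c q a \<in> tangent_space q" if "q \<in> fst c" for q
    using coord_vec_tangent[OF charts_atI[OF c that]] .
  fix c' k assume c': "c' \<in> A"
  have "Ck_on k (\<lambda>y. fderiv (transition c c') (transition c' c y) a) (transition_dom c' c)"
    by (rule Ck_on_compose[OF open_transition_dom[OF c' c] open_transition_dom[OF c c'] _
          transition_deriv_Ck[OF c c'] transition_Ck[OF c' c]]) (use transition_in[OF c' c] in auto)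
  then have "Ck_on k (in_chart c' (\<lambda>q. coord_vec c q a c')) (transition_dom c' c)"
  proof (rule Ck_on_cong[OF open_transition_dom[OF c' c]])
    fix y assume y: "y \<in> transition_dom c' c"
    show "fderiv (transition c c') (transition c' c y) a = in_chart c' (\<lambda>q. coord_vec c q a c') y"
      using transition_domE[OF c' c y] by (simp add: in_chart_eq coord_vec_transition transition_eq)
  qed
  then show "Ck_on k (in_chart c' (\<lambda>q. coord_vec c q a c')) (snd c' ` (fst c' \<inter> fst c))"
    by (simp add: transition_dom_def)
qed

end

section \<open>Christoffel symbols and curvature in charts\<close>

context riemannian_manifold
begin

definition chart_metric :: "('a, 'e) chart \<Rightarrow> 'e \<Rightarrow> 'e \<Rightarrow> 'e \<Rightarrow> real" where
  "chart_metric c x a b = g (cinv c x) (coord_vec c (cinv c x) a) (coord_vec c (cinv c x) b)"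

definition chart_christoffel :: "('a, 'e) chart \<Rightarrow> 'e \<Rightarrow> 'e \<Rightarrow> 'e \<Rightarrow> 'e" where
  "chart_christoffel c x = christoffel c (cinv c x)"

text \<open>The classical coordinate formula for \<open>R(a, b) b\<close>, with \<open>a\<close> and
  \<open>b\<close> extended as fields constant in the chart: their bracket vanishes, which leaves
  the commutator of two covariant derivatives.\<close>

definition chart_curvature :: "('a, 'e) chart \<Rightarrow> 'e \<Rightarrow> 'e \<Rightarrow> 'e \<Rightarrow> 'e" where
  "chart_curvature c x a b =
     fderiv (\<lambda>y. chart_christoffel c y b b) x a
     + chart_christoffel c x a (chart_christoffel c x b b)
     - fderiv (\<lambda>y. chart_christoffel c y a b) x b
     - chart_christoffel c x b (chart_christoffel c x a b)"

lemma chart_metric_Ck: "c \<in> A \<Longrightarrow> Ck_on k (\<lambda>x. chart_metric c x a b) (cdom c)"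
  using metric_smooth[of c a b]
  by (simp add: smooth_on_def in_chart_eq[abs_def] chart_metric_def[abs_def] cdom_def)

lemma chart_metric_sym: "c \<in> A \<Longrightarrow> x \<in> cdom c \<Longrightarrow> chart_metric c x a b = chart_metric c x b a"
  unfolding chart_metric_def by (rule metric_chart_sym[OF cinv_charts_at])

lemma chart_metric_bilinear: "c \<in> A \<Longrightarrow> x \<in> cdom c \<Longrightarrow> bilinear (chart_metric c x)"
proof -
  assume c: "c \<in> A" "x \<in> cdom c"
  have 1: "chart_metric c x (a + a') b = chart_metric c x a b + chart_metric c x a' b"
    "chart_metric c x (r *\<^sub>R a) b = r * chart_metric c x a b" for a a' b r
    using metric_chart_add[OF cinv_charts_at[OF c]] metric_chart_scale[OF cinv_charts_at[OF c]]
    by (simp_all add: chart_metric_def)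
  then have 2: "chart_metric c x b (a + a') = chart_metric c x b a + chart_metric c x b a'"
    "chart_metric c x b (r *\<^sub>R a) = r * chart_metric c x b a" for a a' b r
    using chart_metric_sym[OF c] by metis+
  show "bilinear (chart_metric c x)"
    unfolding bilinear_def by (intro conjI allI linearI) (simp_all add: 1 2)
qed

lemma chart_metric_pos: "c \<in> A \<Longrightarrow> x \<in> cdom c \<Longrightarrow> a \<noteq> 0 \<Longrightarrow> chart_metric c x a a > 0"
  using metric_pos[OF coord_vec_tangent[OF cinv_charts_at], of c x a]
    coord_vec_self[OF cinv_charts_at, of c x a] by (force simp: chart_metric_def)

lemma chart_metric_inj:
  assumes c: "c \<in> A" "x \<in> cdom c" and eq: "\<And>b. chart_metric c x a b = chart_metric c x a' b"
  shows "a = a'"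
proof (rule ccontr)
  assume "a \<noteq> a'"
  moreover have "chart_metric c x (a - a') (a - a') = 0"
    using eq by (simp add: bilinear_lsub[OF chart_metric_bilinear[OF c]])
  ultimately show False using chart_metric_pos[OF c, of "a - a'"] by simp
qed

lemma metric_in_chart:
  assumes "c \<in> charts_at p" "v \<in> tangent_space p" "w \<in> tangent_space p"
  shows "g p v w = chart_metric c (snd c p) (v c) (w c)"
  using assms by (simp add: chart_metric_def cinv_chart coord_vec_inverse)

lemma chart_metric_transition:
  assumes "c \<in> A" "c' \<in> A" "x \<in> transition_dom c c'"
  shows "chart_metric c x a b = chart_metric c' (transition c c' x)
    (fderiv (transition c c') x a) (fderiv (transition c c') x b)"
proof -
  note c = transition_domE[OF assms]
  let ?p = "cinv c x"
  have "chart_metric c' (snd c' ?p) (coord_vec c ?p a c') (coord_vec c ?p b c') =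
    g ?p (coord_vec c ?p a) (coord_vec c ?p b)"
    by (rule metric_in_chart[symmetric, OF c(2) coord_vec_tangent[OF c(1)] coord_vec_tangent[OF c(1)]])
  then show ?thesis
    using c by (simp add: chart_metric_def[of c] coord_vec_transition transition_eq)
qed

lemma is_christoffel_chart:
  assumes "c \<in> A" "x \<in> cdom c"
  shows "is_christoffel c (cinv c x) (chart_christoffel c x)"
  using theI'[OF christoffel_ex1[OF cinv_charts_at[OF assms]]]
  by (simp add: chart_christoffel_def christoffel_def)

lemma chart_christoffel_bilinear: "c \<in> A \<Longrightarrow> x \<in> cdom c \<Longrightarrow> bilinear (chart_christoffel c x)"
  using is_christoffel_chart by (simp add: is_christoffel_def)

lemma chart_christoffel_sym:
  "c \<in> A \<Longrightarrow> x \<in> cdom c \<Longrightarrow> chart_christoffel c x a b = chart_christoffel c x b a"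
  using is_christoffel_chart unfolding is_christoffel_def by blast

lemma chart_metric_derivative:
  assumes c: "c \<in> A" "x \<in> cdom c"
  shows "fderiv (\<lambda>y. chart_metric c y a b) x u =
    chart_metric c x (chart_christoffel c x u a) b + chart_metric c x a (chart_christoffel c x u b)"
proof -
  have "chart_deriv c (\<lambda>q. g q (coord_vec c q a) (coord_vec c q b)) (cinv c x) u =
      fderiv (\<lambda>y. chart_metric c y a b) x u"
    by (simp add: chart_deriv_def in_chart_eq[abs_def] chart_metric_def[abs_def] chart_cinv c)
  then show ?thesis
    using is_christoffel_chart[OF c] by (simp add: is_christoffel_def chart_metric_def)
qed

text \<open>Metric compatibility for three placements of the arguments, added with signs, leaves by
  symmetry twice the wanted term. Thus the Christoffel symbols solve a linear system determined by
  the metric.\<close>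

lemma chart_christoffel_koszul:
  assumes c: "c \<in> A" "x \<in> cdom c"
  shows "chart_metric c x (chart_christoffel c x u a) b =
    (fderiv (\<lambda>y. chart_metric c y a b) x u
     + fderiv (\<lambda>y. chart_metric c y u b) x a
     - fderiv (\<lambda>y. chart_metric c y u a) x b) / 2"
  unfolding chart_metric_derivative[OF c]
  using chart_christoffel_sym[OF c, of u b] chart_christoffel_sym[OF c, of a b]
    chart_christoffel_sym[OF c, of a u]
    chart_metric_sym[OF c, of a "chart_christoffel c x u b"] chart_metric_sym[OF c, of u "chart_christoffel c x a b"]
  by simp

text \<open>The Koszul formula against the basis vectors is a linear system with the Gram matrix as
  coefficients, injective by definiteness, and with first derivatives of the metric on the right.
  Class C^1 is what the construction of the geodesic flow requires.\<close>

lemma chart_christoffel_C1: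
  assumes c: "c \<in> A"
  shows "Ck_on (Suc 0) (\<lambda>x. chart_christoffel c x u a) (cdom c)"
proof -
  let ?B = "\<lambda>x z. \<Sum>i\<in>Basis. chart_metric c x z i *\<^sub>R i"
  let ?D = "\<lambda>u a b x. fderiv (\<lambda>y. chart_metric c y a b) x u"
  let ?k = "\<lambda>i x. (?D u a i x + ?D a u i x + (- 1) *\<^sub>R ?D i u a x) * (1 / 2)"
  note S = open_cdom[OF c]
  have D: "Ck_on (Suc 0) (?D u a b) (cdom c)" for u a b
    using chart_metric_Ck[OF c, of "Suc (Suc 0)" a b] by simp
  have k: "Ck_on (Suc 0) (?k i) (cdom c)" for i
    by (rule Ck_on_bilinear[OF S bounded_bilinear_mult Ck_on_add[OF S Ck_on_add[OF S D D] 
        Ck_on_scaleR[OF S Ck_on_const[OF S] D]] Ck_on_const[OF S]])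
  show ?thesis
  proof (rule linear_solve_C1[OF S, of ?B])
    fix x assume x: "x \<in> cdom c"
    note bil = chart_metric_bilinear[OF c x]
    show "linear (?B x)"
      by (intro linearI) (auto simp: bilinear_ladd[OF bil] bilinear_lmul[OF bil] scaleR_add_left sum.distrib scaleR_sum_right)
    show "inj (?B x)"
    proof (rule injI)
      fix z w assume eq: "?B x z = ?B x w"
      have "chart_metric c x z i = chart_metric c x w i" if "i \<in> Basis" for i
        using arg_cong[OF eq, of "\<lambda>v. v \<bullet> i"] that by (simp only: inner_sum_left_Basis)
      then have "chart_metric c x z b = chart_metric c x w b" for b
        using linear_eq_on_span[of "chart_metric c x z" "chart_metric c x w" Basis b] bil
        by (simp add: bilinear_def)
      then show "z = w" by (rule chart_metric_inj[OF c x])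
    qed
    show "?B x (chart_christoffel c x u a) = (\<Sum>i\<in>Basis. ?k i x *\<^sub>R i)"
      by (intro sum.cong refl) (simp add: chart_christoffel_koszul[OF c x])
  next
    show "Ck_on (Suc 0) (\<lambda>x. ?B x b) (cdom c)" for b
      by (intro Ck_on_sum Ck_on_scaleR Ck_on_const chart_metric_Ck c S finite_Basis)
    show "Ck_on (Suc 0) (\<lambda>x. \<Sum>i\<in>Basis. ?k i x *\<^sub>R i) (cdom c)"
      by (intro Ck_on_sum[OF S finite_Basis] Ck_on_scaleR[OF S k] Ck_on_const[OF S])
  qed
qed

text \<open>Compatibility replaces the derivative of the metric coefficients by Christoffel symbols,
  so that the product rule comes out in terms of covariant derivatives of \<open>a\<close> and
  \<open>b\<close> along \<open>x\<close>.\<close>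

lemma chart_metric_along:
  assumes c: "c \<in> A" and xz: "x z \<in> cdom c" "z \<in> I"
    and x: "(x has_derivative x') (at z within I)"
    and a: "(a has_derivative a') (at z within I)" and b: "(b has_derivative b') (at z within I)"
  shows "((\<lambda>s. chart_metric c (x s) (a s) (b s)) has_derivative
    (\<lambda>h. chart_metric c (x z) (a' h + chart_christoffel c (x z) (x' h) (a z)) (b z)
       + chart_metric c (x z) (a z) (b' h + chart_christoffel c (x z) (x' h) (b z)))) (at z within I)"
proof -
  note bil = chart_metric_bilinear[OF c]
  have "(\<lambda>y. chart_metric c y a b) differentiable (at (x z))" for a b
    using chart_metric_Ck[OF c, of "Suc 0" a b] xz by auto
  from has_derivative_bilinear_family[where B = "chart_metric c" and x = x and z = z and a = a and b = b and I = I, OF open_cdom[OF c] xz bil this x a b]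
  show ?thesis
    by (simp add: chart_metric_derivative[OF c xz(1)] bilinear_ladd[OF bil[OF xz(1)]]
        bilinear_radd[OF bil[OF xz(1)]] algebra_simps)
qed

lemma chart_christoffel_along:
  assumes c: "c \<in> A" and xz: "x z \<in> cdom c" "z \<in> I"
    and x: "(x has_derivative x') (at z within I)"
    and a: "(a has_derivative a') (at z within I)" and b: "(b has_derivative b') (at z within I)"
  shows "((\<lambda>s. chart_christoffel c (x s) (a s) (b s)) has_derivative
    (\<lambda>h. fderiv (\<lambda>y. chart_christoffel c y (a z) (b z)) (x z) (x' h)
       + chart_christoffel c (x z) (a' h) (b z) + chart_christoffel c (x z) (a z) (b' h))) (at z within I)"
proof (rule has_derivative_bilinear_family[where B = "chart_christoffel c" and x = x and z = z and a = a and b = b and I = I, OF open_cdom[OF c] xz chart_christoffel_bilinear[OF c] _ x a b])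
  show "(\<lambda>y. chart_christoffel c y a b) differentiable (at (x z))" for a b
    using chart_christoffel_C1[OF c, of a b] xz by auto
qed

text \<open>Compatibility with the metric in both charts makes the difference of the two sides, with its value
  lowered by the metric, skew in the last two slots; being symmetric in the first two, it vanishes.\<close>

lemma chart_christoffel_transition:
  assumes c: "c \<in> A" "c' \<in> A" "x \<in> transition_dom c c'"
  defines "T \<equiv> fderiv (transition c c') x"
  shows "chart_christoffel c' (transition c c' x) (T u) (T a) =
    T (chart_christoffel c x u a) - transition_deriv2 c c' x u a"
proof -
  let ?t = "transition c c'"
  let ?G = "chart_metric c' (?t x)"
  define \<Delta> where "\<Delta> u a = T (chart_christoffel c x u a) - transition_deriv2 c c' x u a
    - chart_christoffel c' (?t x) (T u) (T a)" for u a
  have xd: "x \<in> cdom c" "?t x \<in> cdom c'"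
    using c transition_dom_subset transition_in by blast+
  note bil = chart_metric_bilinear[OF c(2) xd(2)]
  have \<Delta>sym: "\<Delta> u a = \<Delta> a u" for u a
    unfolding \<Delta>_def using chart_christoffel_sym[OF c(1) xd(1), of u a]
      chart_christoffel_sym[OF c(2) xd(2), of "T u" "T a"] transition_deriv2_sym[OF c, of u a] by simp
  have *: "?G (\<Delta> u a) (T b) + ?G (T a) (\<Delta> u b) = 0" for u a b
  proof -
    let ?Da = "\<lambda>a y. fderiv ?t y a"
    have t: "(?t has_derivative T) (at x)" unfolding T_def by (rule transition_has_derivative[OF c])
    have D: "(?Da a has_derivative (\<lambda>h. transition_deriv2 c c' x h a)) (at x)" for a
    proof -
      have "(?Da a has_derivative (\<lambda>h. transition_deriv2 c c' x h a + fderiv ?t x 0)) (at x)"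
        by (rule transition_deriv_along[OF c(1,2) _ UNIV_I, where x = "\<lambda>y. y" and a = "\<lambda>y. a"])
          (use c in auto)
      then show ?thesis
        using linear_0[OF transition_deriv_linear[OF c]] by simp
    qed
    \<comment> \<open>The function differentiated here is the metric of \<open>c\<close> in
      disguise. Comparison with its derivative computed in \<open>c\<close> gives the
      skewness.\<close>
    have "((\<lambda>y. chart_metric c' (?t y) (?Da a y) (?Da b y)) has_derivative
      (\<lambda>h. ?G (transition_deriv2 c c' x h a + chart_christoffel c' (?t x) (T h) (?Da a x)) (?Da b x)
       + ?G (?Da a x) (transition_deriv2 c c' x h b + chart_christoffel c' (?t x) (T h) (?Da b x)))) (at x)"
      by (rule chart_metric_along[OF c(2) xd(2) UNIV_I t D D])
    then have "((\<lambda>y. chart_metric c y a b) has_derivative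
      (\<lambda>h. ?G (transition_deriv2 c c' x h a + chart_christoffel c' (?t x) (T h) (?Da a x)) (?Da b x)
       + ?G (?Da a x) (transition_deriv2 c c' x h b + chart_christoffel c' (?t x) (T h) (?Da b x)))) (at x)"
      by (rule has_derivative_transform_within_open[OF _ open_transition_dom[OF c(1,2)] c(3)])
        (simp add: chart_metric_transition[OF c(1,2)])
    from fun_cong[OF frechet_derivative_at[OF this], of u]
    have "?G (transition_deriv2 c c' x u a + chart_christoffel c' (?t x) (T u) (T a)) (T b)
       + ?G (T a) (transition_deriv2 c c' x u b + chart_christoffel c' (?t x) (T u) (T b)) =
      fderiv (\<lambda>y. chart_metric c y a b) x u"
      unfolding T_def by simp
    also have "\<dots> = ?G (T (chart_christoffel c x u a)) (T b) + ?G (T a) (T (chart_christoffel c x u b))"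
      unfolding chart_metric_derivative[OF c(1) xd(1)] chart_metric_transition[OF c] T_def ..
    finally show ?thesis
      by (simp add: \<Delta>_def bilinear_lsub[OF bil] bilinear_rsub[OF bil] bilinear_ladd[OF bil] bilinear_radd[OF bil])
  qed
  define S where "S u a b = ?G (\<Delta> u a) (T b)" for u a b
  have S1: "S u a b = S a u b" for u a b unfolding S_def using \<Delta>sym by simp
  have S2: "S u a b = - S u b a" for u a b
    using *[of u a b] chart_metric_sym[OF c(2) xd(2), of "T a"] by (simp add: S_def)
  \<comment> \<open>Three skew exchanges of the last two slots alternate with three symmetric
    exchanges of the first two; the arguments return to their places and the sign is -1.\<close>
  have S0: "S u a b = 0" for u a b
    using S2[of u a b] S1[of u b a] S2[of b u a] S1[of b a u] S2[of a b u] S1[of a u b] by linarith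
  \<comment> \<open>Nondegeneracy tests against all vectors, whereas so far only images under
    \<open>T\<close> have served as test vectors.\<close>
  have surj: "\<exists>b. v = T b" for v
    using transition_deriv_inverse[OF c(2,1) transition_in[OF c], of v] transition_transition[OF c]
    unfolding T_def by metis
  have "\<Delta> u a = 0"
  proof (rule chart_metric_inj[OF c(2) xd(2)])
    fix v
    obtain b where "v = T b" using surj by blast
    then show "?G (\<Delta> u a) v = ?G 0 v"
      using S0[of u a b] by (simp add: S_def bilinear_lzero[OF bil])
  qed
  then show ?thesis by (simp add: \<Delta>_def)
qed

section \<open>Covariant derivative and curvature in coordinates\<close>

lemma nabla_chart:
  assumes "c \<in> charts_at p"
  shows "nabla p v X c = chart_deriv c (\<lambda>q. X q c) p (v c) + chart_christoffel c (snd c p) (v c) (X p c)"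
  using assms by (simp add: nabla_def chart_christoffel_def cinv_chart)

text \<open>The Hessian terms of the differentiated field and of the Christoffel symbols cancel, so
  the coordinate expressions fit together to a tangent vector. This must be known before
  \<open>g\<close> can be evaluated in a chart, because the laws of the metric concern tangent
  vectors only.\<close>

lemma nabla_tangent:
  assumes c: "c \<in> charts_at p" and W: "open W" "p \<in> W"
    and Z: "\<And>q. q \<in> W \<Longrightarrow> Z q \<in> tangent_space q"
    and d: "in_chart c (\<lambda>q. Z q c) differentiable (at (snd c p))"
    and v: "v \<in> tangent_space p"
  shows "nabla p v Z \<in> tangent_space p"
proof -
  have "nabla p v Z c' = coord_vec c p (nabla p v Z c) c'" for c'
  proof (cases "c' \<in> charts_at p")
    case True
    note cA = charts_atD(1)[OF c] charts_atD(1)[OF True] transition_domI[OF c True]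
    let ?T = "fderiv (transition c c') (snd c p)"
    note lin = transition_deriv_linear[OF cA]
    have f: "chart_deriv c' (\<lambda>q. Z q c') p (v c') = ?T (chart_deriv c (\<lambda>q. Z q c) p (v c)) +
        transition_deriv2 c c' (snd c p) (v c) (Z p c)"
      by (rule chart_deriv_field[where Z = Z, OF c True W Z d v])
    have "nabla p v Z c' = ?T (chart_deriv c (\<lambda>q. Z q c) p (v c)) +
        transition_deriv2 c c' (snd c p) (v c) (Z p c) +
        chart_christoffel c' (snd c' p) (v c') (Z p c')"
      by (simp only: nabla_chart[OF True] f)
    also have "chart_christoffel c' (snd c' p) (v c') (Z p c') =
        ?T (chart_christoffel c (snd c p) (v c) (Z p c)) - transition_deriv2 c c' (snd c p) (v c) (Z p c)"
      unfolding tangent_transition[OF v c True] tangent_transition[OF Z[OF W(2)] c True]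
      using chart_christoffel_transition[OF cA] by (simp add: transition_chart[OF c])
    finally show ?thesis
      unfolding coord_vec_transition[OF True] nabla_chart[OF c] by (simp add: linear_add[OF lin])
  next
    case False
    then show ?thesis unfolding nabla_def coord_vec_def by simp
  qed
  then have "nabla p v Z = coord_vec c p (nabla p v Z c)" by blast
  then show ?thesis using coord_vec_tangent[OF c] by metis
qed

text \<open>The fields are constant in \<open>c\<close>, so there the first covariant derivatives
  are plain Christoffel symbols and the bracket vanishes; what remains is
  \<open>chart_curvature\<close>. Agreement in the other charts follows from tangency.\<close>

lemma curvature_coord_fields:
  assumes c: "c \<in> charts_at p"
  shows "curvature (\<lambda>q. coord_vec c q a) (\<lambda>q. coord_vec c q b) (\<lambda>q. coord_vec c q b) p =
    coord_vec c p (chart_curvature c (snd c p) a b)"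
proof -
  let ?X = "\<lambda>a q. coord_vec c q a" and ?x = "snd c p"
  note cA = charts_atD[OF c]
  note W = open_chart_dom[OF cA(1)] cA(2)
  have cq: "c \<in> charts_at q" if "q \<in> fst c" for q using charts_atI[OF cA(1) that] .
  have tan: "?X a q \<in> tangent_space q" if "q \<in> fst c" for a q by (rule coord_vec_tangent[OF cq[OF that]])
  have const: "in_chart c (\<lambda>q. ?X a q c) y = a" if "y \<in> cdom c" for a y
    using coord_vec_self[OF cinv_charts_at[OF cA(1) that]] by (simp add: in_chart_eq)
  have const_d: "(in_chart c (\<lambda>q. ?X a q c) has_derivative (\<lambda>h. 0)) (at y)" if "y \<in> cdom c" for a y
    by (rule has_derivative_transform_within_open[OF has_derivative_const open_cdom[OF cA(1)] that])
      (simp add: const)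
  have cd0: "chart_deriv c (\<lambda>q. ?X a q c) q u = 0" if "q \<in> fst c" for a q u
    using const_d[OF chart_in_cdom[OF cq[OF that]]] unfolding chart_deriv_def
    by (metis frechet_derivative_at)
  have diff: "in_chart c (\<lambda>q. ?X a q c) differentiable (at (snd c q))" if "q \<in> fst c" for a q
    using const_d[OF chart_in_cdom[OF cq[OF that]]] by (auto simp: differentiable_def)
  have nt: "nabla q (?X a q) (?X b) \<in> tangent_space q" if "q \<in> fst c" for a b q
    by (rule nabla_tangent[OF cq[OF that] W(1) that tan diff[OF that] tan[OF that]])
  have nc: "nabla q (?X a q) (?X b) c = chart_christoffel c (snd c q) a b" if "q \<in> fst c" for a b q
    unfolding nabla_chart[OF cq[OF that]] cd0[OF that] coord_vec_self[OF cq[OF that]] by simp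
  have in_nc: "in_chart c (\<lambda>q. nabla q (?X a q) (?X b) c) y = chart_christoffel c y a b" if "y \<in> cdom c" for a b y
    unfolding in_chart_eq using nc[OF cinv_in[OF that]] chart_cinv[OF that] by simp
  have x: "?x \<in> cdom c" by (rule chart_in_cdom[OF c])
  have dGam: "(in_chart c (\<lambda>q. nabla q (?X a q) (?X b) c) has_derivative
      fderiv (\<lambda>y. chart_christoffel c y a b) ?x) (at ?x)" for a b
    by (rule has_derivative_transform_within_open[OF Ck_on_has_derivative[OF chart_christoffel_C1[OF cA(1)] x]
          open_cdom[OF cA(1)] x]) (simp add: in_nc)
  have n2t: "nabla p (?X d p) (\<lambda>q. nabla q (?X a q) (?X b)) \<in> tangent_space p" for a b d
    by (rule nabla_tangent[OF c W nt _ tan[OF cA(2)]]) (use dGam in \<open>auto simp: differentiable_def\<close>)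
  have n2c: "nabla p (?X d p) (\<lambda>q. nabla q (?X a q) (?X b)) c =
    fderiv (\<lambda>y. chart_christoffel c y a b) ?x d + chart_christoffel c ?x d (chart_christoffel c ?x a b)" for a b d
    unfolding nabla_chart[OF c, of "?X d p" "\<lambda>q. nabla q (?X a q) (?X b)"] nc[OF cA(2)] coord_vec_self[OF c]
    by (simp add: chart_deriv_def frechet_derivative_at[OF dGam, symmetric])
  \<comment> \<open>\<open>lie_bracket\<close> is defined chart by chart, so it has to vanish in
    every other chart, too. There each of its two terms is a Hessian term, and these agree by
    symmetry.\<close>
  have lie: "lie_bracket (?X a) (?X b) p = (\<lambda>c. 0)"
  proof
    fix c'
    show "lie_bracket (?X a) (?X b) p c' = 0"
    proof (cases "c' \<in> charts_at p")
      case True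
      note T = charts_atD(1)[OF c] charts_atD(1)[OF True] transition_domI[OF c True]
      have "chart_deriv c' (\<lambda>q. ?X b q c') p (?X a p c') = transition_deriv2 c c' ?x a b" for a b
      proof -
        have "chart_deriv c' (\<lambda>q. ?X b q c') p (?X a p c') =
            fderiv (transition c c') ?x (chart_deriv c (\<lambda>q. ?X b q c) p (?X a p c)) +
            transition_deriv2 c c' ?x (?X a p c) (?X b p c)"
          by (rule chart_deriv_field[where Z = "?X b", OF c True W tan diff[OF cA(2)] tan[OF cA(2)]])
        then show ?thesis
          unfolding cd0[OF cA(2)] coord_vec_self[OF c]
          by (simp add: linear_0[OF transition_deriv_linear[OF T]])
      qed
      then show ?thesis
        using True transition_deriv2_sym[OF T, of a b] by (simp add: lie_bracket_def)
    next
      case False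
      then show ?thesis by (simp add: lie_bracket_def)
    qed
  qed
  have n0: "nabla p (\<lambda>c. 0) (?X b) = (\<lambda>c. 0)"
  proof (rule tangent_eqI[OF _ _ c])
    have z: "(\<lambda>c. 0) \<in> tangent_space p" using coord_vec_tangent[OF c, of 0] coord_vec_0[OF c] by simp
    show "nabla p (\<lambda>c. 0) (?X b) \<in> tangent_space p"
      by (rule nabla_tangent[where Z = "?X b", OF c W tan diff[OF cA(2)] z])
    show "(\<lambda>c. 0) \<in> tangent_space p" by fact
    show "nabla p (\<lambda>c. 0) (?X b) c = 0"
      unfolding nabla_chart[OF c] cd0[OF cA(2)] by (simp add: bilinear_lzero[OF chart_christoffel_bilinear[OF cA(1) x]])
  qed
  have "curvature (?X a) (?X b) (?X b) p =
    tadd (nabla p (?X a p) (\<lambda>q. nabla q (?X b q) (?X b)))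
      (tscale (- 1) (nabla p (?X b p) (\<lambda>q. nabla q (?X a q) (?X b))))"
    unfolding curvature_def lie n0 by (simp add: tadd_def tscale_def)
  moreover have "\<dots> \<in> tangent_space p" by (intro tadd_tangent tscale_tangent n2t)
  ultimately have "curvature (?X a) (?X b) (?X b) p \<in> tangent_space p" by simp
  then show ?thesis
  proof (rule tangent_eqI[OF _ coord_vec_tangent[OF c] c])
    show "curvature (?X a) (?X b) (?X b) p c = coord_vec c p (chart_curvature c ?x a b) c"
      unfolding curvature_def lie n0 n2c coord_vec_self[OF c] chart_curvature_def by simp
  qed
qed

text \<open>For independent \<open>a\<close> and \<open>b\<close> the hypothesis is applied to the
  fields constant in the chart, and the denominator of the sectional curvature is positive. For
  dependent vectors, which the hypothesis does not cover, the curvature expression vanishes.\<close>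

lemma chart_curvature_nonpos:
  assumes K: nonpositive_sectional_curvature and c: "c \<in> A" "x \<in> cdom c"
  shows "chart_metric c x (chart_curvature c x a b) a \<le> 0"
proof -
  let ?p = "cinv c x"
  let ?X = "\<lambda>a q. coord_vec c q a"
  let ?G = "chart_metric c x"
  note cp = cinv_charts_at[OF c]
  note bG = chart_metric_bilinear[OF c] and bC = chart_christoffel_bilinear[OF c]
  note G = bilinear_ladd[OF bG] bilinear_radd[OF bG] bilinear_lmul[OF bG] bilinear_rmul[OF bG]
    bilinear_lsub[OF bG] bilinear_rsub[OF bG] bilinear_lzero[OF bG] bilinear_rzero[OF bG]
  have comb: "tadd (tscale r (?X a ?p)) (tscale s (?X b ?p)) = (\<lambda>c. 0) \<longleftrightarrow> r *\<^sub>R a + s *\<^sub>R b = 0" for r s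
    using coord_vec_self[OF cp, of "r *\<^sub>R a + s *\<^sub>R b"] coord_vec_0[OF cp]
    by (auto simp: coord_vec_add[OF cp, symmetric] coord_vec_scale[OF cp, symmetric])
  show ?thesis
  proof (cases "tindependent (?X a ?p) (?X b ?p)")
    case True
    have ind: "r = 0 \<and> s = 0" if "r *\<^sub>R a + s *\<^sub>R b = 0" for r s
      using True that unfolding tindependent_def comb by blast
    have "b \<noteq> 0" using ind[of 0 1] by auto
    then have Gb: "?G b b > 0" by (rule chart_metric_pos[OF c])
    \<comment> \<open>A multiple of the component of \<open>a\<close> orthogonal to
      \<open>b\<close>. Its squared length is \<open>?G b b\<close> times the Gram determinant,
      which is thereby positive: the strict Cauchy-Schwarz inequality.\<close>
    let ?d = "?G b b *\<^sub>R a - ?G a b *\<^sub>R b"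
    have "?d \<noteq> 0" using ind[of "?G b b" "- ?G a b"] Gb by auto
    then have "?G ?d ?d > 0" by (rule chart_metric_pos[OF c])
    also have "?G ?d ?d = ?G b b * (?G a a * ?G b b - (?G a b)\<^sup>2)"
      using chart_metric_sym[OF c, of b a] by (simp add: G algebra_simps power2_eq_square)
    finally have pos: "?G a a * ?G b b - (?G a b)\<^sup>2 > 0" using Gb by (simp add: zero_less_mult_iff)
    have "sectional_curvature (?X a) (?X b) ?p \<le> 0"
      using K[unfolded nonpositive_sectional_curvature_def, rule_format, of "fst c" ?p "?X a" "?X b"]
        open_chart_dom[OF c(1)] cinv_in[OF c(2)] coord_field_smooth[OF c(1)] True by blast
    then have "?G (chart_curvature c x a b) a / (?G a a * ?G b b - (?G a b)\<^sup>2) \<le> 0"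
      unfolding sectional_curvature_def curvature_coord_fields[OF cp] chart_cinv[OF c(2)]
      by (simp add: chart_metric_def)
    then show ?thesis using pos by (simp add: divide_le_0_iff)
  next
    case False
    then obtain r s where rs: "r *\<^sub>R a + s *\<^sub>R b = 0" "r \<noteq> 0 \<or> s \<noteq> 0"
      unfolding tindependent_def comb by blast
    have fd: "fderiv (\<lambda>y. chart_christoffel c y (l *\<^sub>R u) (m *\<^sub>R v)) x h =
      (l * m) *\<^sub>R fderiv (\<lambda>y. chart_christoffel c y u v) x h" for l m u v h
    proof -
      have "((\<lambda>y. (l * m) *\<^sub>R chart_christoffel c y u v) has_derivative
        (\<lambda>h. (l * m) *\<^sub>R fderiv (\<lambda>y. chart_christoffel c y u v) x h)) (at x)"
        by (intro has_derivative_scaleR_right Ck_on_has_derivative[OF chart_christoffel_C1[OF c(1)] c(2)])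
      then have "((\<lambda>y. chart_christoffel c y (l *\<^sub>R u) (m *\<^sub>R v)) has_derivative
        (\<lambda>h. (l * m) *\<^sub>R fderiv (\<lambda>y. chart_christoffel c y u v) x h)) (at x)"
      proof (rule has_derivative_transform_within_open[OF _ open_cdom[OF c(1)] c(2)])
        fix y assume "y \<in> cdom c"
        from chart_christoffel_bilinear[OF c(1) this]
        show "(l * m) *\<^sub>R chart_christoffel c y u v = chart_christoffel c y (l *\<^sub>R u) (m *\<^sub>R v)"
          by (simp add: bilinear_lmul bilinear_rmul)
      qed
      then show ?thesis by (simp add: frechet_derivative_at[symmetric])
    qed
    have lin: "linear (fderiv (\<lambda>y. chart_christoffel c y u v) x)" for u v
      using Ck_on_has_derivative[OF chart_christoffel_C1[OF c(1)] c(2)] by (rule has_derivative_linear)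
    \<comment> \<open>For multiples of one vector the derivative terms and the quadratic terms of
      the curvature cancel in pairs.\<close>
    have R: "chart_curvature c x (l *\<^sub>R u) (m *\<^sub>R u) = 0" for l m u
      unfolding chart_curvature_def fd linear_scale[OF lin]
      by (simp add: bilinear_lmul[OF bC] bilinear_rmul[OF bC] mult_ac)
    have "chart_curvature c x a b = 0"
    proof (cases "r = 0")
      case True
      then have "b = 0" using rs by auto
      then show ?thesis using R[of 1 a 0] by simp
    next
      case False
      have "a + (s / r) *\<^sub>R b = (1 / r) *\<^sub>R (r *\<^sub>R a + s *\<^sub>R b)"
        using False by (simp add: scaleR_add_right)
      then have "a = (- (s / r)) *\<^sub>R b" using rs(1) by (simp add: eq_neg_iff_add_eq_0)
      then show ?thesis using R[of "- (s / r)" b 1] by simp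
    qed
    then show ?thesis by (simp add: G)
  qed
qed

end

section \<open>Geodesics as solutions of a first-order system\<close>

lemma has_vector_derivative_shift:
  fixes f :: "real \<Rightarrow> 'b::real_normed_vector"
  assumes "(f has_vector_derivative D) (at (t + k) within J)" "\<And>s. s \<in> I \<Longrightarrow> s + k \<in> J"
  shows "((\<lambda>s. f (s + k)) has_vector_derivative D) (at t within I)"
proof -
  have "((\<lambda>s. s + k) has_vector_derivative 1) (at t within I)"
    by (auto intro!: derivative_eq_intros)
  moreover have "(f has_vector_derivative D) (at (t + k) within (\<lambda>s. s + k) ` I)"
    using assms by (intro has_vector_derivative_within_subset[OF assms(1)]) auto
  ultimately show ?thesis
    using vector_diff_chain_within[of "\<lambda>s. s + k" 1 t I f D] by (simp add: comp_def)
qed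

lemma has_vector_derivative_glue:
  fixes f h :: "real \<Rightarrow> 'b::real_normed_vector"
  assumes abd: "a \<le> b" "b \<le> d" and t: "t \<in> {a..d}" and eq: "t = b \<Longrightarrow> f b = h b"
    and f: "t \<le> b \<Longrightarrow> (f has_vector_derivative D) (at t within {a..b})"
    and h: "b \<le> t \<Longrightarrow> (h has_vector_derivative D) (at t within {b..d})"
  shows "((\<lambda>s. if s \<le> b then f s else h s) has_vector_derivative D) (at t within {a..d})"
proof -
  have u: "{a..d} = {a..b} \<union> {b..d}" "{a..b} \<inter> {b..d} = {b}" using abd by auto
  have "((\<lambda>s. if s \<in> {a..b} then f s else h s) has_vector_derivative (if t \<in> {a..b} then D else D)) (at t within {a..d})"
  proof (rule has_vector_derivative_If_within_closures)
    show "t \<in> {a..b} \<union> {b..d}" using t u by simp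
    show "{a..d} = {a..b} \<union> {b..d}" by (rule u)
    assume "t \<in> closure {a..b}" "t \<in> closure {b..d}"
    then show "f t = h t" using eq by auto
  qed (use f h u abd in \<open>auto simp: insert_absorb\<close>)
  then have *: "((\<lambda>s. if s \<in> {a..b} then f s else h s) has_vector_derivative D) (at t within {a..d})" by simp
  show ?thesis
    by (rule has_vector_derivative_transform[OF t _ *]) auto
qed

lemma increasing_within_interval:
  fixes f :: "real \<Rightarrow> real"
  assumes "a \<le> b" "\<And>t. t \<in> {a..b} \<Longrightarrow> (f has_vector_derivative D t) (at t within {a..b})"
    and "\<And>t. t \<in> {a..b} \<Longrightarrow> 0 \<le> D t"
  shows "f a \<le> f b"
proof -
  obtain t where t: "t \<in> {a..b}" "f b - f a = (b - a) *\<^sub>R D t"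
    using mvt_very_simple[OF assms(1), of f "\<lambda>t h. h *\<^sub>R D t"] assms(2)
    by (auto simp: has_vector_derivative_def)
  then have "0 \<le> f b - f a" using assms(1) assms(3)[OF t(1)] by simp
  then show ?thesis by simp
qed

lemma C1_locally_lipschitz:
  fixes f :: "'b::euclidean_space \<Rightarrow> 'c::real_normed_vector"
  assumes S: "open S" "z \<in> S" and f: "Ck_on (Suc 0) f S"
  obtains R L where "R > 0" "L > 0" "cball z R \<subseteq> S"
    "\<And>x y. x \<in> cball z R \<Longrightarrow> y \<in> cball z R \<Longrightarrow> norm (f x - f y) \<le> L * norm (x - y)"
proof -
  let ?f' = "\<lambda>x. Blinfun (fderiv f x)"
  obtain R where R: "R > 0" "cball z R \<subseteq> S" using S open_contains_cball by blast
  have cont: "continuous_on (cball z R) ?f'"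
    using continuous_on_subset[OF Ck_on_1_blinfun(1)[OF f] R(2)] .
  obtain L where L: "L > 0" "\<And>x. x \<in> cball z R \<Longrightarrow> norm (?f' x) \<le> L"
    using compact_imp_bounded[OF compact_continuous_image[OF cont compact_cball]]
    by (auto simp: bounded_pos)
  have "norm (f x - f y) \<le> L * norm (x - y)" if xy: "x \<in> cball z R" "y \<in> cball z R" for x y
  proof (rule differentiable_bound[OF convex_cball[of z R] _ _ xy])
    fix w assume w: "w \<in> cball z R"
    then have wS: "w \<in> S" using R(2) by auto
    show "(f has_derivative fderiv f w) (at w within cball z R)"
      by (rule has_derivative_at_withinI[OF Ck_on_has_derivative[OF f wS]])
    show "onorm (fderiv f w) \<le> L"
      using L(2)[OF w] Ck_on_1_blinfun(2)[OF f wS] by (simp add: norm_blinfun.rep_eq)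
  qed
  then show thesis using that R L by blast
qed

context smooth_manifold
begin

lemma eventually_charts_at:
  assumes "continuous_on I \<gamma>" "t \<in> I" "c \<in> charts_at (\<gamma> t)"
  shows "\<forall>\<^sub>F s in at t within I. c \<in> charts_at (\<gamma> s)"
proof -
  have "(\<gamma> \<longlongrightarrow> \<gamma> t) (at t within I)" using assms by (simp add: continuous_on_def)
  then have "\<forall>\<^sub>F s in at t within I. \<gamma> s \<in> fst c"
    using topological_tendstoD open_chart_dom charts_atD[OF assms(3)] by blast
  then show ?thesis by eventually_elim (rule charts_atI[OF charts_atD(1)[OF assms(3)]])
qed

lemma transition_deriv2_scale:
  assumes "c \<in> A" "c' \<in> A" "x \<in> transition_dom c c'"
  shows "transition_deriv2 c c' x (r *\<^sub>R u) a = r *\<^sub>R transition_deriv2 c c' x u a"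
  unfolding transition_deriv2_def
  using Ck_on_has_derivative[OF transition_deriv_Ck[OF assms(1,2)] assms(3)]
  by (intro linear_scale has_derivative_linear)

lemma transition_along:
  assumes c: "c \<in> A" "c' \<in> A" and xt: "x t \<in> transition_dom c c'"
    and x: "(x has_vector_derivative x') (at t within I)"
  shows "((\<lambda>s. transition c c' (x s)) has_vector_derivative fderiv (transition c c') (x t) x')
    (at t within I)"
  using has_derivative_compose[OF x[unfolded has_vector_derivative_def] transition_has_derivative[OF c xt]]
  by (simp add: has_vector_derivative_def linear_scale[OF transition_deriv_linear[OF c xt]])

end

context riemannian_manifold
begin

text \<open>The velocity \<open>V\<close> is a component of its own, which makes the geodesic
  equation a first-order system. On a one-point interval, where a derivative of
  \<open>\<gamma>\<close> carries no information, the state still has a velocity; changes of charts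
  use this.\<close>

definition geodesic_flow_on :: "real set \<Rightarrow> (real \<Rightarrow> 'a) \<Rightarrow> (real \<Rightarrow> ('a, 'e) tvec) \<Rightarrow> bool" where
  "geodesic_flow_on I \<gamma> V \<longleftrightarrow> continuous_on I \<gamma> \<and> (\<forall>t\<in>I. V t \<in> tangent_space (\<gamma> t) \<and>
     (\<forall>c\<in>charts_at (\<gamma> t). ((\<lambda>s. snd c (\<gamma> s)) has_vector_derivative V t c) (at t within I) \<and>
       ((\<lambda>s. V s c) has_vector_derivative - chart_christoffel c (snd c (\<gamma> t)) (V t c) (V t c)) (at t within I)))"

text \<open>The geodesic spray in a chart: the vector field on states \<open>(x, v)\<close> whose
  integral curves are the geodesics with their velocities.\<close>

definition geodesic_field :: "('a, 'e) chart \<Rightarrow> 'e \<times> 'e \<Rightarrow> 'e \<times> 'e" where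
  "geodesic_field c z = (snd z, - chart_christoffel c (fst z) (snd z) (snd z))"

lemma geodesic_flow_onD:
  assumes "geodesic_flow_on I \<gamma> V"
  shows "continuous_on I \<gamma>" "t \<in> I \<Longrightarrow> V t \<in> tangent_space (\<gamma> t)"
    "t \<in> I \<Longrightarrow> c \<in> charts_at (\<gamma> t) \<Longrightarrow> ((\<lambda>s. snd c (\<gamma> s)) has_vector_derivative V t c) (at t within I)"
    "t \<in> I \<Longrightarrow> c \<in> charts_at (\<gamma> t) \<Longrightarrow>
      ((\<lambda>s. V s c) has_vector_derivative - chart_christoffel c (snd c (\<gamma> t)) (V t c) (V t c)) (at t within I)"
  using assms unfolding geodesic_flow_on_def by blast+

lemma geodesic_flow_state:
  assumes "geodesic_flow_on I \<gamma> V" "t \<in> I" "c \<in> charts_at (\<gamma> t)"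
  shows "((\<lambda>s. (snd c (\<gamma> s), V s c)) has_vector_derivative geodesic_field c (snd c (\<gamma> t), V t c)) (at t within I)"
  using geodesic_flow_onD(3,4)[OF assms] by (simp add: geodesic_field_def has_vector_derivative_Pair)

lemma geodesic_flow_on_subset:
  "geodesic_flow_on I \<gamma> V \<Longrightarrow> J \<subseteq> I \<Longrightarrow> geodesic_flow_on J \<gamma> V"
  unfolding geodesic_flow_on_def
  by (meson continuous_on_subset has_vector_derivative_within_subset subset_iff)

lemma geodesic_field_C1:
  assumes c: "c \<in> A"
  shows "Ck_on (Suc 0) (geodesic_field c) (cdom c \<times> UNIV)"
proof -
  let ?S = "cdom c \<times> (UNIV :: 'e set)"
  have S: "open ?S" using open_cdom[OF c] by (auto intro: open_Times)
  have 1: "Ck_on (Suc 0) fst ?S" "fst ` ?S \<subseteq> cdom c" "Ck_on (Suc 0) snd ?S"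
    using S by (auto intro!: Ck_on_bounded_linear bounded_linear_fst bounded_linear_snd simp del: Ck_on.simps)
  have "Ck_on (Suc 0) (\<lambda>z. chart_christoffel c (fst z) (snd z) (snd z)) ?S"
    by (rule Ck_on_bilinear_family[OF open_cdom[OF c] chart_christoffel_bilinear[OF c] chart_christoffel_C1[OF c]
          S 1(2,1,3,3)])
  from Ck_on_Pair[OF S 1(3) Ck_on_linear_comp[OF S bounded_linear_minus[OF bounded_linear_ident] this]]
  show ?thesis by (simp add: geodesic_field_def[abs_def] del: Ck_on.simps)
qed

text \<open>The right side is that of the linearized geodesic equation, that is, of the Jacobi
  equation before it is brought into covariant form.\<close>

lemma geodesic_field_derivative:
  assumes c: "c \<in> A" "x \<in> cdom c"
  shows "fderiv (geodesic_field c) (x, v) (u, w) =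
    (w, - (fderiv (\<lambda>y. chart_christoffel c y v v) x u
      + chart_christoffel c x w v + chart_christoffel c x v w))"
proof -
  have f: "(fst has_derivative fst) (at (x, v))" "(snd has_derivative snd) (at (x, v))"
    by (auto intro!: derivative_eq_intros)
  have "((\<lambda>s. chart_christoffel c (fst s) (snd s) (snd s)) has_derivative
    (\<lambda>h. fderiv (\<lambda>y. chart_christoffel c y (snd (x, v)) (snd (x, v))) (fst (x, v)) (fst h)
       + chart_christoffel c (fst (x, v)) (snd h) (snd (x, v)) + chart_christoffel c (fst (x, v)) (snd (x, v)) (snd h)))
    (at (x, v))"
    by (rule chart_christoffel_along[OF c(1) _ UNIV_I f(1,2,2)]) (use c in simp)
  then have "(geodesic_field c has_derivative (\<lambda>h. (snd h,
     - (fderiv (\<lambda>y. chart_christoffel c y v v) x (fst h)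
       + chart_christoffel c x (snd h) v + chart_christoffel c x v (snd h))))) (at (x, v))"
    unfolding geodesic_field_def[abs_def] by (intro has_derivative_Pair has_derivative_minus f) simp
  from fun_cong[OF frechet_derivative_at[OF this], of "(u, w)"] show ?thesis by simp
qed

text \<open>Under a change of charts the acceleration picks up a Hessian term and the Christoffel
  symbols pick up the opposite one, so solving the equation in one chart is enough.\<close>

lemma geodesic_flow_in_chart:
  assumes c: "c \<in> A" and x: "\<And>t. t \<in> I \<Longrightarrow> fst (z t) \<in> cdom c"
    and z: "\<And>t. t \<in> I \<Longrightarrow> (z has_vector_derivative geodesic_field c (z t)) (at t within I)"
  shows "geodesic_flow_on I (\<lambda>t. cinv c (fst (z t))) (\<lambda>t. coord_vec c (cinv c (fst (z t))) (snd (z t)))"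
    (is "geodesic_flow_on I ?\<gamma> ?V")
proof -
  have zcont: "continuous_on I z" by (rule continuous_on_vector_derivative[OF z])
  have cont: "continuous_on I ?\<gamma>"
    by (rule continuous_on_compose2[OF cinv_continuous[OF c] continuous_on_fst[OF zcont]]) (use x in auto)
  have "((\<lambda>s. snd c' (?\<gamma> s)) has_vector_derivative ?V t c') (at t within I) \<and>
      ((\<lambda>s. ?V s c') has_vector_derivative - chart_christoffel c' (snd c' (?\<gamma> t)) (?V t c') (?V t c')) (at t within I)"
    if t: "t \<in> I" and c': "c' \<in> charts_at (?\<gamma> t)" for t c'
  proof
    let ?x = "\<lambda>t. fst (z t)" and ?v = "\<lambda>t. snd (z t)"
    note cA = c charts_atD(1)[OF c']
    have cc: "c \<in> charts_at (?\<gamma> s)" "snd c (?\<gamma> s) = ?x s" if "s \<in> I" for s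
      using cinv_charts_at[OF c x[OF that]] chart_cinv[OF x[OF that]] by auto
    have xt: "?x t \<in> transition_dom c c'" using transition_domI[OF cc(1)[OF t] c'] cc(2)[OF t] by simp
    have dx: "(?x has_vector_derivative ?v t) (at t within I)"
      using bounded_linear.has_vector_derivative[OF bounded_linear_fst z[OF t]] by (simp add: geodesic_field_def)
    have dv: "(?v has_vector_derivative - chart_christoffel c (?x t) (?v t) (?v t)) (at t within I)"
      using bounded_linear.has_vector_derivative[OF bounded_linear_snd z[OF t]] by (simp add: geodesic_field_def)
    have Vt: "?V s c' = fderiv (transition c c') (?x s) (?v s)" if "s \<in> I" "c' \<in> charts_at (?\<gamma> s)" for s
      using coord_vec_transition[OF that(2)] cc(2)[OF that(1)] by simp
    show "((\<lambda>s. snd c' (?\<gamma> s)) has_vector_derivative ?V t c') (at t within I)"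
      using transition_along[OF cA xt dx] unfolding Vt[OF t c'] by (simp add: transition_eq)
    let ?T = "fderiv (transition c c') (?x t)"
    have law: "transition_deriv2 c c' (?x t) (?v t) (?v t) + ?T (- chart_christoffel c (?x t) (?v t) (?v t)) =
        - chart_christoffel c' (snd c' (?\<gamma> t)) (?T (?v t)) (?T (?v t))"
      using chart_christoffel_transition[OF cA xt, of "?v t" "?v t"]
      by (simp add: transition_eq linear_neg[OF transition_deriv_linear[OF cA xt]])
    have "((\<lambda>s. fderiv (transition c c') (?x s) (?v s)) has_vector_derivative
      transition_deriv2 c c' (?x t) (?v t) (?v t) + ?T (- chart_christoffel c (?x t) (?v t) (?v t))) (at t within I)"
      unfolding has_vector_derivative_def scaleR_add_right transition_deriv2_scale[OF cA xt, symmetric]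
        linear_scale[OF transition_deriv_linear[OF cA xt], symmetric]
      by (rule transition_deriv_along[OF cA xt t dx[unfolded has_vector_derivative_def] dv[unfolded has_vector_derivative_def]])
    then have D: "((\<lambda>s. fderiv (transition c c') (?x s) (?v s)) has_vector_derivative
      - chart_christoffel c' (snd c' (?\<gamma> t)) (?V t c') (?V t c')) (at t within I)"
      unfolding law Vt[OF t c'] .
    have "\<forall>\<^sub>F s in at t within I. c' \<in> charts_at (?\<gamma> s) \<and> s \<in> I"
      using eventually_charts_at[OF cont t c'] by (rule eventually_conj) (simp add: eventually_at_filter)
    then have ev: "\<forall>\<^sub>F s in at t within I. fderiv (transition c c') (?x s) (?v s) = ?V s c'"
      by eventually_elim (simp add: Vt)
    show "((\<lambda>s. ?V s c') has_vector_derivative - chart_christoffel c' (snd c' (?\<gamma> t)) (?V t c') (?V t c')) (at t within I)"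
      using D ev unfolding has_vector_derivative_def
      by (rule has_derivative_transform_eventually) (simp_all add: Vt t c')
  qed
  moreover have "?V t \<in> tangent_space (?\<gamma> t)" if "t \<in> I" for t
    using coord_vec_tangent[OF cinv_charts_at[OF c x[OF that]]] .
  ultimately show ?thesis using cont unfolding geodesic_flow_on_def by blast
qed

lemma geodesic_flow_glue:
  assumes g1: "geodesic_flow_on {a..b} \<gamma> V" and g2: "geodesic_flow_on {b..d} \<gamma>' V'" and abd: "a \<le> b" "b \<le> d"
    and eq: "\<gamma> b = \<gamma>' b" "V b = V' b"
  shows "geodesic_flow_on {a..d} (\<lambda>t. if t \<le> b then \<gamma> t else \<gamma>' t) (\<lambda>t. if t \<le> b then V t else V' t)"
    (is "geodesic_flow_on _ ?\<gamma> ?V")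
  unfolding geodesic_flow_on_def
proof (intro conjI ballI)
  have "{a..d} = {a..b} \<union> {b..d}" using abd by auto
  then show "continuous_on {a..d} ?\<gamma>"
    using continuous_on_If[of "{a..b}" "{b..d}" \<gamma> \<gamma>' "\<lambda>t. t \<le> b"] geodesic_flow_onD(1)[OF g1] geodesic_flow_onD(1)[OF g2] eq
    by auto
  fix t assume t: "t \<in> {a..d}"
  have l: "?\<gamma> t = \<gamma> t" "?V t = V t" "t \<in> {a..b}" if "t \<le> b" using that t by auto
  have r: "?\<gamma> t = \<gamma>' t" "?V t = V' t" "t \<in> {b..d}" if "b \<le> t" using that t eq by (auto simp: le_less)
  show "?V t \<in> tangent_space (?\<gamma> t)"
  proof (cases "t \<le> b")
    case True
    then show ?thesis using geodesic_flow_onD(2)[OF g1] l[OF True] by simp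
  next
    case False
    then have "b \<le> t" by simp
    then show ?thesis using geodesic_flow_onD(2)[OF g2] r by simp
  qed
  fix c assume c: "c \<in> charts_at (?\<gamma> t)"
  have "((\<lambda>s. if s \<le> b then snd c (\<gamma> s) else snd c (\<gamma>' s)) has_vector_derivative ?V t c) (at t within {a..d})"
  proof (rule has_vector_derivative_glue[OF abd t])
    show "((\<lambda>s. snd c (\<gamma> s)) has_vector_derivative ?V t c) (at t within {a..b})" if "t \<le> b"
      using geodesic_flow_onD(3)[OF g1 l(3)[OF that], of c] c unfolding l(1,2)[OF that] .
    show "((\<lambda>s. snd c (\<gamma>' s)) has_vector_derivative ?V t c) (at t within {b..d})" if "b \<le> t"
      using geodesic_flow_onD(3)[OF g2 r(3)[OF that], of c] c unfolding r(1,2)[OF that] .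
  qed (simp add: eq)
  moreover have "(\<lambda>s. if s \<le> b then snd c (\<gamma> s) else snd c (\<gamma>' s)) = (\<lambda>s. snd c (?\<gamma> s))" by auto
  ultimately show "((\<lambda>s. snd c (?\<gamma> s)) has_vector_derivative ?V t c) (at t within {a..d})" by simp
  have "((\<lambda>s. if s \<le> b then V s c else V' s c) has_vector_derivative
    - chart_christoffel c (snd c (?\<gamma> t)) (?V t c) (?V t c)) (at t within {a..d})"
  proof (rule has_vector_derivative_glue[OF abd t])
    show "((\<lambda>s. V s c) has_vector_derivative - chart_christoffel c (snd c (?\<gamma> t)) (?V t c) (?V t c)) (at t within {a..b})"
      if "t \<le> b"
      using geodesic_flow_onD(4)[OF g1 l(3)[OF that], of c] c unfolding l(1,2)[OF that] .
    show "((\<lambda>s. V' s c) has_vector_derivative - chart_christoffel c (snd c (?\<gamma> t)) (?V t c) (?V t c)) (at t within {b..d})"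
      if "b \<le> t"
      using geodesic_flow_onD(4)[OF g2 r(3)[OF that], of c] c unfolding r(1,2)[OF that] .
  qed (simp add: eq)
  moreover have "(\<lambda>s. if s \<le> b then V s c else V' s c) = (\<lambda>s. ?V s c)" by auto
  ultimately show "((\<lambda>s. ?V s c) has_vector_derivative - chart_christoffel c (snd c (?\<gamma> t)) (?V t c) (?V t c)) (at t within {a..d})"
    by simp
qed

section \<open>Uniqueness of geodesics with given initial velocity\<close>

lemma geodesic_flow_unique_local:
  assumes g1: "geodesic_flow_on {a..b} \<gamma> V" and g2: "geodesic_flow_on {a..b} \<gamma>' V'" and ab: "a \<le> b"
    and c: "c \<in> A" "\<And>t. t \<in> {a..b} \<Longrightarrow> \<gamma> t \<in> fst c" "\<And>t. t \<in> {a..b} \<Longrightarrow> \<gamma>' t \<in> fst c"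
    and K: "\<And>t. t \<in> {a..b} \<Longrightarrow> (snd c (\<gamma> t), V t c) \<in> K" "\<And>t. t \<in> {a..b} \<Longrightarrow> (snd c (\<gamma>' t), V' t c) \<in> K"
    and lip: "\<And>x y. x \<in> K \<Longrightarrow> y \<in> K \<Longrightarrow> norm (geodesic_field c x - geodesic_field c y) \<le> L * norm (x - y)"
    and L: "0 \<le> L" "(b - a) * L \<le> 1 / 2"
    and eq: "\<gamma> a = \<gamma>' a" "V a = V' a"
  shows "\<gamma> b = \<gamma>' b \<and> V b = V' b"
proof -
  let ?z = "\<lambda>t. (snd c (\<gamma> t), V t c)" and ?z' = "\<lambda>t. (snd c (\<gamma>' t), V' t c)"
  let ?u = "\<lambda>t. ?z (t + a) - ?z' (t + a)"
  have cc: "c \<in> charts_at (\<gamma> t)" "c \<in> charts_at (\<gamma>' t)" if "t \<in> {a..b}" for t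
    using c that by (auto intro: charts_atI)
  \<comment> \<open>The difference of the two states, shifted to start at time 0, has initial value
    0 and satisfies the inequality without inhomogeneity, so it vanishes at the end.\<close>
  have "norm (?u (b - a)) \<le> 2 * (norm (?u 0) + (b - a) * 0)"
  proof (rule ode_bound)
    fix t assume "t \<in> {0..b - a}"
    then have t: "t + a \<in> {a..b}" by auto
    show "(?u has_vector_derivative geodesic_field c (?z (t + a)) - geodesic_field c (?z' (t + a))) (at t within {0..b - a})"
      by (intro has_vector_derivative_diff
          has_vector_derivative_shift[where f = ?z, OF geodesic_flow_state[OF g1 t cc(1)[OF t]]]
          has_vector_derivative_shift[where f = ?z', OF geodesic_flow_state[OF g2 t cc(2)[OF t]]]) auto
    show "norm (geodesic_field c (?z (t + a)) - geodesic_field c (?z' (t + a))) \<le> L * norm (?u t) + 0"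
      using lip[OF K(1)[OF t] K(2)[OF t]] by simp
  qed (use ab L in auto)
  then have e: "snd c (\<gamma> b) = snd c (\<gamma>' b)" "V b c = V' b c" using eq by (auto simp: zero_prod_def)
  have b: "b \<in> {a..b}" using ab by simp
  have "\<gamma> b = \<gamma>' b" using e(1) cinv_chart[OF cc(1)[OF b]] cinv_chart[OF cc(2)[OF b]] by metis
  then show ?thesis
    using tangent_eqI[where v = "V b" and w = "V' b" and c = c, OF geodesic_flow_onD(2)[OF g1 b] _ cc(1)[OF b] e(2)]
      geodesic_flow_onD(2)[OF g2 b] by simp
qed

lemma eventually_at_within_dist:
  "(\<forall>\<^sub>F s in at x within I. P s) \<Longrightarrow> P x \<Longrightarrow> \<exists>d>0. \<forall>s\<in>I. \<bar>s - x\<bar> < d \<longrightarrow> P (s :: real)"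
  unfolding eventually_at by (metis dist_real_def)

text \<open>Bisection of the interval, for the property that agreement at \<open>s\<close>
  propagates to \<open>t\<close>; it is transitive, so a proof near each time \<open>x\<close>
  suffices. If the states differ at \<open>x\<close>, they differ near \<open>x\<close>, by the
  Hausdorff property or by continuity, and the property holds vacuously. If they agree, both stay in
  one chart for times near \<open>x\<close>, where the Lipschitz estimate decides.\<close>

lemma geodesic_flow_unique:
  assumes g1: "geodesic_flow_on {a..b} \<gamma> V" and g2: "geodesic_flow_on {a..b} \<gamma>' V'" and ab: "a \<le> b"
    and eq: "\<gamma> a = \<gamma>' a" "V a = V' a"
  shows "\<gamma> b = \<gamma>' b \<and> V b = V' b"
proof -
  define P where "P s t \<longleftrightarrow> (a \<le> s \<and> s \<le> t \<and> t \<le> b \<longrightarrow> \<gamma> s = \<gamma>' s \<and> V s = V' s \<longrightarrow> \<gamma> t = \<gamma>' t \<and> V t = V' t)" for s t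
  have "P a b"
  proof (rule Bolzano[OF ab])
    show "P s u" if "P s t" "P t u" "s \<le> t" "t \<le> u" for s t u using that unfolding P_def by auto
    fix x assume "a \<le> x" "x \<le> b"
    then have x: "x \<in> {a..b}" by simp
    have lim: "(\<gamma> \<longlongrightarrow> \<gamma> x) (at x within {a..b})" "(\<gamma>' \<longlongrightarrow> \<gamma>' x) (at x within {a..b})"
      using geodesic_flow_onD(1)[OF g1] geodesic_flow_onD(1)[OF g2] x by (auto simp: continuous_on_def)
    have vac: "\<exists>d>0. \<forall>s t. s \<le> x \<and> x \<le> t \<and> t - s < d \<longrightarrow> P s t"
      if ev: "\<forall>\<^sub>F s in at x within {a..b}. \<not> (\<gamma> s = \<gamma>' s \<and> V s = V' s)" and ne: "\<not> (\<gamma> x = \<gamma>' x \<and> V x = V' x)"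
    proof -
      obtain d where d: "d > 0" "\<And>s. s \<in> {a..b} \<Longrightarrow> \<bar>s - x\<bar> < d \<Longrightarrow> \<not> (\<gamma> s = \<gamma>' s \<and> V s = V' s)"
        using eventually_at_within_dist[OF ev ne] by blast
      show ?thesis
      proof (intro exI[of _ d] conjI allI impI)
        fix s t assume st: "s \<le> x \<and> x \<le> t \<and> t - s < d"
        show "P s t"
          unfolding P_def
        proof (intro impI)
          assume "a \<le> s \<and> s \<le> t \<and> t \<le> b" "\<gamma> s = \<gamma>' s \<and> V s = V' s"
          then show "\<gamma> t = \<gamma>' t \<and> V t = V' t" using d(2)[of s] st by auto
        qed
      qed (use d in simp)
    qed
    show "\<exists>d>0. \<forall>s t. s \<le> x \<and> x \<le> t \<and> t - s < d \<longrightarrow> P s t"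
    proof (cases "\<gamma> x = \<gamma>' x")
      case False
      then obtain U U' where U: "open U" "open U'" "\<gamma> x \<in> U" "\<gamma>' x \<in> U'" "U \<inter> U' = {}"
        using hausdorff by metis
      have "\<forall>\<^sub>F s in at x within {a..b}. \<gamma> s \<in> U" "\<forall>\<^sub>F s in at x within {a..b}. \<gamma>' s \<in> U'"
        using topological_tendstoD[OF lim(1) U(1,3)] topological_tendstoD[OF lim(2) U(2,4)] by auto
      then have "\<forall>\<^sub>F s in at x within {a..b}. \<not> (\<gamma> s = \<gamma>' s \<and> V s = V' s)"
        by eventually_elim (use U(5) in auto)
      then show ?thesis using vac False by blast
    next
      case True
      obtain c where c: "c \<in> charts_at (\<gamma> x)" by (rule charts_at_nonempty)
      then have c': "c \<in> charts_at (\<gamma>' x)" using True by simp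
      let ?z = "\<lambda>t. (snd c (\<gamma> t), V t c)" and ?z' = "\<lambda>t. (snd c (\<gamma>' t), V' t c)"
      have z: "(?z \<longlongrightarrow> ?z x) (at x within {a..b})" "(?z' \<longlongrightarrow> ?z' x) (at x within {a..b})"
        using has_vector_derivative_continuous[OF geodesic_flow_state[OF g1 x c]]
          has_vector_derivative_continuous[OF geodesic_flow_state[OF g2 x c']]
        unfolding continuous_within by auto
      show ?thesis
      proof (cases "V x = V' x")
        case False
        then have ne: "V x c \<noteq> V' x c"
          using tangent_eqI[where v = "V x" and w = "V' x" and c = c, OF geodesic_flow_onD(2)[OF g1 x] _ c] geodesic_flow_onD(2)[OF g2 x] True by auto
        have "((\<lambda>t. V t c - V' t c) \<longlongrightarrow> V x c - V' x c) (at x within {a..b})"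
          using tendsto_snd[OF z(1)] tendsto_snd[OF z(2)] by (auto intro!: tendsto_intros)
        then have "\<forall>\<^sub>F t in at x within {a..b}. V t c - V' t c \<noteq> 0"
          using ne by (intro tendsto_imp_eventually_ne) auto
        then have "\<forall>\<^sub>F s in at x within {a..b}. \<not> (\<gamma> s = \<gamma>' s \<and> V s = V' s)"
          by eventually_elim auto
        then show ?thesis using vac False by blast
      next
        case Veq: True
        note cA = charts_atD(1)[OF c]
        obtain R L where RL: "R > 0" "L > 0" "cball (?z x) R \<subseteq> cdom c \<times> UNIV"
          "\<And>p q. p \<in> cball (?z x) R \<Longrightarrow> q \<in> cball (?z x) R \<Longrightarrow>
            norm (geodesic_field c p - geodesic_field c q) \<le> L * norm (p - q)"
        proof (rule C1_locally_lipschitz[OF _ _ geodesic_field_C1[OF cA], of "?z x"])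
          show "open (cdom c \<times> (UNIV :: 'e set))" "?z x \<in> cdom c \<times> UNIV"
            using open_cdom[OF cA] chart_in_cdom[OF c] by (auto intro: open_Times)
        qed blast
        have zz: "?z' x = ?z x" using True Veq by simp
        let ?B = "ball (?z x) R"
        have "\<forall>\<^sub>F s in at x within {a..b}. ?z s \<in> ?B" "\<forall>\<^sub>F s in at x within {a..b}. ?z' s \<in> ?B"
          using topological_tendstoD[OF z(1) open_ball] topological_tendstoD[OF z(2) open_ball] RL(1) zz by auto
        moreover note eventually_charts_at[OF geodesic_flow_onD(1)[OF g1] x c]
          eventually_charts_at[OF geodesic_flow_onD(1)[OF g2] x c']
        ultimately have ev: "\<forall>\<^sub>F s in at x within {a..b}. ?z s \<in> ?B \<and> ?z' s \<in> ?B \<and> \<gamma> s \<in> fst c \<and> \<gamma>' s \<in> fst c"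
          by eventually_elim (auto dest: charts_atD)
        have "?z x \<in> ?B \<and> ?z' x \<in> ?B \<and> \<gamma> x \<in> fst c \<and> \<gamma>' x \<in> fst c"
          unfolding zz using RL(1) charts_atD(2)[OF c] charts_atD(2)[OF c'] by simp
        from eventually_at_within_dist[OF ev this] obtain d where d: "d > 0"
          "\<And>s. s \<in> {a..b} \<Longrightarrow> \<bar>s - x\<bar> < d \<Longrightarrow> ?z s \<in> ?B \<and> ?z' s \<in> ?B \<and> \<gamma> s \<in> fst c \<and> \<gamma>' s \<in> fst c"
          by blast
        show ?thesis
        \<comment> \<open>Within \<open>d\<close> of \<open>x\<close> both curves remain in the
          chart and in the ball with Lipschitz constant \<open>L\<close>; the other bound makes the
          length of the interval times \<open>L\<close> at most 1/2, as local uniqueness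
          requires.\<close>
        proof (intro exI[of _ "min d (1 / (2 * L))"] conjI allI impI)
          show "min d (1 / (2 * L)) > 0" using d RL by simp
          fix s t assume st: "s \<le> x \<and> x \<le> t \<and> t - s < min d (1 / (2 * L))"
          show "P s t"
            unfolding P_def
          proof (intro impI)
            assume ab: "a \<le> s \<and> s \<le> t \<and> t \<le> b" and eq: "\<gamma> s = \<gamma>' s \<and> V s = V' s"
            have sub: "{s..t} \<subseteq> {a..b}" using ab by auto
            have near: "?z r \<in> ?B \<and> ?z' r \<in> ?B \<and> \<gamma> r \<in> fst c \<and> \<gamma>' r \<in> fst c" if "r \<in> {s..t}" for r
              using that st sub by (intro d(2)) auto
            have "(t - s) * L \<le> 1 / (2 * L) * L" using st RL(2) by (intro mult_right_mono) auto
            then have L: "(t - s) * L \<le> 1 / 2" using RL(2) by simp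
            show "\<gamma> t = \<gamma>' t \<and> V t = V' t"
            proof (rule geodesic_flow_unique_local[OF geodesic_flow_on_subset[OF g1 sub]
                  geodesic_flow_on_subset[OF g2 sub] _ cA _ _ _ _ _ _ L, where K = "cball (?z x) R"])
              show "norm (geodesic_field c p - geodesic_field c q) \<le> L * norm (p - q)"
                if "p \<in> cball (?z x) R" "q \<in> cball (?z x) R" for p q using RL(4)[OF that] .
              show "?z r \<in> cball (?z x) R" "?z' r \<in> cball (?z x) R" if "r \<in> {s..t}" for r
                using near[OF that] subsetD[OF ball_subset_cball] by blast+
            qed (use near ab eq RL in auto)
          qed
        qed
      qed
    qed
  qed
  then show ?thesis using ab eq unfolding P_def by simp
qed

end

section \<open>Jacobi fields and the geodesic flow\<close>

context riemannian_manifold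
begin

section \<open>Comparison with the definition of geodesics by vector derivatives\<close>

lemma geodesic_flow_velocity:
  assumes g: "geodesic_flow_on {a..b} \<gamma> V" and ab: "a < b" and t: "t \<in> {a..b}"
  shows "velocity {a..b} \<gamma> t = V t"
proof
  fix c
  show "velocity {a..b} \<gamma> t c = V t c"
  proof (cases "c \<in> charts_at (\<gamma> t)")
    case True
    then show ?thesis
      using vector_derivative_within_closed_interval[OF ab t geodesic_flow_onD(3)[OF g t True]]
      by (simp add: velocity_def comp_def)
  next
    case False
    have "V t c = 0"
      using geodesic_flow_onD(2)[OF g t] False unfolding tangent_space_def by blast
    then show ?thesis using False by (simp add: velocity_def)
  qed
qed

lemma geodesic_flow_imp_geodesic:
  assumes g: "geodesic_flow_on {a..b} \<gamma> V" and ab: "a < b"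
  shows "geodesic_on {a..b} \<gamma>"
  unfolding geodesic_on_def
proof (intro conjI ballI)
  let ?I = "{a..b}"
  have vd: "vector_derivative (snd c \<circ> \<gamma>) (at t within ?I) = V t c" if "t \<in> ?I" "c \<in> charts_at (\<gamma> t)" for t c
    using vector_derivative_within_closed_interval[OF ab that(1) geodesic_flow_onD(3)[OF g that]]
    by (simp add: comp_def)
  show "C1_curve_on ?I \<gamma>"
    unfolding C1_curve_on_def
  proof (intro conjI ballI impI)
    show "continuous_on ?I \<gamma>" by (rule geodesic_flow_onD(1)[OF g])
    fix c assume c: "c \<in> A"
    show "(snd c \<circ> \<gamma>) differentiable (at t within ?I)" if "t \<in> ?I" "\<gamma> t \<in> fst c" for t
      using geodesic_flow_onD(3)[OF g that(1) charts_atI[OF c that(2)]]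
      by (auto simp: comp_def has_vector_derivative_def differentiable_def)
    let ?J = "{t \<in> ?I. \<gamma> t \<in> fst c}"
    have "continuous (at t within ?J) (\<lambda>t. V t c)" if "t \<in> ?J" for t
      using geodesic_flow_onD(4)[OF g _ charts_atI[OF c], of t] that
      by (auto intro: continuous_within_subset[OF has_vector_derivative_continuous])
    then have "continuous_on ?J (\<lambda>t. V t c)" by (simp add: continuous_on_eq_continuous_within)
    moreover have "V t c = vector_derivative (snd c \<circ> \<gamma>) (at t within ?I)" if "t \<in> ?J" for t
      using vd[of t c] charts_atI[OF c, of "\<gamma> t"] that by simp
    ultimately show "continuous_on ?J (\<lambda>t. vector_derivative (snd c \<circ> \<gamma>) (at t within ?I))"
      by (rule continuous_on_eq)
  qed
  fix t c assume t: "t \<in> ?I" and c: "c \<in> charts_at (\<gamma> t)"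
  let ?x' = "\<lambda>s. vector_derivative (snd c \<circ> \<gamma>) (at s within ?I)"
  have "\<forall>\<^sub>F s in at t within ?I. c \<in> charts_at (\<gamma> s) \<and> s \<in> ?I"
    using eventually_charts_at[OF geodesic_flow_onD(1)[OF g] t c]
    by (rule eventually_conj) (simp add: eventually_at_filter)
  then have ev: "\<forall>\<^sub>F s in at t within ?I. V s c = ?x' s" by eventually_elim (simp add: vd)
  have "(?x' has_vector_derivative - chart_christoffel c (snd c (\<gamma> t)) (V t c) (V t c)) (at t within ?I)"
    using geodesic_flow_onD(4)[OF g t c] ev unfolding has_vector_derivative_def
    by (rule has_derivative_transform_eventually) (use t vd[OF t c] in simp_all)
  then show "let x' = ?x' in (x' has_vector_derivative - christoffel c (\<gamma> t) (x' t) (x' t)) (at t within ?I)"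
    by (simp add: vd[OF t c] chart_christoffel_def cinv_chart[OF c])
qed

lemma C1_curve_velocity_derivative:
  assumes "C1_curve_on I \<gamma>" "t \<in> I" "c \<in> charts_at (\<gamma> t)"
  shows "((\<lambda>s. snd c (\<gamma> s)) has_vector_derivative velocity I \<gamma> t c) (at t within I)"
proof -
  have "(snd c \<circ> \<gamma>) differentiable (at t within I)"
    using assms charts_atD[OF assms(3)] by (auto simp: C1_curve_on_def)
  then have "((snd c \<circ> \<gamma>) has_vector_derivative vector_derivative (snd c \<circ> \<gamma>) (at t within I)) (at t within I)"
    by (simp add: vector_derivative_works)
  then show ?thesis using assms(3) by (simp add: velocity_def comp_def)
qed

text \<open>The chain rule through the transition map, together with uniqueness of derivatives
  within a nondegenerate interval, which includes the end points.\<close>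

lemma C1_curve_velocity_tangent:
  assumes \<gamma>: "C1_curve_on {a..b} \<gamma>" and ab: "a < b" and t: "t \<in> {a..b}"
  shows "velocity {a..b} \<gamma> t \<in> tangent_space (\<gamma> t)"
proof -
  have "velocity {a..b} \<gamma> t c' = chart_deriv c (snd c') (\<gamma> t) (velocity {a..b} \<gamma> t c)"
    if c: "c \<in> charts_at (\<gamma> t)" and c': "c' \<in> charts_at (\<gamma> t)" for c c'
  proof -
    let ?v = "velocity {a..b} \<gamma> t"
    note cA = charts_atD(1)[OF c] charts_atD(1)[OF c']
    have "((\<lambda>s. transition c c' (snd c (\<gamma> s))) has_vector_derivative
      fderiv (transition c c') (snd c (\<gamma> t)) (?v c)) (at t within {a..b})"
      by (rule transition_along[OF cA transition_domI[OF c c'] C1_curve_velocity_derivative[OF \<gamma> t c]])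
    moreover have cont: "continuous_on {a..b} \<gamma>" using \<gamma> by (simp add: C1_curve_on_def)
    have "\<forall>\<^sub>F s in at t within {a..b}. transition c c' (snd c (\<gamma> s)) = snd c' (\<gamma> s)"
      using eventually_charts_at[OF cont t c] by eventually_elim (rule transition_chart)
    ultimately have "((\<lambda>s. snd c' (\<gamma> s)) has_vector_derivative
      fderiv (transition c c') (snd c (\<gamma> t)) (?v c)) (at t within {a..b})"
      unfolding has_vector_derivative_def
      by (rule has_derivative_transform_eventually) (use t in \<open>simp_all add: transition_chart[OF c]\<close>)
    from vector_derivative_within_closed_interval[OF ab t this]
      vector_derivative_within_closed_interval[OF ab t C1_curve_velocity_derivative[OF \<gamma> t c']]
    show ?thesis by (simp add: chart_deriv_transition)
  qed
  moreover have "velocity {a..b} \<gamma> t c = 0" if "c \<notin> charts_at (\<gamma> t)" for c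
    using that by (simp add: velocity_def)
  ultimately show ?thesis unfolding tangent_space_def by blast
qed

lemma geodesic_imp_geodesic_flow:
  assumes g: "geodesic_on {a..b} \<gamma>" and ab: "a < b"
  shows "geodesic_flow_on {a..b} \<gamma> (velocity {a..b} \<gamma>)"
  unfolding geodesic_flow_on_def
proof (intro conjI ballI)
  let ?I = "{a..b}" and ?V = "velocity {a..b} \<gamma>"
  have C1: "C1_curve_on ?I \<gamma>" using g by (simp add: geodesic_on_def)
  show cont: "continuous_on ?I \<gamma>" using C1 by (simp add: C1_curve_on_def)
  fix t assume t: "t \<in> ?I"
  show "?V t \<in> tangent_space (\<gamma> t)" by (rule C1_curve_velocity_tangent[OF C1 ab t])
  fix c assume c: "c \<in> charts_at (\<gamma> t)"
  show "((\<lambda>s. snd c (\<gamma> s)) has_vector_derivative ?V t c) (at t within ?I)"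
    by (rule C1_curve_velocity_derivative[OF C1 t c])
  let ?x' = "\<lambda>s. vector_derivative (snd c \<circ> \<gamma>) (at s within ?I)"
  have x': "?x' s = ?V s c" if "c \<in> charts_at (\<gamma> s)" for s using that by (simp add: velocity_def)
  have "(?x' has_vector_derivative - christoffel c (\<gamma> t) (?x' t) (?x' t)) (at t within ?I)"
    using g t c unfolding geodesic_on_def Let_def by blast
  then have "(?x' has_vector_derivative - chart_christoffel c (snd c (\<gamma> t)) (?V t c) (?V t c)) (at t within ?I)"
    by (simp add: x'[OF c] chart_christoffel_def cinv_chart[OF c])
  moreover have "\<forall>\<^sub>F s in at t within ?I. ?x' s = ?V s c"
    using eventually_charts_at[OF cont t c] by eventually_elim (rule x')
  ultimately show "((\<lambda>s. ?V s c) has_vector_derivative - chart_christoffel c (snd c (\<gamma> t)) (?V t c) (?V t c)) (at t within ?I)"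
    unfolding has_vector_derivative_def
    by (rule has_derivative_transform_eventually) (use t in \<open>simp_all add: x'[OF c]\<close>)
qed

section \<open>Jacobi fields in coordinates\<close>

lemma chart_metric_along_curve:
  assumes c: "c \<in> A" and t: "x t \<in> cdom c" "t \<in> I"
    and d: "(x has_vector_derivative x') (at t within I)" "(a has_vector_derivative a') (at t within I)"
      "(b has_vector_derivative b') (at t within I)"
  shows "((\<lambda>s. chart_metric c (x s) (a s) (b s)) has_vector_derivative
    chart_metric c (x t) (a' + chart_christoffel c (x t) x' (a t)) (b t)
    + chart_metric c (x t) (a t) (b' + chart_christoffel c (x t) x' (b t))) (at t within I)"
proof -
  note bG = chart_metric_bilinear[OF c t(1)] and bC = chart_christoffel_bilinear[OF c t(1)]
  show ?thesis
    using chart_metric_along[where x = x and z = t and a = a and b = b and I = I,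
        OF c t d[unfolded has_vector_derivative_def]]
    by (simp add: has_vector_derivative_def bilinear_lmul[OF bC] bilinear_lmul[OF bG] bilinear_rmul[OF bG]
        bilinear_ladd[OF bG] bilinear_radd[OF bG] algebra_simps)
qed

lemma chart_christoffel_along_curve:
  assumes c: "c \<in> A" and t: "x t \<in> cdom c" "t \<in> I"
    and d: "(x has_vector_derivative x') (at t within I)" "(a has_vector_derivative a') (at t within I)"
      "(b has_vector_derivative b') (at t within I)"
  shows "((\<lambda>s. chart_christoffel c (x s) (a s) (b s)) has_vector_derivative
    fderiv (\<lambda>y. chart_christoffel c y (a t) (b t)) (x t) x'
    + chart_christoffel c (x t) a' (b t) + chart_christoffel c (x t) (a t) b') (at t within I)"
proof -
  note bC = chart_christoffel_bilinear[OF c t(1)]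
  have lin: "linear (fderiv (\<lambda>y. chart_christoffel c y (a t) (b t)) (x t))"
    using Ck_on_has_derivative[OF chart_christoffel_C1[OF c] t(1)] by (rule has_derivative_linear)
  show ?thesis
    using chart_christoffel_along[where x = x and z = t and a = a and b = b and I = I,
        OF c t d[unfolded has_vector_derivative_def]]
    by (simp add: has_vector_derivative_def bilinear_lmul[OF bC] bilinear_rmul[OF bC] linear_scale[OF lin]
        scaleR_add_right)
qed

text \<open>For a variation \<open>\<zeta> = (J, J')\<close> of the state \<open>z = (x, v)\<close> of a geodesic, these are \<open>\<parallel>J\<parallel>\<^sup>2\<close> and
  \<open>\<langle>J, \<nabla>\<^sub>v J\<rangle>\<close>, half the derivative of the former.\<close>

definition jacobi_norm :: "('a, 'e) chart \<Rightarrow> 'e \<times> 'e \<Rightarrow> 'e \<times> 'e \<Rightarrow> real" where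
  "jacobi_norm c z \<zeta> = chart_metric c (fst z) (fst \<zeta>) (fst \<zeta>)"

definition jacobi_slope :: "('a, 'e) chart \<Rightarrow> 'e \<times> 'e \<Rightarrow> 'e \<times> 'e \<Rightarrow> real" where
  "jacobi_slope c z \<zeta> = chart_metric c (fst z) (fst \<zeta>) (snd \<zeta> + chart_christoffel c (fst z) (snd z) (fst \<zeta>))"

text \<open>By the Jacobi equation the derivative of \<open>\<langle>J, \<nabla>J\<rangle>\<close>
  is \<open>\<parallel>\<nabla>J\<parallel>\<^sup>2 - \<langle>R(J, v) v, J\<rangle>\<close>, and
  both contributions are nonnegative.\<close>

lemma jacobi_slope_nondecreasing:
  assumes K: nonpositive_sectional_curvature and c: "c \<in> A" and ab: "a \<le> b"
    and zc: "\<And>t. t \<in> {a..b} \<Longrightarrow> fst (z t) \<in> cdom c"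
    and z: "\<And>t. t \<in> {a..b} \<Longrightarrow> (z has_vector_derivative geodesic_field c (z t)) (at t within {a..b})"
    and \<zeta>: "\<And>t. t \<in> {a..b} \<Longrightarrow>
      (\<zeta> has_vector_derivative fderiv (geodesic_field c) (z t) (\<zeta> t)) (at t within {a..b})"
  shows "jacobi_slope c (z a) (\<zeta> a) \<le> jacobi_slope c (z b) (\<zeta> b)"
proof -
  define x v J w where "x t = fst (z t)" and "v t = snd (z t)" and "J t = fst (\<zeta> t)" and "w t = snd (\<zeta> t)" for t
  let ?G = "\<lambda>t. chart_metric c (x t)" and ?C = "\<lambda>t. chart_christoffel c (x t)"
  let ?k = "\<lambda>t. w t + ?C t (v t) (J t)"
  let ?R = "\<lambda>t. chart_curvature c (x t) (J t) (v t)"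
  show ?thesis
  proof (rule increasing_within_interval[OF ab])
    fix t assume t: "t \<in> {a..b}"
    let ?d = "\<lambda>a b. fderiv (\<lambda>y. chart_christoffel c y a b) (x t)"
    have xt: "x t \<in> cdom c" using zc[OF t] by (simp add: x_def)
    note bG = chart_metric_bilinear[OF c xt] and bC = chart_christoffel_bilinear[OF c xt]
    have zt: "z t = (x t, v t)" "\<zeta> t = (J t, w t)" by (simp_all add: x_def v_def J_def w_def)
    have dx: "(x has_vector_derivative v t) (at t within {a..b})"
      and dv: "(v has_vector_derivative - ?C t (v t) (v t)) (at t within {a..b})"
      using bounded_linear.has_vector_derivative[OF bounded_linear_fst z[OF t]]
        bounded_linear.has_vector_derivative[OF bounded_linear_snd z[OF t]]
      by (simp_all add: geodesic_field_def x_def[abs_def] v_def[abs_def])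
    have dJ: "(J has_vector_derivative w t) (at t within {a..b})"
      and dw: "(w has_vector_derivative - (?d (v t) (v t) (J t) + ?C t (w t) (v t) + ?C t (v t) (w t))) (at t within {a..b})"
      using bounded_linear.has_vector_derivative[OF bounded_linear_fst \<zeta>[OF t]]
        bounded_linear.has_vector_derivative[OF bounded_linear_snd \<zeta>[OF t]]
      unfolding zt geodesic_field_derivative[OF c xt] by (simp_all add: J_def[abs_def] w_def[abs_def])
    note dk = has_vector_derivative_add[OF dw chart_christoffel_along_curve[OF c xt t dx dv dJ]]
    \<comment> \<open>The derivative terms of the two sides contain the Christoffel symbols with
      exchanged arguments; equality of the symbols on the open chart domain passes to their
      derivatives.\<close>
    have d_sym: "?d (v t) (J t) (v t) = ?d (J t) (v t) (v t)"
      using frechet_derivative_cong_open[OF open_cdom[OF c] xt, of "\<lambda>y. chart_christoffel c y (v t) (J t)"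
          "\<lambda>y. chart_christoffel c y (J t) (v t)"] chart_christoffel_sym[OF c] by simp
    have C: "?C t (v t) (?C t (v t) (J t)) = ?C t (v t) (?C t (J t) (v t))"
      "?C t (?C t (v t) (v t)) (J t) = ?C t (J t) (?C t (v t) (v t))" "?C t (w t) (v t) = ?C t (v t) (w t)"
      using chart_christoffel_sym[OF c xt] by metis+
    have "((\<lambda>s. ?G s (J s) (?k s)) has_vector_derivative
      ?G t (w t + ?C t (v t) (J t)) (?k t) +
      ?G t (J t) ((- (?d (v t) (v t) (J t) + ?C t (w t) (v t) + ?C t (v t) (w t)) +
        (?d (v t) (J t) (v t) + ?C t (- ?C t (v t) (v t)) (J t) + ?C t (v t) (w t))) + ?C t (v t) (?k t)))
      (at t within {a..b})"
      by (rule chart_metric_along_curve[OF c xt t dx dJ dk])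
    \<comment> \<open>This is the Jacobi equation: the covariant derivative of \<open>?k\<close>,
      the coordinate form of \<open>\<nabla>J\<close>, is \<open>- R(J, v) v\<close>. The geodesic
      equation, substituted for the derivative of \<open>v\<close>, supplies the term
      \<open>\<Gamma>(J, \<Gamma>(v, v))\<close> of the curvature.\<close>
    moreover have "(- (?d (v t) (v t) (J t) + ?C t (w t) (v t) + ?C t (v t) (w t)) +
        (?d (v t) (J t) (v t) + ?C t (- ?C t (v t) (v t)) (J t) + ?C t (v t) (w t))) + ?C t (v t) (?k t) = - ?R t"
      unfolding chart_curvature_def d_sym bilinear_lneg[OF bC] bilinear_radd[OF bC] C by simp
    ultimately show "((\<lambda>s. jacobi_slope c (z s) (\<zeta> s)) has_vector_derivative
        ?G t (?k t) (?k t) + ?G t (J t) (- ?R t)) (at t within {a..b})"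
      by (simp add: jacobi_slope_def x_def v_def J_def w_def)
    have "0 \<le> ?G t (?k t) (?k t)"
      using chart_metric_pos[OF c xt, of "?k t"] bilinear_lzero[OF bG] by (cases "?k t = 0") auto
    moreover have "?G t (J t) (?R t) \<le> 0"
      using chart_curvature_nonpos[OF K c xt, of "J t" "v t"] chart_metric_sym[OF c xt] by simp
    ultimately show "0 \<le> ?G t (?k t) (?k t) + ?G t (J t) (- ?R t)"
      by (simp add: bilinear_rneg[OF bG])
  qed
qed

text \<open>The derivative of the squared norm is twice the slope. The slope starts nonnegative and
  cannot fall, an argument applied on each initial interval \<open>{a..t}\<close>.\<close>

lemma jacobi_norm_nondecreasing:
  assumes K: nonpositive_sectional_curvature and c: "c \<in> A" and ab: "a \<le> b"
    and zc: "\<And>t. t \<in> {a..b} \<Longrightarrow> fst (z t) \<in> cdom c"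
    and z: "\<And>t. t \<in> {a..b} \<Longrightarrow> (z has_vector_derivative geodesic_field c (z t)) (at t within {a..b})"
    and \<zeta>: "\<And>t. t \<in> {a..b} \<Longrightarrow>
      (\<zeta> has_vector_derivative fderiv (geodesic_field c) (z t) (\<zeta> t)) (at t within {a..b})"
    and slope: "0 \<le> jacobi_slope c (z a) (\<zeta> a)"
  shows "jacobi_norm c (z a) (\<zeta> a) \<le> jacobi_norm c (z b) (\<zeta> b)"
proof (rule increasing_within_interval[OF ab])
  fix t assume t: "t \<in> {a..b}"
  have sub: "{a..t} \<subseteq> {a..b}" using t by auto
  have "jacobi_slope c (z a) (\<zeta> a) \<le> jacobi_slope c (z t) (\<zeta> t)"
    by (rule jacobi_slope_nondecreasing[OF K c])
      (use t sub in \<open>auto intro!: zc has_vector_derivative_within_subset[OF z sub]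
        has_vector_derivative_within_subset[OF \<zeta> sub]\<close>)
  then show "0 \<le> 2 * jacobi_slope c (z t) (\<zeta> t)" using slope by simp
  let ?x = "\<lambda>t. fst (z t)" and ?J = "\<lambda>t. fst (\<zeta> t)"
  have xt: "?x t \<in> cdom c" by (rule zc[OF t])
  have dx: "(?x has_vector_derivative snd (z t)) (at t within {a..b})"
    using bounded_linear.has_vector_derivative[OF bounded_linear_fst z[OF t]] by (simp add: geodesic_field_def)
  have "fderiv (geodesic_field c) (z t) (\<zeta> t) = fderiv (geodesic_field c) (fst (z t), snd (z t)) (fst (\<zeta> t), snd (\<zeta> t))"
    by simp
  then have dJ: "(?J has_vector_derivative snd (\<zeta> t)) (at t within {a..b})"
    using bounded_linear.has_vector_derivative[OF bounded_linear_fst \<zeta>[OF t]]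
    unfolding geodesic_field_derivative[OF c xt] by simp
  show "((\<lambda>t. jacobi_norm c (z t) (\<zeta> t)) has_vector_derivative 2 * jacobi_slope c (z t) (\<zeta> t)) (at t within {a..b})"
    using chart_metric_along_curve[OF c xt t dx dJ dJ] chart_metric_sym[OF c xt, of "?J t"]
    by (simp add: jacobi_norm_def jacobi_slope_def)
qed

text \<open>The geodesic flow from time \<open>a\<close> to time \<open>b\<close> near a given geodesic, as a map between states in
  two charts, and the monotonicity of Jacobi fields along that geodesic. States are compared only at
  the two times, so that these relations compose.\<close>

definition flow_map :: "(real \<Rightarrow> 'a) \<Rightarrow> (real \<Rightarrow> ('a, 'e) tvec) \<Rightarrow> real \<Rightarrow> ('a, 'e) chart \<Rightarrow> real \<Rightarrow> ('a, 'e) chart \<Rightarrow>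
    ('e \<times> 'e) set \<Rightarrow> ('e \<times> 'e \<Rightarrow> 'e \<times> 'e) \<Rightarrow> bool" where
  "flow_map \<gamma> V a c b c' N H \<longleftrightarrow> open N \<and> (snd c (\<gamma> a), V a c) \<in> N \<and>
     H (snd c (\<gamma> a), V a c) = (snd c' (\<gamma> b), V b c') \<and> Ck_on (Suc 0) H N \<and>
     (\<forall>z\<in>N. \<exists>\<Gamma> W. geodesic_flow_on {a..b} \<Gamma> W \<and> c \<in> charts_at (\<Gamma> a) \<and> (snd c (\<Gamma> a), W a c) = z \<and>
       c' \<in> charts_at (\<Gamma> b) \<and> (snd c' (\<Gamma> b), W b c') = H z) \<and>
     (\<forall>\<zeta>. let z = (snd c (\<gamma> a), V a c); z' = (snd c' (\<gamma> b), V b c'); \<zeta>' = fderiv H z \<zeta> in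
       0 \<le> jacobi_slope c z \<zeta> \<longrightarrow> 0 \<le> jacobi_slope c' z' \<zeta>' \<and> jacobi_norm c z \<zeta> \<le> jacobi_norm c' z' \<zeta>')"

text \<open>Geodesics with equal intermediate states are glued, the chain rule composes the
  derivatives at the states of \<gamma>, and the inequalities chain because the first piece hands on
  a nonnegative slope.\<close>

lemma flow_map_trans:
  assumes 1: "flow_map \<gamma> V a c b c' N H" and 2: "flow_map \<gamma> V b c' d c'' N' H'" and abd: "a \<le> b" "b \<le> d"
  shows "flow_map \<gamma> V a c d c'' (N \<inter> H -` N') (H' \<circ> H)"
proof -
  let ?z = "(snd c (\<gamma> a), V a c)" and ?z' = "(snd c' (\<gamma> b), V b c')" and ?z'' = "(snd c'' (\<gamma> d), V d c'')"
  have N: "open N" "?z \<in> N" "H ?z = ?z'" "Ck_on (Suc 0) H N" and N': "open N'" "?z' \<in> N'" "H' ?z' = ?z''" "Ck_on (Suc 0) H' N'"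
    using 1 2 unfolding flow_map_def by blast+
  have o: "open (N \<inter> H -` N')"
    using continuous_open_preimage[OF Ck_on_continuous[OF N(4)] N(1) N'(1)] .
  have C1: "Ck_on (Suc 0) (H' \<circ> H) (N \<inter> H -` N')"
    unfolding comp_def
    by (rule Ck_on_compose[OF o N'(1) _ N'(4) Ck_on_subset[OF N(4)]]) auto
  have D: "fderiv (H' \<circ> H) ?z \<zeta> = fderiv H' ?z' (fderiv H ?z \<zeta>)" for \<zeta>
    using frechet_derivative_at[OF diff_chain_at[OF Ck_on_has_derivative[OF N(4,2)], of H' "fderiv H' ?z'"]]
      Ck_on_has_derivative[OF N'(4,2)] N(3) by (metis comp_apply)
  have curve: "\<exists>\<Gamma> W. geodesic_flow_on {a..d} \<Gamma> W \<and> c \<in> charts_at (\<Gamma> a) \<and> (snd c (\<Gamma> a), W a c) = z \<and>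
       c'' \<in> charts_at (\<Gamma> d) \<and> (snd c'' (\<Gamma> d), W d c'') = (H' \<circ> H) z" if z: "z \<in> N \<inter> H -` N'" for z
  proof -
    obtain \<Gamma> W where g: "geodesic_flow_on {a..b} \<Gamma> W" "c \<in> charts_at (\<Gamma> a)" "(snd c (\<Gamma> a), W a c) = z"
      "c' \<in> charts_at (\<Gamma> b)" "(snd c' (\<Gamma> b), W b c') = H z"
      using 1 z unfolding flow_map_def by blast
    obtain \<Gamma>' W' where g': "geodesic_flow_on {b..d} \<Gamma>' W'" "c' \<in> charts_at (\<Gamma>' b)" "(snd c' (\<Gamma>' b), W' b c') = H z"
      "c'' \<in> charts_at (\<Gamma>' d)" "(snd c'' (\<Gamma>' d), W' d c'') = H' (H z)"
      using 2 z unfolding flow_map_def by blast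
    \<comment> \<open>Equality of coordinates at time \<open>b\<close> is lifted to equality of
      points and of tangent vectors, which gluing asks for.\<close>
    have e: "snd c' (\<Gamma> b) = snd c' (\<Gamma>' b)" "W b c' = W' b c'"
      using trans[OF g(5) g'(3)[symmetric]] by simp_all
    have eq: "\<Gamma> b = \<Gamma>' b"
      using cinv_chart[OF g(4)] cinv_chart[OF g'(2)] e(1) by metis
    have "W b = W' b"
    proof (rule tangent_eqI[where v = "W b" and w = "W' b" and c = c', OF _ _ g(4) e(2)])
      show "W b \<in> tangent_space (\<Gamma> b)" using geodesic_flow_onD(2)[OF g(1)] abd by simp
      show "W' b \<in> tangent_space (\<Gamma> b)" using geodesic_flow_onD(2)[OF g'(1)] abd eq by simp
    qed
    note glue = geodesic_flow_glue[OF g(1) g'(1) abd eq this]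
    let ?\<Gamma> = "\<lambda>t. if t \<le> b then \<Gamma> t else \<Gamma>' t" and ?W = "\<lambda>t. if t \<le> b then W t else W' t"
    have "?\<Gamma> a = \<Gamma> a" "?W a = W a" using abd by auto
    moreover have "?\<Gamma> d = \<Gamma>' d" "?W d = W' d" using abd eq \<open>W b = W' b\<close> by (auto simp: le_less)
    ultimately show ?thesis using glue g g' by (intro exI[of _ ?\<Gamma>] exI[of _ ?W]) simp
  qed
  have J1: "0 \<le> jacobi_slope c' ?z' (fderiv H ?z \<zeta>) \<and>
      jacobi_norm c ?z \<zeta> \<le> jacobi_norm c' ?z' (fderiv H ?z \<zeta>)" if "0 \<le> jacobi_slope c ?z \<zeta>" for \<zeta>
    using 1 that unfolding flow_map_def Let_def by blast
  have J2: "0 \<le> jacobi_slope c'' ?z'' (fderiv H' ?z' \<zeta>) \<and>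
      jacobi_norm c' ?z' \<zeta> \<le> jacobi_norm c'' ?z'' (fderiv H' ?z' \<zeta>)" if "0 \<le> jacobi_slope c' ?z' \<zeta>" for \<zeta>
    using 2 that unfolding flow_map_def Let_def by blast
  have J: "0 \<le> jacobi_slope c'' ?z'' (fderiv H' ?z' (fderiv H ?z \<zeta>)) \<and>
      jacobi_norm c ?z \<zeta> \<le> jacobi_norm c'' ?z'' (fderiv H' ?z' (fderiv H ?z \<zeta>))"
    if "0 \<le> jacobi_slope c ?z \<zeta>" for \<zeta>
    using J1[OF that] J2[of "fderiv H ?z \<zeta>"] by (meson order_trans)
  show ?thesis
    unfolding flow_map_def Let_def D
    by (intro conjI allI impI ballI o C1 curve) (use N N' J in simp_all)
qed

text \<open>A change of charts is treated as a flow of duration 0. Slope and norm are preserved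
  exactly, since the second component of a variation, with its Christoffel correction, transforms as
  a tangent vector.\<close>

lemma flow_map_transition:
  assumes V: "V a \<in> tangent_space (\<gamma> a)" and c: "c \<in> charts_at (\<gamma> a)" "c' \<in> charts_at (\<gamma> a)"
  shows "flow_map \<gamma> V a c a c' (transition_dom c c' \<times> UNIV) (tangent_map c c')"
proof -
  let ?x = "snd c (\<gamma> a)" and ?v = "V a c" and ?z = "(snd c (\<gamma> a), V a c)" and ?z' = "(snd c' (\<gamma> a), V a c')"
  let ?T = "fderiv (transition c c') ?x"
  note cA = charts_atD(1)[OF c(1)] charts_atD(1)[OF c(2)]
  have x: "?x \<in> transition_dom c c'" by (rule transition_domI[OF c])
  have tz: "tangent_map c c' ?z = ?z'"
    using tangent_transition[OF V c] transition_chart[OF c(1), of c'] by (simp add: tangent_map_def)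
  have curve: "\<exists>\<Gamma> W. geodesic_flow_on {a..a} \<Gamma> W \<and> c \<in> charts_at (\<Gamma> a) \<and> (snd c (\<Gamma> a), W a c) = z \<and>
       c' \<in> charts_at (\<Gamma> a) \<and> (snd c' (\<Gamma> a), W a c') = tangent_map c c' z" if z: "z \<in> transition_dom c c' \<times> UNIV" for z
  proof -
    let ?p = "cinv c (fst z)"
    note d = transition_domE[OF cA, of "fst z"]
    have z': "fst z \<in> transition_dom c c'" using z by auto
    have "geodesic_flow_on {a..a} (\<lambda>t. cinv c (fst z)) (\<lambda>t. coord_vec c ?p (snd z))"
    proof (rule geodesic_flow_in_chart[OF cA(1), where z = "\<lambda>t. z"])
      show "fst z \<in> cdom c" using z' transition_dom_subset by blast
      show "((\<lambda>t. z) has_vector_derivative geodesic_field c z) (at t within {a..a})" if "t \<in> {a..a}" for t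
      proof -
        \<comment> \<open>On a one-point interval the derivative conditions hold trivially, so a
          constant curve with an arbitrary velocity qualifies.\<close>
        have "at t within {a..a} = bot" using that by (simp add: at_within_eq_bot_iff)
        then show ?thesis by (simp add: has_vector_derivative_def has_derivative_def bounded_linear_scaleR_left)
      qed
    qed
    moreover have "(snd c ?p, coord_vec c ?p (snd z) c) = z"
      using d[OF z'] by (simp add: coord_vec_self)
    moreover have "(snd c' ?p, coord_vec c ?p (snd z) c') = tangent_map c c' z"
      using d[OF z'] by (simp add: coord_vec_transition tangent_map_def transition_eq)
    ultimately show ?thesis using d[OF z'] by blast
  qed
  have J: "jacobi_slope c' ?z' (fderiv (tangent_map c c') ?z \<zeta>) = jacobi_slope c ?z \<zeta>"
    "jacobi_norm c' ?z' (fderiv (tangent_map c c') ?z \<zeta>) = jacobi_norm c ?z \<zeta>" for \<zeta>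
  proof -
    obtain u w where \<zeta>: "\<zeta> = (u, w)" by (cases \<zeta>)
    have V': "V a c' = ?T ?v" "snd c' (\<gamma> a) = transition c c' ?x"
      using tangent_transition[OF V c] transition_chart[OF c(1), of c'] by auto
    \<comment> \<open>The Hessian term of the variation meets the opposite one from the Christoffel
      symbols; they cancel by symmetry of second derivatives.\<close>
    have "transition_deriv2 c c' ?x u ?v + ?T w + chart_christoffel c' (transition c c' ?x) (?T ?v) (?T u) =
        ?T (w + chart_christoffel c ?x ?v u)"
      unfolding chart_christoffel_transition[OF cA x] linear_add[OF transition_deriv_linear[OF cA x]]
      using transition_deriv2_sym[OF cA x, of u ?v] by simp
    then show "jacobi_slope c' ?z' (fderiv (tangent_map c c') ?z \<zeta>) = jacobi_slope c ?z \<zeta>"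
      by (simp add: jacobi_slope_def \<zeta> tangent_map_derivative[OF cA x] V' chart_metric_transition[OF cA x])
    show "jacobi_norm c' ?z' (fderiv (tangent_map c c') ?z \<zeta>) = jacobi_norm c ?z \<zeta>"
      by (simp add: jacobi_norm_def \<zeta> tangent_map_derivative[OF cA x] V' chart_metric_transition[OF cA x])
  qed
  show ?thesis
    unfolding flow_map_def Let_def J
    using curve tz x tangent_map_Ck[OF cA] open_transition_dom[OF cA]
    by (auto intro: open_Times simp del: Ck_on.simps)
qed

text \<open>\<open>local_flow\<close> around the state at time \<open>x\<close> gives one ball and
  one time span for all short intervals that contain \<open>x\<close>. Uniqueness identifies the
  flow from the state at \<open>a\<close> with \<gamma>, and the derivative of the flow solves the
  linearized equation, so the monotonicity of Jacobi fields applies.\<close>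

lemma flow_map_local:
  assumes K: nonpositive_sectional_curvature
    and g: "geodesic_flow_on {p..q} \<gamma> V" and x: "x \<in> {p..q}" and c: "c \<in> charts_at (\<gamma> x)"
  shows "\<exists>d>0. \<forall>a b. p \<le> a \<and> a \<le> x \<and> x \<le> b \<and> b \<le> q \<and> b - a < d \<longrightarrow>
    c \<in> charts_at (\<gamma> a) \<and> c \<in> charts_at (\<gamma> b) \<and> (\<exists>N H. flow_map \<gamma> V a c b c N H)"
proof -
  note cA = charts_atD(1)[OF c]
  let ?z = "\<lambda>t. (snd c (\<gamma> t), V t c)"
  have S: "open (cdom c \<times> (UNIV :: 'e set))" "?z x \<in> cdom c \<times> UNIV"
    using open_cdom[OF cA] chart_in_cdom[OF c] by (auto intro: open_Times)
  obtain T r \<Phi> where T: "T > 0" and r: "r > 0" "ball (?z x) r \<subseteq> cdom c \<times> UNIV"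
    and \<Phi>: "\<And>z. z \<in> ball (?z x) r \<Longrightarrow> \<Phi> z 0 = z"
      "\<And>z t. z \<in> ball (?z x) r \<Longrightarrow> t \<in> {0..T} \<Longrightarrow> \<Phi> z t \<in> cdom c \<times> UNIV"
      "\<And>z t. z \<in> ball (?z x) r \<Longrightarrow> t \<in> {0..T} \<Longrightarrow> (\<Phi> z has_vector_derivative geodesic_field c (\<Phi> z t)) (at t within {0..T})"
      "\<And>t. t \<in> {0..T} \<Longrightarrow> Ck_on (Suc 0) (\<lambda>z. \<Phi> z t) (ball (?z x) r)"
      "\<And>z \<zeta>. z \<in> ball (?z x) r \<Longrightarrow> fderiv (\<lambda>z. \<Phi> z 0) z \<zeta> = \<zeta>"
      "\<And>z \<zeta> t. z \<in> ball (?z x) r \<Longrightarrow> t \<in> {0..T} \<Longrightarrow>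
        ((\<lambda>t. fderiv (\<lambda>z. \<Phi> z t) z \<zeta>) has_vector_derivative
         fderiv (geodesic_field c) (\<Phi> z t) (fderiv (\<lambda>z. \<Phi> z t) z \<zeta>)) (at t within {0..T})"
    by (rule local_flow[OF S geodesic_field_C1[OF cA]]) blast
  have "(?z \<longlongrightarrow> ?z x) (at x within {p..q})"
    using has_vector_derivative_continuous[OF geodesic_flow_state[OF g x c]] by (simp add: continuous_within)
  from topological_tendstoD[OF this open_ball[of "?z x" r]]
  have "\<forall>\<^sub>F s in at x within {p..q}. ?z s \<in> ball (?z x) r" using r(1) by simp
  then have "\<forall>\<^sub>F s in at x within {p..q}. ?z s \<in> ball (?z x) r \<and> c \<in> charts_at (\<gamma> s)"
    using eventually_charts_at[OF geodesic_flow_onD(1)[OF g] x c] by (rule eventually_conj)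
  moreover have "?z x \<in> ball (?z x) r \<and> c \<in> charts_at (\<gamma> x)" using r(1) c by simp
  ultimately obtain d where d: "d > 0"
    "\<And>s. s \<in> {p..q} \<Longrightarrow> \<bar>s - x\<bar> < d \<Longrightarrow> ?z s \<in> ball (?z x) r \<and> c \<in> charts_at (\<gamma> s)"
    using eventually_at_within_dist by blast
  \<comment> \<open>The bound \<open>d\<close> keeps both end points in the chart and the ball, and
    \<open>T\<close> keeps the flow defined up to time \<open>b - a\<close>.\<close>
  have main: "c \<in> charts_at (\<gamma> a) \<and> c \<in> charts_at (\<gamma> b) \<and> flow_map \<gamma> V a c b c (ball (?z x) r) (\<lambda>z. \<Phi> z (b - a))"
    if ab: "p \<le> a" "a \<le> x" "x \<le> b" "b \<le> q" "b - a < min d T" for a b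
  proof -
    have za: "?z a \<in> ball (?z x) r" "c \<in> charts_at (\<gamma> a)" "c \<in> charts_at (\<gamma> b)"
      using d(2)[of a] d(2)[of b] ab by auto
    have ba: "b - a \<in> {0..T}" "a \<le> b" "{0..b - a} \<subseteq> {0..T}" using ab by auto
    let ?\<Gamma> = "\<lambda>z t. cinv c (fst (\<Phi> z (t + - a)))"
    let ?W = "\<lambda>z t. coord_vec c (?\<Gamma> z t) (snd (\<Phi> z (t + - a)))"
    have flow: "geodesic_flow_on {a..b} (?\<Gamma> z) (?W z)" if z: "z \<in> ball (?z x) r" for z
    proof (rule geodesic_flow_in_chart[OF cA])
      fix t assume "t \<in> {a..b}"
      then have t: "t + - a \<in> {0..T}" using ba by auto
      show "fst (\<Phi> z (t + - a)) \<in> cdom c" using \<Phi>(2)[OF z t] by auto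
      show "((\<lambda>t. \<Phi> z (t + - a)) has_vector_derivative geodesic_field c (\<Phi> z (t + - a))) (at t within {a..b})"
        by (rule has_vector_derivative_shift[OF \<Phi>(3)[OF z t]]) (use ba in auto)
    qed
    have state: "c \<in> charts_at (?\<Gamma> z t)" "(snd c (?\<Gamma> z t), ?W z t c) = \<Phi> z (t - a)"
      if z: "z \<in> ball (?z x) r" and t: "t \<in> {a..b}" for z t
    proof -
      have "t - a \<in> {0..T}" using t ba by auto
      then have f: "fst (\<Phi> z (t - a)) \<in> cdom c" using \<Phi>(2)[OF z] by (auto simp: mem_Times_iff)
      then show "c \<in> charts_at (?\<Gamma> z t)" using cinv_charts_at[OF cA f] by simp
      then show "(snd c (?\<Gamma> z t), ?W z t c) = \<Phi> z (t - a)"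
        using chart_cinv[OF f] by (simp add: coord_vec_self)
    qed
    have a_in: "a \<in> {a..b}" "b \<in> {a..b}" using ba by auto
    have curve: "\<exists>\<Gamma> W. geodesic_flow_on {a..b} \<Gamma> W \<and> c \<in> charts_at (\<Gamma> a) \<and> (snd c (\<Gamma> a), W a c) = z \<and>
       c \<in> charts_at (\<Gamma> b) \<and> (snd c (\<Gamma> b), W b c) = \<Phi> z (b - a)" if z: "z \<in> ball (?z x) r" for z
      using flow[OF z] state[OF z a_in(1)] state[OF z a_in(2)] \<Phi>(1)[OF z]
      by (intro exI[of _ "?\<Gamma> z"] exI[of _ "?W z"]) simp
    have H: "\<Phi> (?z a) (b - a) = ?z b"
    proof -
      have a1: "?\<Gamma> (?z a) a = \<gamma> a" using \<Phi>(1)[OF za(1)] by (simp add: cinv_chart[OF za(2)])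
      have a2: "?W (?z a) a = V a"
        unfolding a1 using \<Phi>(1)[OF za(1)] coord_vec_inverse[OF za(2) geodesic_flow_onD(2)[OF g]] ab by simp
      have e: "?\<Gamma> (?z a) b = \<gamma> b \<and> ?W (?z a) b = V b"
        by (rule geodesic_flow_unique[OF flow[OF za(1)] geodesic_flow_on_subset[OF g] ba(2) a1 a2]) (use ab in auto)
      show ?thesis
        unfolding state(2)[OF za(1) a_in(2), symmetric]
        by (rule arg_cong2[where f = "\<lambda>p v. (snd c p, v c)", OF conjunct1[OF e] conjunct2[OF e]])
    qed
    have Jac: "0 \<le> jacobi_slope c (?z b) (fderiv (\<lambda>z. \<Phi> z (b - a)) (?z a) \<zeta>) \<and>
        jacobi_norm c (?z a) \<zeta> \<le> jacobi_norm c (?z b) (fderiv (\<lambda>z. \<Phi> z (b - a)) (?z a) \<zeta>)"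
      if J: "0 \<le> jacobi_slope c (?z a) \<zeta>" for \<zeta>
    proof -
      let ?\<zeta> = "\<lambda>t. fderiv (\<lambda>z. \<Phi> z t) (?z a) \<zeta>"
      have 1: "fst (\<Phi> (?z a) t) \<in> cdom c"
        "(\<Phi> (?z a) has_vector_derivative geodesic_field c (\<Phi> (?z a) t)) (at t within {0..b - a})"
        "(?\<zeta> has_vector_derivative fderiv (geodesic_field c) (\<Phi> (?z a) t) (?\<zeta> t)) (at t within {0..b - a})"
        if "t \<in> {0..b - a}" for t
      proof -
        have t: "t \<in> {0..T}" using that ba(3) by blast
        show "fst (\<Phi> (?z a) t) \<in> cdom c" using \<Phi>(2)[OF za(1) t] by auto
        show "(\<Phi> (?z a) has_vector_derivative geodesic_field c (\<Phi> (?z a) t)) (at t within {0..b - a})"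
          by (rule has_vector_derivative_within_subset[OF \<Phi>(3)[OF za(1) t] ba(3)])
        show "(?\<zeta> has_vector_derivative fderiv (geodesic_field c) (\<Phi> (?z a) t) (?\<zeta> t)) (at t within {0..b - a})"
          by (rule has_vector_derivative_within_subset[OF \<Phi>(6)[OF za(1) t] ba(3)])
      qed
      have 0: "0 \<le> b - a" using ba by simp
      have s0: "jacobi_slope c (\<Phi> (?z a) 0) (?\<zeta> 0) = jacobi_slope c (?z a) \<zeta>"
        "jacobi_norm c (\<Phi> (?z a) 0) (?\<zeta> 0) = jacobi_norm c (?z a) \<zeta>"
        using \<Phi>(1)[OF za(1)] \<Phi>(5)[OF za(1), of \<zeta>] by simp_all
      have "jacobi_slope c (\<Phi> (?z a) 0) (?\<zeta> 0) \<le> jacobi_slope c (\<Phi> (?z a) (b - a)) (?\<zeta> (b - a))"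
        by (rule jacobi_slope_nondecreasing[OF K cA 0 1])
      moreover have "jacobi_norm c (\<Phi> (?z a) 0) (?\<zeta> 0) \<le> jacobi_norm c (\<Phi> (?z a) (b - a)) (?\<zeta> (b - a))"
        by (rule jacobi_norm_nondecreasing[OF K cA 0 1]) (use J s0 in simp_all)
      ultimately show ?thesis using J unfolding s0 H by simp
    qed
    show ?thesis
      unfolding flow_map_def Let_def
      using za H \<Phi>(4)[OF ba(1)] curve Jac open_ball by blast
  qed
  show ?thesis
  proof (intro exI[of _ "min d T"] conjI allI impI)
    show "min d T > 0" using d(1) T by simp
    fix a b assume "p \<le> a \<and> a \<le> x \<and> x \<le> b \<and> b \<le> q \<and> b - a < min d T"
    then show "c \<in> charts_at (\<gamma> a)" "c \<in> charts_at (\<gamma> b)" "\<exists>N H. flow_map \<gamma> V a c b c N H"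
      using main[of a b] by blast+
  qed
qed

text \<open>Bisection of time. The property quantifies over all charts at both ends, so two halves
  may be joined in any chart at the middle; near a time \<open>x\<close> the flow is taken in one
  chart \<open>e\<close>, with a change of charts on either side.\<close>

lemma flow_map_exists:
  assumes K: nonpositive_sectional_curvature
    and g: "geodesic_flow_on {p..q} \<gamma> V" and pq: "p \<le> q" and c: "c \<in> charts_at (\<gamma> p)" "c' \<in> charts_at (\<gamma> q)"
  shows "\<exists>N H. flow_map \<gamma> V p c q c' N H"
proof -
  define P where "P a b \<longleftrightarrow> (p \<le> a \<and> a \<le> b \<and> b \<le> q \<longrightarrow>
    (\<forall>c\<in>charts_at (\<gamma> a). \<forall>c'\<in>charts_at (\<gamma> b). \<exists>N H. flow_map \<gamma> V a c b c' N H))" for a b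
  have "P p q"
  proof (rule Bolzano[OF pq])
    fix a b d assume ab: "P a b" "P b d" "a \<le> b" "b \<le> d"
    show "P a d"
      unfolding P_def
    proof (intro impI ballI)
      fix c c'' assume "p \<le> a \<and> a \<le> d \<and> d \<le> q" and c: "c \<in> charts_at (\<gamma> a)" "c'' \<in> charts_at (\<gamma> d)"
      then have o: "p \<le> a \<and> a \<le> b \<and> b \<le> q" "p \<le> b \<and> b \<le> d \<and> d \<le> q" using ab by auto
      obtain c' where c': "c' \<in> charts_at (\<gamma> b)" by (rule charts_at_nonempty)
      obtain N H N' H' where "flow_map \<gamma> V a c b c' N H" "flow_map \<gamma> V b c' d c'' N' H'"
        using ab(1,2) o c c' unfolding P_def by blast
      from flow_map_trans[OF this ab(3,4)] show "\<exists>N H. flow_map \<gamma> V a c d c'' N H" by blast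
    qed
  next
    fix x assume "p \<le> x" "x \<le> q"
    then have x: "x \<in> {p..q}" by simp
    obtain e where e: "e \<in> charts_at (\<gamma> x)" by (rule charts_at_nonempty)
    obtain d where d: "d > 0" "\<And>a b. p \<le> a \<and> a \<le> x \<and> x \<le> b \<and> b \<le> q \<and> b - a < d \<Longrightarrow>
      e \<in> charts_at (\<gamma> a) \<and> e \<in> charts_at (\<gamma> b) \<and> (\<exists>N H. flow_map \<gamma> V a e b e N H)"
      using flow_map_local[OF K g x e] by blast
    have "P a b" if ab: "a \<le> x \<and> x \<le> b \<and> b - a < d" for a b
      unfolding P_def
    proof (intro impI ballI)
      fix c c' assume o: "p \<le> a \<and> a \<le> b \<and> b \<le> q" and c: "c \<in> charts_at (\<gamma> a)" "c' \<in> charts_at (\<gamma> b)"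
      obtain N H where f: "e \<in> charts_at (\<gamma> a)" "e \<in> charts_at (\<gamma> b)" "flow_map \<gamma> V a e b e N H"
        using d(2)[of a b] ab o by blast
      have V: "V a \<in> tangent_space (\<gamma> a)" "V b \<in> tangent_space (\<gamma> b)"
        using o by (auto intro!: geodesic_flow_onD(2)[OF g])
      from flow_map_trans[OF flow_map_trans[OF flow_map_transition[where \<gamma> = \<gamma> and V = V, OF V(1) c(1) f(1)] f(3)]
          flow_map_transition[where \<gamma> = \<gamma> and V = V, OF V(2) f(2) c(2)]] o
      show "\<exists>N H. flow_map \<gamma> V a c b c' N H" by blast
    qed
    then show "\<exists>d>0. \<forall>a b. a \<le> x \<and> x \<le> b \<and> b - a < d \<longrightarrow> P a b" using d(1) by blast
  qed
  then show ?thesis using c pq unfolding P_def by blast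
qed

end

section \<open>The endpoint map of a GIE step\<close>

context smooth_manifold
begin

text \<open>Continuity makes the times spent in the chart relatively open in \<open>I\<close>. The
  restricted filter is the one in which \<open>C1_curve_on\<close> states continuity of the
  derivative.\<close>

lemma at_within_chart:
  assumes "continuous_on I \<gamma>" "c \<in> A" "\<gamma> t \<in> fst c" "t \<in> I"
  shows "at t within {s \<in> I. \<gamma> s \<in> fst c} = at t within I"
proof -
  obtain O' where O': "open O'" "O' \<inter> I = \<gamma> -` fst c \<inter> I"
    using assms(1) open_chart_dom[OF assms(2)] unfolding continuous_on_open_invariant by blast
  then show ?thesis
    using assms by (intro at_within_nhd[of t O']) auto
qed

end

context riemannian_manifold
begin

text \<open>Uniqueness of geodesics with given initial velocity makes the definite description in
  \<open>riem_exp\<close> proper, so its value is the end point of any geodesic flow with these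
  initial data.\<close>

lemma riem_exp_geodesic_flow:
  assumes g: "geodesic_flow_on {0..1} \<Gamma> W"
  shows "W 0 \<in> exp_dom (\<Gamma> 0)" "riem_exp (\<Gamma> 0) (W 0) = \<Gamma> 1"
proof -
  have geo: "geodesic_on {0..1} \<Gamma>" "velocity {0..1} \<Gamma> 0 = W 0"
    using geodesic_flow_imp_geodesic[OF g] geodesic_flow_velocity[OF g] by auto
  then show "W 0 \<in> exp_dom (\<Gamma> 0)"
    using geodesic_flow_onD(2)[OF g, of 0] by (auto simp: exp_dom_def)
  show "riem_exp (\<Gamma> 0) (W 0) = \<Gamma> 1"
    unfolding riem_exp_def
  proof (rule the_equality)
    show "\<exists>\<gamma>. geodesic_on {0..1} \<gamma> \<and> \<gamma> 0 = \<Gamma> 0 \<and> velocity {0..1} \<gamma> 0 = W 0 \<and> \<gamma> 1 = \<Gamma> 1"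
      using geo by blast
    fix q assume "\<exists>\<gamma>. geodesic_on {0..1} \<gamma> \<and> \<gamma> 0 = \<Gamma> 0 \<and> velocity {0..1} \<gamma> 0 = W 0 \<and> \<gamma> 1 = q"
    then obtain \<gamma> where \<gamma>: "geodesic_on {0..1} \<gamma>" "\<gamma> 0 = \<Gamma> 0" "velocity {0..1} \<gamma> 0 = W 0" "\<gamma> 1 = q"
      by blast
    have "geodesic_flow_on {0..1} \<gamma> (velocity {0..1} \<gamma>)"
      by (rule geodesic_imp_geodesic_flow[OF \<gamma>(1)]) simp
    from geodesic_flow_unique[OF this g _ \<gamma>(2,3)] \<gamma>(4) show "q = \<Gamma> 1" by simp
  qed
qed

lemma exp_domE:
  assumes "v \<in> exp_dom p"
  obtains \<gamma> V where "geodesic_flow_on {0..1} \<gamma> V" "\<gamma> 0 = p" "V 0 = v" "\<gamma> 1 = riem_exp p v"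
proof -
  obtain \<gamma> where \<gamma>: "geodesic_on {0..1} \<gamma>" "\<gamma> 0 = p" "velocity {0..1} \<gamma> 0 = v"
    using assms by (auto simp: exp_dom_def)
  have g: "geodesic_flow_on {0..1} \<gamma> (velocity {0..1} \<gamma>)"
    by (rule geodesic_imp_geodesic_flow[OF \<gamma>(1)]) simp
  show thesis
    by (rule that[OF g \<gamma>(2,3)]) (use riem_exp_geodesic_flow(2)[OF g] \<gamma> in simp)
qed

section \<open>Speed and length of curves of class C^1\<close>

lemma tnorm_in_chart:
  "c \<in> charts_at p \<Longrightarrow> v \<in> tangent_space p \<Longrightarrow> tnorm p v = sqrt (chart_metric c (snd c p) (v c) (v c))"
  by (simp add: tnorm_def metric_in_chart)

lemma chart_metric_tendsto:
  assumes c: "c \<in> A" "x0 \<in> cdom c" and lim: "(x \<longlongrightarrow> x0) F" "(a \<longlongrightarrow> a0) F" "(b \<longlongrightarrow> b0) F"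
  shows "((\<lambda>s. chart_metric c (x s) (a s) (b s)) \<longlongrightarrow> chart_metric c x0 a0 b0) F"
proof -
  let ?S = "cdom c \<times> (UNIV :: ('e \<times> 'e) set)"
  let ?f = "\<lambda>z. chart_metric c (fst z) (fst (snd z)) (snd (snd z))"
  have S: "open ?S" using open_cdom[OF c(1)] by (auto intro: open_Times)
  have "Ck_on 0 ?f ?S"
    by (rule Ck_on_bilinear_family[OF open_cdom[OF c(1)] chart_metric_bilinear[OF c(1)] chart_metric_Ck[OF c(1)] S])
      (auto intro!: continuous_intros)
  then have "isCont ?f (x0, a0, b0)"
    using S c by (simp add: continuous_on_eq_continuous_at)
  moreover have "((\<lambda>s. (x s, a s, b s)) \<longlongrightarrow> (x0, a0, b0)) F" using lim by (intro tendsto_Pair)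
  ultimately show ?thesis using isCont_tendsto_compose[of "(x0, a0, b0)" ?f] by fastforce
qed

lemma C1_curve_velocity_tendsto:
  assumes \<gamma>: "C1_curve_on I \<gamma>" and t: "t \<in> I" and c: "c \<in> charts_at (\<gamma> t)"
  shows "((\<lambda>s. velocity I \<gamma> s c) \<longlongrightarrow> velocity I \<gamma> t c) (at t within I)"
proof -
  let ?J = "{s \<in> I. \<gamma> s \<in> fst c}" and ?d = "\<lambda>s. vector_derivative (snd c \<circ> \<gamma>) (at s within I)"
  have cont: "continuous_on I \<gamma>" and d: "continuous_on ?J ?d"
    using \<gamma> charts_atD(1)[OF c] by (auto simp: C1_curve_on_def)
  have "(?d \<longlongrightarrow> ?d t) (at t within ?J)"
    using d t charts_atD(2)[OF c] by (auto simp: continuous_on_def)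
  then have "(?d \<longlongrightarrow> ?d t) (at t within I)"
    using at_within_chart[OF cont charts_atD[OF c] t] by simp
  moreover have "\<forall>\<^sub>F s in at t within I. ?d s = velocity I \<gamma> s c"
    using eventually_charts_at[OF cont t c] by eventually_elim (simp add: velocity_def)
  moreover have "?d t = velocity I \<gamma> t c" using c by (simp add: velocity_def)
  ultimately show ?thesis using tendsto_cong[of ?d "\<lambda>s. velocity I \<gamma> s c"] by simp
qed

lemma C1_curve_chart_tendsto:
  assumes "continuous_on I \<gamma>" "t \<in> I" "c \<in> charts_at (\<gamma> t)"
  shows "((\<lambda>s. snd c (\<gamma> s)) \<longlongrightarrow> snd c (\<gamma> t)) (at t within I)"
proof -
  have "isCont (snd c) (\<gamma> t)"
    using chart_continuous open_chart_dom charts_atD[OF assms(3)] by (simp add: continuous_on_eq_continuous_at)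
  moreover have "(\<gamma> \<longlongrightarrow> \<gamma> t) (at t within I)" using assms by (simp add: continuous_on_def)
  ultimately show ?thesis by (rule isCont_tendsto_compose)
qed

text \<open>Near each time the speed is a continuous expression in coordinates. This supplies the
  integrability on which the comparison of lengths through speeds relies.\<close>

lemma C1_curve_speed_continuous:
  assumes \<gamma>: "C1_curve_on {a..b} \<gamma>" and ab: "a < b"
  shows "continuous_on {a..b} (\<lambda>t. tnorm (\<gamma> t) (velocity {a..b} \<gamma> t))"
  unfolding continuous_on_def
proof
  let ?I = "{a..b}" and ?V = "velocity {a..b} \<gamma>"
  fix t assume t: "t \<in> ?I"
  obtain c where c: "c \<in> charts_at (\<gamma> t)" by (rule charts_at_nonempty)
  have cont: "continuous_on ?I \<gamma>" using \<gamma> by (simp add: C1_curve_on_def)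
  have tn: "tnorm (\<gamma> s) (?V s) = sqrt (chart_metric c (snd c (\<gamma> s)) (?V s c) (?V s c))"
    if "s \<in> ?I" "c \<in> charts_at (\<gamma> s)" for s
    by (rule tnorm_in_chart[OF that(2) C1_curve_velocity_tangent[OF \<gamma> ab that(1)]])
  have "((\<lambda>s. sqrt (chart_metric c (snd c (\<gamma> s)) (?V s c) (?V s c))) \<longlongrightarrow>
      sqrt (chart_metric c (snd c (\<gamma> t)) (?V t c) (?V t c))) (at t within ?I)"
    by (intro tendsto_real_sqrt chart_metric_tendsto charts_atD(1)[OF c] chart_in_cdom[OF c]
        C1_curve_chart_tendsto[OF cont t c] C1_curve_velocity_tendsto[OF \<gamma> t c])
  moreover have "\<forall>\<^sub>F s in at t within ?I. c \<in> charts_at (\<gamma> s) \<and> s \<in> ?I"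
    using eventually_charts_at[OF cont t c] by (rule eventually_conj) (simp add: eventually_at_filter)
  then have "\<forall>\<^sub>F s in at t within ?I. sqrt (chart_metric c (snd c (\<gamma> s)) (?V s c) (?V s c)) = tnorm (\<gamma> s) (?V s)"
    by eventually_elim (simp only: tn)
  ultimately show "((\<lambda>t. tnorm (\<gamma> t) (?V t)) \<longlongrightarrow> tnorm (\<gamma> t) (?V t)) (at t within ?I)"
    using tn[OF t c] tendsto_cong by fastforce
qed

lemma C1_curve_on_subinterval:
  assumes \<gamma>: "C1_curve_on {a..b} \<gamma>" and st: "a \<le> s" "s < t" "t \<le> b"
  shows "C1_curve_on {s..t} \<gamma>"
  unfolding C1_curve_on_def
proof (intro conjI ballI impI)
  have sub: "{s..t} \<subseteq> {a..b}" using st by auto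
  have "continuous_on {a..b} \<gamma>" using \<gamma> by (simp add: C1_curve_on_def)
  then show "continuous_on {s..t} \<gamma>" using sub by (rule continuous_on_subset)
  fix c assume c: "c \<in> A"
  let ?V = "\<lambda>r. velocity {a..b} \<gamma> r c"
  have d: "((snd c \<circ> \<gamma>) has_vector_derivative ?V r) (at r within {s..t})" if r: "r \<in> {s..t}" "\<gamma> r \<in> fst c" for r
    using has_vector_derivative_within_subset[OF C1_curve_velocity_derivative[OF \<gamma> _ charts_atI[OF c r(2)]] sub] r(1) sub
    by (auto simp: comp_def)
  show "(snd c \<circ> \<gamma>) differentiable (at r within {s..t})" if "r \<in> {s..t}" "\<gamma> r \<in> fst c" for r
    using d[OF that] by (auto simp: has_vector_derivative_def differentiable_def)
  let ?J = "{r \<in> {s..t}. \<gamma> r \<in> fst c}"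
  have "(?V \<longlongrightarrow> ?V r) (at r within ?J)" if r: "r \<in> ?J" for r
  proof (rule tendsto_within_subset)
    show "(?V \<longlongrightarrow> ?V r) (at r within {a..b})"
      by (rule C1_curve_velocity_tendsto[OF \<gamma> _ charts_atI[OF c]]) (use r sub in auto)
    show "?J \<subseteq> {a..b}" using sub by auto
  qed
  then have "continuous_on ?J ?V" by (simp add: continuous_on_def)
  moreover have "?V r = vector_derivative (snd c \<circ> \<gamma>) (at r within {s..t})" if "r \<in> ?J" for r
    using vector_derivative_within_closed_interval[OF st(2) _ d[of r]] that by simp
  ultimately show "continuous_on ?J (\<lambda>r. vector_derivative (snd c \<circ> \<gamma>) (at r within {s..t}))"
    by (rule continuous_on_eq)
qed

lemma riem_dist_le_curve_length:
  assumes "C1_curve_on {0..1} \<gamma>"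
  shows "riem_dist (\<gamma> 0) (\<gamma> 1) \<le> ereal (curve_length 0 1 \<gamma>)"
  unfolding riem_dist_def
proof (rule INF_lower)
  have "piecewise_C1_curve_on 0 1 \<gamma>"
    unfolding piecewise_C1_curve_on_def
  proof (intro conjI exI[of _ "{}"] allI impI)
    show "continuous_on {0..1} \<gamma>" using assms by (simp add: C1_curve_on_def)
    show "C1_curve_on {s..t} \<gamma>" if "0 \<le> s \<and> s < t \<and> t \<le> 1 \<and> {s<..<t} \<inter> {} = {}" for s t
      using C1_curve_on_subinterval[OF assms, of s t] that by blast
  qed simp
  then show "\<gamma> \<in> {\<gamma>'. piecewise_C1_curve_on 0 1 \<gamma>' \<and> \<gamma>' 0 = \<gamma> 0 \<and> \<gamma>' 1 = \<gamma> 1}" by simp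
qed

text \<open>In the charts, \<open>G\<close> is the local inverse of the endpoint map \<open>y \<mapsto> exp\<^sub>y(-hX)\<close>.\<close>

lemma GIE_local_inverse:
  assumes K: nonpositive_sectional_curvature and sys: "nonexpansive_system \<U> X \<nu>" and h: "0 < h"
    and xy: "x \<in> \<U>" "y \<in> \<U>" "GIE h X x y" and c: "c \<in> charts_at y" "c' \<in> charts_at x"
  obtains V G where "open V" "snd c' x \<in> V" "G (snd c' x) = snd c y" "Ck_on (Suc 0) G V"
    "\<And>u. u \<in> V \<Longrightarrow> G u \<in> cdom c \<and> cinv c (G u) \<in> \<U> \<and> GIE h X (cinv c' u) (cinv c (G u))"
    "\<And>w. chart_metric c (snd c y) (fderiv G (snd c' x) w) (fderiv G (snd c' x) w)
      \<le> chart_metric c' (snd c' x) w w"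
proof -
  note cA = charts_atD(1)[OF c(1)] charts_atD(1)[OF c(2)]
  have \<U>: "open \<U>" and Xt: "X p \<in> tangent_space p" and mono: "monotonicity_condition \<U> X \<nu>" and \<nu>: "\<nu> \<le> 0" for p
    using sys by (auto simp: nonexpansive_system_def smooth_vfield_on_def)
  let ?u0 = "snd c y" and ?x = "snd c' x"
  let ?Xc = "in_chart c (\<lambda>q. X q c)"
  have XCk: "Ck_on k ?Xc (cdom c)" for k
    using sys cA by (simp add: nonexpansive_system_def smooth_vfield_on_def smooth_on_def cdom_def)
  have u0: "?u0 \<in> cdom c" by (rule chart_in_cdom[OF c(1)])
  have dom: "tscale (- h) (X y) \<in> exp_dom y" and exp: "riem_exp y (tscale (- h) (X y)) = x"
    using xy(3) by (auto simp: GIE_def)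
  obtain \<gamma> W where g: "geodesic_flow_on {0..1} \<gamma> W" and \<gamma>0: "\<gamma> 0 = y" and W0: "W 0 = tscale (- h) (X y)" and \<gamma>1: "\<gamma> 1 = x"
    using exp_domE[OF dom] exp by metis
  obtain N H where fm: "flow_map \<gamma> W 0 c 1 c' N H"
    using flow_map_exists[OF K g, of c c'] c \<gamma>0 \<gamma>1 by auto
  \<comment> \<open>The section \<open>- h X\<close> of the tangent bundle in the chart: it turns a
    point into the initial state of its step, so that \<open>F\<close> below, the base point of
    \<open>H (\<iota> u)\<close>, is the endpoint map.\<close>
  define \<iota> where "\<iota> u = (u, (- h) *\<^sub>R ?Xc u)" for u
  have \<iota>0: "\<iota> ?u0 = (snd c (\<gamma> 0), W 0 c)"
    by (simp add: \<iota>_def \<gamma>0 W0 tscale_def in_chart_eq cinv_chart[OF c(1)])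
  have N: "open N" "\<iota> ?u0 \<in> N" "H (\<iota> ?u0) = (?x, W 1 c')" "Ck_on (Suc 0) H N"
    using fm unfolding flow_map_def \<iota>0 \<gamma>1 by blast+
  have oc: "open (cdom c)" by (rule open_cdom[OF cA(1)])
  have \<iota>C1: "Ck_on (Suc 0) \<iota> (cdom c)"
    unfolding \<iota>_def[abs_def]
    by (rule Ck_on_Pair[OF oc Ck_on_bounded_linear[OF oc bounded_linear_ident]
          Ck_on_linear_comp[OF oc bounded_linear_scaleR_right XCk]])
  define D where "D c = cdom c \<inter> cinv c -` \<U>" for c
  have D: "open (D c)" if "c \<in> A" for c
    unfolding D_def by (rule continuous_open_preimage[OF cinv_continuous[OF that] open_cdom[OF that] \<U>])
  define O1 where "O1 = D c \<inter> \<iota> -` N"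
  have O1sub: "O1 \<subseteq> cdom c" "\<iota> ` O1 \<subseteq> N" by (auto simp: O1_def D_def)
  have O1: "open O1"
    unfolding O1_def
    by (rule continuous_open_preimage[OF continuous_on_subset[OF Ck_on_continuous[OF \<iota>C1]] D[OF cA(1)] N(1)])
      (simp add: D_def)
  define F where "F u = fst (H (\<iota> u))" for u
  have FC1': "Ck_on (Suc 0) F O1"
    unfolding F_def[abs_def]
    by (rule Ck_on_linear_comp[OF O1 bounded_linear_fst Ck_on_compose[OF O1 N(1) O1sub(2) N(4)
            Ck_on_subset[OF \<iota>C1 O1sub(1)]]])
  \<comment> \<open>The starts \<open>u\<close> were confined to \<open>\<U>\<close> so that values
    of the inverse will be candidates for the step in \<open>\<U>\<close>; now the end points
    \<open>F u\<close> are confined likewise.\<close>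
  define O2 where "O2 = O1 \<inter> F -` D c'"
  have O2: "open O2"
    unfolding O2_def by (rule continuous_open_preimage[OF Ck_on_continuous[OF FC1'] O1 D[OF cA(2)]])
  have FC1: "Ck_on (Suc 0) F O2" by (rule Ck_on_subset[OF FC1']) (simp add: O2_def)
  have Fu0: "F ?u0 = ?x" by (simp add: F_def N)
  have u0O2: "?u0 \<in> O2"
    using u0 xy N(2) chart_in_cdom[OF c(2)] by (simp add: O2_def O1_def D_def Fu0 cinv_chart c)
  have gie: "GIE h X (cinv c' (F u)) (cinv c u)" if u: "u \<in> O2" for u
  proof -
    have "\<iota> u \<in> N" using u by (auto simp: O2_def O1_def)
    then obtain \<Gamma> V where \<Gamma>: "geodesic_flow_on {0..1} \<Gamma> V" "c \<in> charts_at (\<Gamma> 0)" "(snd c (\<Gamma> 0), V 0 c) = \<iota> u"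
       "c' \<in> charts_at (\<Gamma> 1)" "(snd c' (\<Gamma> 1), V 1 c') = H (\<iota> u)"
      using fm unfolding flow_map_def by blast
    have e: "snd c (\<Gamma> 0) = u" "V 0 c = (- h) *\<^sub>R ?Xc u" using \<Gamma>(3) by (auto simp: \<iota>_def)
    have p0: "\<Gamma> 0 = cinv c u" using cinv_chart[OF \<Gamma>(2)] e(1) by simp
    have "F u = snd c' (\<Gamma> 1)" unfolding F_def \<Gamma>(5)[symmetric] by simp
    then have p1: "\<Gamma> 1 = cinv c' (F u)" using cinv_chart[OF \<Gamma>(4)] by simp
    \<comment> \<open>The coordinate equation in \<open>c\<close> becomes an equation of tangent
      vectors, so this geodesic is the one that the exponential map follows in a step.\<close>
    have V0: "V 0 = tscale (- h) (X (\<Gamma> 0))"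
    proof (rule tangent_eqI[where p = "\<Gamma> 0" and c = c])
      show "V 0 \<in> tangent_space (\<Gamma> 0)" using geodesic_flow_onD(2)[OF \<Gamma>(1)] by simp
      show "tscale (- h) (X (\<Gamma> 0)) \<in> tangent_space (\<Gamma> 0)" by (rule tscale_tangent[OF Xt])
      show "V 0 c = tscale (- h) (X (\<Gamma> 0)) c" unfolding e(2) by (simp add: tscale_def in_chart_eq p0)
    qed (rule \<Gamma>(2))
    show ?thesis
      using riem_exp_geodesic_flow[OF \<Gamma>(1)] unfolding GIE_def V0 p0 p1 by simp
  qed
  let ?A = "fderiv F ?u0"
  have expand: "chart_metric c ?u0 u u \<le> chart_metric c' ?x (?A u) (?A u)" for u
  proof -
    let ?DX = "fderiv ?Xc ?u0"
    have X: "(?Xc has_derivative ?DX) (at ?u0)" by (rule Ck_on_has_derivative[OF XCk u0])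
    have \<iota>': "(\<iota> has_derivative (\<lambda>u. (u, (- h) *\<^sub>R ?DX u))) (at ?u0)"
      unfolding \<iota>_def[abs_def] by (intro has_derivative_Pair has_derivative_ident has_derivative_scaleR_right X)
    have "(H \<circ> \<iota> has_derivative fderiv H (\<iota> ?u0) \<circ> (\<lambda>u. (u, (- h) *\<^sub>R ?DX u))) (at ?u0)"
      by (rule diff_chain_at[OF \<iota>' Ck_on_has_derivative[OF N(4,2)]])
    from bounded_linear.has_derivative[OF bounded_linear_fst this]
    have "(F has_derivative (\<lambda>u. fst (fderiv H (\<iota> ?u0) (u, (- h) *\<^sub>R ?DX u)))) (at ?u0)"
      by (simp add: F_def[abs_def] comp_def)
    from fun_cong[OF frechet_derivative_at[OF this], of u]
    have F'u: "?A u = fst (fderiv H (\<iota> ?u0) (u, (- h) *\<^sub>R ?DX u))"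
      by simp
    let ?\<zeta> = "(u, (- h) *\<^sub>R ?DX u)"
    note bG = chart_metric_bilinear[OF cA(1) u0] and bC = chart_christoffel_bilinear[OF cA(1) u0]
    let ?v = "coord_vec c y u"
    have v: "?v \<in> tangent_space y" "?v c = u" using coord_vec_tangent[OF c(1)] coord_vec_self[OF c(1)] by auto
    have nc: "nabla y ?v X c = ?DX u + chart_christoffel c ?u0 u (X y c)"
      by (simp add: nabla_chart[OF c(1)] chart_deriv_def v(2))
    have "?Xc differentiable (at ?u0)" using X by (auto simp: differentiable_def)
    then have nt: "nabla y ?v X \<in> tangent_space y"
      by (intro nabla_tangent[OF c(1) open_UNIV UNIV_I Xt _ v(1)])
    have "g y (nabla y ?v X) ?v \<le> \<nu> * (tnorm y ?v)\<^sup>2"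
      using mono xy(2) v(1) unfolding monotonicity_condition_def by blast
    also have "\<dots> \<le> 0" using \<nu> by (simp add: mult_nonpos_nonneg)
    finally have "chart_metric c ?u0 (?DX u + chart_christoffel c ?u0 u (X y c)) u \<le> 0"
      unfolding metric_in_chart[OF c(1) nt v(1)] nc v(2) .
    then have neg: "h * chart_metric c ?u0 (?DX u + chart_christoffel c ?u0 u (X y c)) u \<le> 0"
      using h by (simp add: mult_nonneg_nonpos)
    have "jacobi_slope c (\<iota> ?u0) ?\<zeta> =
        chart_metric c ?u0 u ((- h) *\<^sub>R ?DX u + chart_christoffel c ?u0 ((- h) *\<^sub>R X y c) u)"
      by (simp add: jacobi_slope_def \<iota>_def in_chart_eq cinv_chart[OF c(1)])
    \<comment> \<open>The ordinary derivative of \<open>X\<close> in the variation is completed by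
      the Christoffel term of the slope to \<open>- h \<nabla>\<^sub>u X\<close>, because the
      initial velocity is \<open>- h X\<close> and the symbols are symmetric.\<close>
    also have "(- h) *\<^sub>R ?DX u + chart_christoffel c ?u0 ((- h) *\<^sub>R X y c) u =
        (- h) *\<^sub>R (?DX u + chart_christoffel c ?u0 u (X y c))"
      unfolding bilinear_lmul[OF bC] scaleR_add_right chart_christoffel_sym[OF cA(1) u0, of "X y c"] ..
    also have "chart_metric c ?u0 u \<dots> = - (h * chart_metric c ?u0 (?DX u + chart_christoffel c ?u0 u (X y c)) u)"
      unfolding bilinear_rmul[OF bG] chart_metric_sym[OF cA(1) u0, of u] by simp
    finally have "0 \<le> jacobi_slope c (\<iota> ?u0) ?\<zeta>" using neg by simp
    then have "jacobi_norm c (\<iota> ?u0) ?\<zeta> \<le> jacobi_norm c' (snd c' (\<gamma> 1), W 1 c') (fderiv H (\<iota> ?u0) ?\<zeta>)"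
      using fm unfolding flow_map_def Let_def \<iota>0[symmetric] by blast
    then show ?thesis by (simp add: jacobi_norm_def \<iota>_def F'u \<gamma>1)
  qed
  have Alin: "linear ?A" using Ck_on_has_derivative[OF FC1 u0O2] by (rule has_derivative_linear)
  \<comment> \<open>Expansion and definiteness of the metric exclude a kernel, which is what the
    inverse function theorem asks for in equal dimensions.\<close>
  have "u = 0" if "?A u = 0" for u
  proof (rule ccontr)
    assume "u \<noteq> 0"
    then have "chart_metric c ?u0 u u > 0" by (rule chart_metric_pos[OF cA(1) u0])
    then show False
      using expand[of u] that bilinear_lzero[OF chart_metric_bilinear[OF cA(2) chart_in_cdom[OF c(2)]]] by simp
  qed
  then have Ainj: "inj ?A" using linear_injective_0[OF Alin] by blast
  obtain V G where V: "open V" "F ?u0 \<in> V" "G (F ?u0) = ?u0" "Ck_on (Suc 0) G V"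
    "\<And>u. u \<in> V \<Longrightarrow> G u \<in> O2 \<and> F (G u) = u"
    "\<And>u w. u \<in> V \<Longrightarrow> fderiv F (G u) (fderiv G u w) = w"
    by (rule C1_local_inverse[OF O2 u0O2 FC1 Ainj]) blast
  show thesis
  proof (rule that[OF V(1) _ _ V(4)])
    show "?x \<in> V" "G ?x = ?u0" using V(2,3) Fu0 by simp_all
    show "G u \<in> cdom c \<and> cinv c (G u) \<in> \<U> \<and> GIE h X (cinv c' u) (cinv c (G u))" if u: "u \<in> V" for u
      using V(5)[OF u] gie[of "G u"] by (auto simp: O2_def O1_def D_def)
    fix w
    show "chart_metric c ?u0 (fderiv G ?x w) (fderiv G ?x w) \<le> chart_metric c' ?x w w"
      using expand[of "fderiv G ?x w"] V(6)[OF V(2), of w] V(3) by (simp add: Fu0)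
  qed
qed

text \<open>Around each time \<open>s\<close> a local inverse \<open>G\<close> gives solutions of
  the step in \<open>\<U>\<close> for all nearby points of \<sigma>, and uniqueness identifies them
  with \<phi>. Hence \<phi> \<circ> \<sigma> is, near \<open>s\<close>, a C^1 map of the coordinates
  of \<sigma>. \<open>G\<close> changes with \<open>s\<close>, and its norm estimate is used at
  \<open>s\<close> itself.\<close>

lemma GIE_curve:
  assumes K: nonpositive_sectional_curvature and sys: "nonexpansive_system \<U> X \<nu>" and h: "0 < h"
    and \<phi>: "\<And>x. x \<in> \<U> \<Longrightarrow> \<phi> x \<in> \<U> \<and> GIE h X x (\<phi> x)"
      "\<And>x y. x \<in> \<U> \<Longrightarrow> y \<in> \<U> \<Longrightarrow> GIE h X x y \<Longrightarrow> y = \<phi> x"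
    and \<sigma>: "C1_curve_on {0..1} \<sigma>" "\<sigma> ` {0..1} \<subseteq> \<U>"
  shows "C1_curve_on {0..1} (\<phi> \<circ> \<sigma>)"
    and "\<And>s. s \<in> {0..1} \<Longrightarrow> tnorm ((\<phi> \<circ> \<sigma>) s) (velocity {0..1} (\<phi> \<circ> \<sigma>) s) \<le> tnorm (\<sigma> s) (velocity {0..1} \<sigma> s)"
proof -
  let ?I = "{0..1 :: real}"
  define \<gamma> where "\<gamma> = \<phi> \<circ> \<sigma>"
  let ?V = "velocity ?I \<sigma>"
  have \<sigma>cont: "continuous_on ?I \<sigma>" using \<sigma>(1) by (simp add: C1_curve_on_def)
  \<comment> \<open>Charts and \<open>G\<close> change with \<open>s\<close>, so only what survives
    this is kept: a derivative \<open>D\<close> near \<open>s\<close> that is continuous at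
    \<open>s\<close>, and the norm bound at \<open>s\<close>. This gives both class C^1 and the
    estimate of the speed.\<close>
  have main: "\<exists>D. (\<gamma> \<longlongrightarrow> \<gamma> s) (at s within ?I) \<and> (D \<longlongrightarrow> D s) (at s within ?I) \<and>
      (\<forall>\<^sub>F r in at s within ?I. ((snd c \<circ> \<gamma>) has_vector_derivative D r) (at r within ?I)) \<and>
      ((snd c \<circ> \<gamma>) has_vector_derivative D s) (at s within ?I) \<and>
      chart_metric c (snd c (\<gamma> s)) (D s) (D s) \<le> (tnorm (\<sigma> s) (?V s))\<^sup>2"
    if s: "s \<in> ?I" and c: "c \<in> charts_at (\<gamma> s)" for s c
  proof -
    have \<sigma>s: "\<sigma> s \<in> \<U>" using \<sigma>(2) s by blast
    obtain c' where c': "c' \<in> charts_at (\<sigma> s)" by (rule charts_at_nonempty)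
    have \<gamma>s: "\<gamma> s \<in> \<U>" "GIE h X (\<sigma> s) (\<gamma> s)" using \<phi>(1)[OF \<sigma>s] by (auto simp: \<gamma>_def)
    obtain W G where W: "open W" "snd c' (\<sigma> s) \<in> W" "G (snd c' (\<sigma> s)) = snd c (\<gamma> s)" "Ck_on (Suc 0) G W"
      "\<And>u. u \<in> W \<Longrightarrow> G u \<in> cdom c \<and> cinv c (G u) \<in> \<U> \<and> GIE h X (cinv c' u) (cinv c (G u))"
      "\<And>w. chart_metric c (snd c (\<gamma> s)) (fderiv G (snd c' (\<sigma> s)) w) (fderiv G (snd c' (\<sigma> s)) w)
        \<le> chart_metric c' (snd c' (\<sigma> s)) w w"
      by (rule GIE_local_inverse[OF K sys h \<sigma>s \<gamma>s c c']) blast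
    let ?u = "\<lambda>r. snd c' (\<sigma> r)"
    let ?D = "\<lambda>r. fderiv G (?u r) (?V r c')"
    let ?good = "\<lambda>r. c' \<in> charts_at (\<sigma> r) \<and> ?u r \<in> W"
    have good_s: "?good s" using c' W by simp
    have "\<forall>\<^sub>F r in at s within ?I. ?u r \<in> W"
      using topological_tendstoD[OF C1_curve_chart_tendsto[OF \<sigma>cont s c'] W(1,2)] .
    with eventually_charts_at[OF \<sigma>cont s c'] have good: "\<forall>\<^sub>F r in at s within ?I. ?good r" by (rule eventually_conj)
    have \<gamma>eq: "\<gamma> r = cinv c (G (?u r))" "snd c (\<gamma> r) = G (?u r)" if r: "r \<in> ?I" "?good r" for r
    proof -
      have w: "G (?u r) \<in> cdom c" "cinv c (G (?u r)) \<in> \<U>" "GIE h X (cinv c' (?u r)) (cinv c (G (?u r)))"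
        using W(5)[of "?u r"] r by auto
      have "\<sigma> r \<in> \<U>" using \<sigma>(2) r by blast
      from \<phi>(2)[OF this w(2)] w(3) r show 1: "\<gamma> r = cinv c (G (?u r))"
        by (simp add: \<gamma>_def cinv_chart)
      show "snd c (\<gamma> r) = G (?u r)" unfolding 1 by (rule chart_cinv[OF w(1)])
    qed
    \<comment> \<open>From the filter to an actual interval: the derivative at \<open>r\<close>
      requires the identity with \<open>G\<close> in a neighborhood of \<open>r\<close>.\<close>
    obtain d where d: "d > 0" "\<And>r. r \<in> ?I \<Longrightarrow> \<bar>r - s\<bar> < d \<Longrightarrow> ?good r"
      using eventually_at_within_dist[OF good good_s] by blast
    have deriv: "((snd c \<circ> \<gamma>) has_vector_derivative ?D r) (at r within ?I)" if r: "r \<in> ?I" "\<bar>r - s\<bar> < d" for r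
    proof -
      note gr = d(2)[OF r]
      have v: "(?u has_derivative (\<lambda>h. h *\<^sub>R ?V r c')) (at r within ?I)"
        using C1_curve_velocity_derivative[OF \<sigma>(1) r(1), of c'] gr by (simp add: has_vector_derivative_def)
      have G: "(G has_derivative fderiv G (?u r)) (at (?u r))"
        by (rule Ck_on_has_derivative[OF W(4)]) (use gr in simp)
      have 1: "((\<lambda>q. G (?u q)) has_derivative (\<lambda>h. fderiv G (?u r) (h *\<^sub>R ?V r c'))) (at r within ?I)"
        by (rule has_derivative_compose[OF v G])
      have "((snd c \<circ> \<gamma>) has_derivative (\<lambda>h. fderiv G (?u r) (h *\<^sub>R ?V r c'))) (at r within ?I)"
      proof (rule has_derivative_transform_within[OF 1 _ r(1)])
        show "0 < d - \<bar>r - s\<bar>" using r by simp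
        fix q assume q: "q \<in> ?I" "dist q r < d - \<bar>r - s\<bar>"
        then have "?good q" by (intro d(2)) (auto simp: dist_real_def)
        then show "G (?u q) = (snd c \<circ> \<gamma>) q" using \<gamma>eq(2)[OF q(1)] by simp
      qed
      then show ?thesis
        by (simp add: has_vector_derivative_def linear_scale[OF has_derivative_linear[OF G]])
    qed
    have "\<forall>\<^sub>F r in at s within ?I. r \<in> ?I \<and> \<bar>r - s\<bar> < d"
      using d(1) by (auto simp: eventually_at dist_real_def)
    then have ev: "\<forall>\<^sub>F r in at s within ?I. ((snd c \<circ> \<gamma>) has_vector_derivative ?D r) (at r within ?I)"
      by eventually_elim (simp add: deriv)
    have Giso: "isCont G (?u s)"
      using Ck_on_continuous[OF W(4)] W(1,2) by (simp add: continuous_on_eq_continuous_at)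
    have \<gamma>lim: "(\<gamma> \<longlongrightarrow> \<gamma> s) (at s within ?I)"
    proof -
      have "isCont (cinv c) (G (?u s))"
        using cinv_continuous[OF charts_atD(1)[OF c]] open_cdom[OF charts_atD(1)[OF c]] W(5)[OF W(2)]
        by (simp add: continuous_on_eq_continuous_at)
      then have "((\<lambda>r. cinv c (G (?u r))) \<longlongrightarrow> cinv c (G (?u s))) (at s within ?I)"
        by (rule isCont_tendsto_compose[OF _ isCont_tendsto_compose[OF Giso C1_curve_chart_tendsto[OF \<sigma>cont s c']]])
      moreover have "\<forall>\<^sub>F r in at s within ?I. ?good r \<and> r \<in> ?I"
        using good by (rule eventually_conj) (simp add: eventually_at_filter)
      then have "\<forall>\<^sub>F r in at s within ?I. cinv c (G (?u r)) = \<gamma> r"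
        by eventually_elim (simp only: \<gamma>eq)
      ultimately have "(\<gamma> \<longlongrightarrow> cinv c (G (?u s))) (at s within ?I)" by (rule Lim_transform_eventually)
      then show ?thesis using \<gamma>eq(1)[OF s good_s] by simp
    qed
    have Dlim: "(?D \<longlongrightarrow> ?D s) (at s within ?I)"
    proof -
      let ?S = "W \<times> (UNIV :: 'e set)" and ?f = "\<lambda>z. fderiv G (fst z) (snd z)"
      have S: "open ?S" using W(1) by (auto intro: open_Times)
      have "Ck_on 0 ?f ?S"
      proof (rule Ck_on_linear_family[OF S, where B = "\<lambda>z. fderiv G (fst z)"])
        show "linear (fderiv G (fst z))" if "z \<in> ?S" for z
          using Ck_on_has_derivative[OF W(4), of "fst z"] that by (auto dest: has_derivative_linear)
        have cG: "continuous_on W (\<lambda>u. fderiv G u a)" for a using W(4) by simp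
        show "Ck_on 0 (\<lambda>z. fderiv G (fst z) a) ?S" for a
          unfolding Ck_on.simps
          by (rule continuous_on_compose2[OF cG continuous_on_fst[OF continuous_on_id]]) auto
        show "Ck_on 0 snd ?S" by (simp add: continuous_on_snd continuous_on_id)
      qed
      then have "isCont ?f (?u s, ?V s c')"
        using S W(2) by (simp add: continuous_on_eq_continuous_at)
      from isCont_tendsto_compose[OF this tendsto_Pair[OF C1_curve_chart_tendsto[OF \<sigma>cont s c']
          C1_curve_velocity_tendsto[OF \<sigma>(1) s c']]]
      show ?thesis by simp
    qed
    have Vt: "?V s \<in> tangent_space (\<sigma> s)" by (rule C1_curve_velocity_tangent[OF \<sigma>(1) _ s]) simp
    have "0 \<le> chart_metric c' (?u s) (?V s c') (?V s c')"
      using chart_metric_pos[OF charts_atD(1)[OF c'] chart_in_cdom[OF c'], of "?V s c'"]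
        bilinear_lzero[OF chart_metric_bilinear[OF charts_atD(1)[OF c'] chart_in_cdom[OF c']]]
      by (cases "?V s c' = 0") auto
    then have "(tnorm (\<sigma> s) (?V s))\<^sup>2 = chart_metric c' (?u s) (?V s c') (?V s c')"
      by (simp add: tnorm_in_chart[OF c' Vt])
    then have "chart_metric c (snd c (\<gamma> s)) (?D s) (?D s) \<le> (tnorm (\<sigma> s) (?V s))\<^sup>2"
      using W(6)[of "?V s c'"] by simp
    then show ?thesis using \<gamma>lim Dlim ev deriv[OF s] d(1) by (intro exI[of _ ?D]) auto
  qed
  have \<gamma>cont: "continuous_on ?I \<gamma>"
    unfolding continuous_on_def using main charts_at_nonempty by metis
  have C1: "C1_curve_on ?I \<gamma>"
    unfolding C1_curve_on_def
  proof (intro conjI ballI impI \<gamma>cont)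
    fix c assume c: "c \<in> A"
    show "(snd c \<circ> \<gamma>) differentiable (at t within ?I)" if t: "t \<in> ?I" "\<gamma> t \<in> fst c" for t
      using main[OF t(1) charts_atI[OF c t(2)]] by (auto simp: has_vector_derivative_def differentiable_def)
    let ?J = "{t \<in> ?I. \<gamma> t \<in> fst c}" and ?d = "\<lambda>t. vector_derivative (snd c \<circ> \<gamma>) (at t within ?I)"
    have vd: "?d r = D" if "r \<in> ?I" "((snd c \<circ> \<gamma>) has_vector_derivative D) (at r within ?I)" for r D
      by (rule vector_derivative_within_closed_interval[OF _ that]) simp
    have "(?d \<longlongrightarrow> ?d s) (at s within ?J)" if s: "s \<in> ?J" for s
    proof -
      have sI: "s \<in> ?I" using s by simp
      obtain D where D: "(D \<longlongrightarrow> D s) (at s within ?I)"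
        "\<forall>\<^sub>F r in at s within ?I. ((snd c \<circ> \<gamma>) has_vector_derivative D r) (at r within ?I)"
        "((snd c \<circ> \<gamma>) has_vector_derivative D s) (at s within ?I)"
        using main[OF sI charts_atI[OF c]] s by blast
      have "\<forall>\<^sub>F r in at s within ?I. ((snd c \<circ> \<gamma>) has_vector_derivative D r) (at r within ?I) \<and> r \<in> ?I"
        using D(2) by (rule eventually_conj) (simp add: eventually_at_filter)
      then have "\<forall>\<^sub>F r in at s within ?I. D r = ?d r"
        by eventually_elim (metis vd)
      from Lim_transform_eventually[OF D(1) this] have "(?d \<longlongrightarrow> ?d s) (at s within ?I)"
        using vd[OF sI D(3)] by simp
      then show ?thesis by (rule tendsto_within_subset) auto
    qed
    then show "continuous_on ?J ?d" by (simp add: continuous_on_def)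
  qed
  then show "C1_curve_on ?I (\<phi> \<circ> \<sigma>)" by (simp add: \<gamma>_def)
  fix s assume s: "s \<in> ?I"
  obtain c where c: "c \<in> charts_at (\<gamma> s)" by (rule charts_at_nonempty)
  obtain D where D: "((snd c \<circ> \<gamma>) has_vector_derivative D s) (at s within ?I)"
    "chart_metric c (snd c (\<gamma> s)) (D s) (D s) \<le> (tnorm (\<sigma> s) (?V s))\<^sup>2"
    using main[OF s c] by blast
  have "velocity ?I \<gamma> s c = D s"
    using vector_derivative_within_closed_interval[OF _ s D(1)] c by (simp add: velocity_def)
  then have "tnorm (\<gamma> s) (velocity ?I \<gamma> s) = sqrt (chart_metric c (snd c (\<gamma> s)) (D s) (D s))"
    using tnorm_in_chart[OF c C1_curve_velocity_tangent[OF C1 _ s]] by simp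
  also have "\<dots> \<le> sqrt ((tnorm (\<sigma> s) (?V s))\<^sup>2)" by (rule real_sqrt_le_mono[OF D(2)])
  also have "\<dots> = tnorm (\<sigma> s) (?V s)"
  proof -
    have "?V s \<in> tangent_space (\<sigma> s)" by (rule C1_curve_velocity_tangent[OF \<sigma>(1) _ s]) simp
    \<comment> \<open>At the zero vector the value is 0 by homogeneity, as positivity speaks of
      nonzero vectors.\<close>
    then have "0 \<le> g (\<sigma> s) (?V s) (?V s)"
      using metric_pos[of "?V s" "\<sigma> s"] metric_scale[of "?V s" "\<sigma> s" "?V s" 0]
      by (cases "?V s = (\<lambda>c. 0)") (auto simp: tscale_def)
    then show ?thesis by (simp add: tnorm_def)
  qed
  finally show "tnorm ((\<phi> \<circ> \<sigma>) s) (velocity {0..1} (\<phi> \<circ> \<sigma>) s) \<le> tnorm (\<sigma> s) (?V s)"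
    by (simp add: \<gamma>_def)
qed

lemma GIE_B_stable:
  assumes K: nonpositive_sectional_curvature and wd: "well_defined_invariant GIE"
  shows "B_stable GIE"
  unfolding B_stable_def
proof (intro allI impI ballI)
  fix \<U> X \<nu> and h :: real and x0 y0
  assume sys: "nonexpansive_system \<U> X \<nu>" and h: "0 < h" and xy: "x0 \<in> \<U>" "y0 \<in> \<U>"
  let ?\<phi> = "method_map GIE h X \<U>"
  have ex1: "\<exists>!y. y \<in> \<U> \<and> GIE h X x y" if "x \<in> \<U>" for x
    using wd sys h that unfolding well_defined_invariant_def by blast
  have \<phi>: "?\<phi> x \<in> \<U> \<and> GIE h X x (?\<phi> x)" if "x \<in> \<U>" for x
    unfolding method_map_def by (rule theI'[OF ex1[OF that]])
  have \<phi>': "y = ?\<phi> x" if "x \<in> \<U>" "y \<in> \<U>" "GIE h X x y" for x y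
    using ex1[OF that(1)] \<phi>[OF that(1)] that by blast
  \<comment> \<open>Geodesic convexity supplies a minimizer that stays in \<open>\<U>\<close>, where
    the step is defined.\<close>
  obtain \<sigma> where \<sigma>: "minimizing_geodesic \<sigma> x0 y0" "\<sigma> ` {0..1} \<subseteq> \<U>"
    using sys xy unfolding nonexpansive_system_def geodesically_convex_def by blast
  have \<sigma>C1: "C1_curve_on {0..1} \<sigma>" and ends: "\<sigma> 0 = x0" "\<sigma> 1 = y0"
    and len: "ereal (curve_length 0 1 \<sigma>) = riem_dist x0 y0"
    using \<sigma>(1) by (auto simp: minimizing_geodesic_def geodesic_on_def)
  note \<gamma> = GIE_curve[OF K sys h \<phi> \<phi>' \<sigma>C1 \<sigma>(2)]
  \<comment> \<open>The image curve is one competitor in the infimum that defines the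
    distance.\<close>
  have "riem_dist (?\<phi> x0) (?\<phi> y0) \<le> ereal (curve_length 0 1 (?\<phi> \<circ> \<sigma>))"
    using riem_dist_le_curve_length[OF \<gamma>(1)] by (simp add: ends)
  also have "curve_length 0 1 (?\<phi> \<circ> \<sigma>) \<le> curve_length 0 1 \<sigma>"
    unfolding curve_length_def
    by (intro integral_le integrable_continuous_interval C1_curve_speed_continuous \<gamma> \<sigma>C1) simp_all
  finally show "riem_dist (?\<phi> x0) (?\<phi> y0) \<le> riem_dist x0 y0" by (simp add: len)
qed

end

theorem theorem3p1:
  fixes A :: "('a::{t2_space, second_countable_topology}, 'e::euclidean_space) chart set"
    and g :: "'a \<Rightarrow> ('a, 'e) tvec \<Rightarrow> ('a, 'e) tvec \<Rightarrow> real"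
  assumes "riemannian_manifold A g"
    and "riemannian_manifold.nonpositive_sectional_curvature A g"
    and "riemannian_manifold.well_defined_invariant A g (riemannian_manifold.GIE A g)"
  shows "riemannian_manifold.B_stable A g (riemannian_manifold.GIE A g)"
  using riemannian_manifold.GIE_B_stable[OF assms] .

end
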